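(* Let $(S, P)$ be a c.n.u. $\Gamma$-contraction on a Hilbert space $\mathcal{H}$, and let $$S \cong \mathbf{P}_{\mathcal{Q}_P} \big((A+A^*M_z) \oplus U\big)\big|_{\mathcal{Q}_P},$$ where $A\in\mathcal{B}(\mathcal{D}_{P^*})$, $w(A)\le1$, and $U\in\mathcal{B}(\overline{\Delta_P L^2_{\mathcal{D}_P}(\mathbb{T})})$ is such that $(U,M_{e^{it}})$ is a $\Gamma$-unitary. Then the representing operators $A$ and $U$ are unique. That is, if $$S \cong \mathbf{P}_{\mathcal{Q}_P} \big((\tilde{A} + \tilde{A}^* M_z) \oplus \tilde{U}\big)\big|_{\mathcal{Q}_P},$$ where $\tilde{A} \in \mathcal{B}(\mathcal{D}_{P^*})$, $w(\tilde{A}) \leq 1$, $\tilde{U} \in \mathcal{B}(\overline{\Delta_P L^2_{\mathcal{D}_P}(\mathbb{T})})$ and $(\tilde{U}, M_{e^{it}})$ is a $\Gamma$-unitary, then $A \cong \tilde{A}$ and $U \cong \tilde{U}$ (unitary equivalence). Moreover, $$\big((A + A^* M_z) \oplus U,\ M_z \oplus M_{e^{it}}\big)$$ on $\mathcal{H}_P$ is the minimal isometric dilation of the $\Gamma$-contraction $(S, P)$.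
   Context: All Hilbert spaces are complex and separable; $H^2_{\mathcal{E}}(\mathbb{D})$ is the $\mathcal{E}$-valued Hardy space, identified with $H^2(\mathbb{D})\otimes\mathcal{E}$; $A+A^*M_z$ means $I_{H^2(\mathbb{D})}\otimes A+M_z\otimes A^*$; $w(A)=\sup\{|\langle Ah,h\rangle|:\|h\|\le1\}$ is the numerical radius; $\mathbf{P}_{\mathcal{S}}$ is the orthogonal projection onto $\mathcal{S}$. $\Gamma=\{(z_1+z_2,z_1z_2):|z_1|,|z_2|\le1\}$. A commuting pair $(S,P)$ is a $\Gamma$-contraction if $\|p(S,P)\|\le\sup_{\Gamma}|p|$ for all $p\in\mathbb{C}[z_1,z_2]$. It is a $\Gamma$-unitary if $S,P$ are normal and their joint spectrum lies in the distinguished boundary $\{(z_1+z_2,z_1z_2):|z_1|=|z_2|=1\}$ of $\Gamma$; a $\Gamma$-isometry if it has a $\Gamma$-unitary extension. A contraction $P$ is completely non-unitary (c.n.u.) if there is no nonzero $P$-reducing subspace on which $P$ is unitary; a $\Gamma$-contraction $(S,P)$ is c.n.u. if $P$ is. Sz.-Nagy--Foias model. $D_P=(I-P^*P)^{1/2}$, $D_{P^*}=(I-PP^* )^{1/2}$, $\mathcal{D}_P=\overline{\mathrm{ran}\,D_P}$, $\mathcal{D}_{P^*}=\overline{\mathrm{ran}\,D_{P^*}}$. $\Theta_P(z)=[-P+zD_{P^*}(I-zP^* )^{-1}D_P]|_{\mathcal{D}_P}$, $z\in\mathbb{D}$, and $\Delta_P(t)=[I_{\mathcal{D}_P}-\Theta_P(e^{it})^*\Theta_P(e^{it})]^{1/2}$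 for a.e. $e^{it}\in\mathbb{T}$, acting on $L^2_{\mathcal{D}_P}(\mathbb{T})$. $\mathcal{H}_P=H^2_{\mathcal{D}_{P^*}}(\mathbb{D})\oplus\overline{\Delta_PL^2_{\mathcal{D}_P}(\mathbb{T})}$, $\mathcal{S}_P=\{\Theta_Pf\oplus\Delta_Pf:f\in H^2_{\mathcal{D}_P}(\mathbb{D})\}$, $\mathcal{Q}_P=\mathcal{H}_P\ominus\mathcal{S}_P$. $M_{e^{it}}$ denotes the restriction of multiplication by $e^{it}$ to $\overline{\Delta_PL^2_{\mathcal{D}_P}(\mathbb{T})}$. $\Pi_{NF}:\mathcal{H}\to\mathcal{H}_P$ is the Sz.-Nagy--Foias minimal isometric dilation of $P$: an isometry with range $\mathcal{Q}_P$, $\Pi_{NF}P^*=(M_z\oplus M_{e^{it}})^*\Pi_{NF}$, and $\mathcal{H}_P=\overline{\mathrm{span}}\{(M_z\oplus M_{e^{it}})^m\Pi_{NF}\mathcal{H}:m\ge0\}$. For $T$ on $\mathcal{Q}_P$, $S\cong T$ means that $S$ is carried to $T$ by the unitary $\Pi_{NF}:\mathcal{H}\to\mathcal{Q}_P$, which carries $P$ to $\mathbf{P}_{\mathcal{Q}_P}(M_z\oplus M_{e^{it}})|_{\mathcal{Q}_P}$. A $\Gamma$-isometry $(\tilde S,\tilde P)$ on $\mathcal{K}$ is a minimal isometric dilation of $(S,P)$ if there is an isometry $\Pi:\mathcal{H}\to\mathcal{K}$ with $\Pi S^*=\tilde S^*\Pi$, $\Pi P^*=\tilde P^*\Pi$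 and $\mathcal{K}=\overline{\mathrm{span}}\{\tilde P^m\Pi\mathcal{H}:m\ge0\}$; here $\Pi=\Pi_{NF}$. *)

theory Defs
  imports "HOL-Analysis.Analysis" "HOL-Probability.Probability_Measure"
    "HOL-Computational_Algebra.Polynomial" "HOL-Library.Nonpos_Ints"
begin

section \<open>Complex Hilbert spaces\<close>

class scaleC =
  fixes scaleC :: "complex \<Rightarrow> 'a \<Rightarrow> 'a" (infixr "*\<^sub>C" 75)

text \<open>The complex inner product is linear in the first argument.  The real inner product
  (hence the norm and the topology) is its real part.\<close>

class complex_inner = real_inner + scaleC +
  fixes cinner :: "'a \<Rightarrow> 'a \<Rightarrow> complex"
  assumes scaleC_add_right: "c *\<^sub>C (x + y) = c *\<^sub>C x + c *\<^sub>C y"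
    and scaleC_add_left: "(c + d) *\<^sub>C x = c *\<^sub>C x + d *\<^sub>C x"
    and scaleC_scaleC: "c *\<^sub>C d *\<^sub>C x = (c * d) *\<^sub>C x"
    and scaleR_scaleC: "r *\<^sub>R x = complex_of_real r *\<^sub>C x"
    and cinner_commute: "cinner x y = cnj (cinner y x)"
    and cinner_add_left: "cinner (x + y) z = cinner x z + cinner y z"
    and cinner_scaleC_left: "cinner (c *\<^sub>C x) y = c * cinner x y"
    and Re_cinner: "Re (cinner x y) = inner x y"

class chilbert_space = complex_inner + banach

lemma scaleC_one [simp]: "1 *\<^sub>C (x::'a::complex_inner) = x"
  using scaleR_scaleC[of 1 x] by simp

lemma norm_scaleC: "norm (c *\<^sub>C (x::'a::complex_inner)) = cmod c * norm x"
proof -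
  have self: "cinner y y = complex_of_real ((norm y)\<^sup>2)" for y :: 'a
    using cinner_commute[of y y] Re_cinner[of y y]
    by (simp add: complex_eq_iff power2_norm_eq_inner)
  have "cinner (c *\<^sub>C x) (c *\<^sub>C x) = c * cnj c * cinner x x"
    by (metis (no_types, lifting) cinner_commute cinner_scaleC_left complex_cnj_mult mult.assoc)
  then have "complex_of_real ((norm (c *\<^sub>C x))\<^sup>2) = complex_of_real ((cmod c * norm x)\<^sup>2)"
    unfolding self by (simp add: complex_norm_square[symmetric] power_mult_distrib)
  then have "(norm (c *\<^sub>C x))\<^sup>2 = (cmod c * norm x)\<^sup>2"
    using of_real_eq_iff by blast
  then show ?thesis
    by (meson mult_nonneg_nonneg norm_ge_zero power2_eq_imp_eq)
qed

lemma bounded_linear_scaleC: "bounded_linear (\<lambda>x::'a::complex_inner. c *\<^sub>C x)"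
  by (rule bounded_linear_intro[where K = "cmod c"])
    (auto simp: scaleC_add_right scaleR_scaleC scaleC_scaleC norm_scaleC mult.commute)

instantiation complex :: chilbert_space
begin
definition scaleC_complex :: "complex \<Rightarrow> complex \<Rightarrow> complex" where "scaleC_complex c x = c * x"
definition cinner_complex :: "complex \<Rightarrow> complex \<Rightarrow> complex" where "cinner_complex x y = x * cnj y"
instance
  by standard
    (auto simp: scaleC_complex_def cinner_complex_def algebra_simps inner_complex_def
      scaleR_conv_of_real)
end

instantiation prod :: (complex_inner, complex_inner) complex_inner
begin
definition scaleC_prod :: "complex \<Rightarrow> 'a \<times> 'b \<Rightarrow> 'a \<times> 'b"
  where "scaleC_prod c x = (c *\<^sub>C fst x, c *\<^sub>C snd x)"
definition cinner_prod :: "'a \<times> 'b \<Rightarrow> 'a \<times> 'b \<Rightarrow> complex"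
  where "cinner_prod x y = cinner (fst x) (fst y) + cinner (snd x) (snd y)"
instance
proof
  fix x y :: "'a \<times> 'b"
  show "cinner x y = cnj (cinner y x)"
    unfolding cinner_prod_def complex_cnj_add
    using cinner_commute[of "fst x" "fst y"] cinner_commute[of "snd x" "snd y"] by simp
qed (auto simp: scaleC_prod_def cinner_prod_def scaleC_add_right scaleC_add_left scaleC_scaleC
      scaleR_scaleC cinner_add_left cinner_scaleC_left Re_cinner inner_prod_def
      prod_eq_iff algebra_simps)
end


section \<open>Operators on subspaces\<close>

text \<open>A Hilbert space that occurs as a closed subspace \<open>K\<close> of an ambient type is given by its
  carrier, and an operator on \<open>K\<close> is a function on the ambient type of which only the values
  on \<open>K\<close> matter.\<close>

definition csubspace :: "'a::complex_inner set \<Rightarrow> bool" where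
  "csubspace V \<longleftrightarrow> 0 \<in> V \<and> (\<forall>x\<in>V. \<forall>y\<in>V. x + y \<in> V) \<and> (\<forall>c. \<forall>x\<in>V. c *\<^sub>C x \<in> V)"

abbreviation cspan :: "'a::complex_inner set \<Rightarrow> 'a set" where
  "cspan X \<equiv> csubspace hull X"

definition clinear_on :: "'a::complex_inner set \<Rightarrow> 'b::complex_inner set \<Rightarrow> ('a \<Rightarrow> 'b) \<Rightarrow> bool" where
  "clinear_on K L T \<longleftrightarrow> (\<forall>x\<in>K. T x \<in> L) \<and> (\<forall>x\<in>K. \<forall>y\<in>K. T (x + y) = T x + T y) \<and>
     (\<forall>c. \<forall>x\<in>K. T (c *\<^sub>C x) = c *\<^sub>C T x)"

definition bounded_op_on :: "'a::complex_inner set \<Rightarrow> ('a \<Rightarrow> 'a) \<Rightarrow> bool" where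
  "bounded_op_on K T \<longleftrightarrow> clinear_on K K T \<and> (\<exists>B. \<forall>x\<in>K. norm (T x) \<le> B * norm x)"

definition isometry_on :: "'a::complex_inner set \<Rightarrow> 'b::complex_inner set \<Rightarrow> ('a \<Rightarrow> 'b) \<Rightarrow> bool" where
  "isometry_on K L V \<longleftrightarrow> clinear_on K L V \<and> (\<forall>x\<in>K. norm (V x) = norm x)"

text \<open>Adjoint of an operator with domain \<open>K\<close>, taking values in \<open>K\<close>.\<close>

definition adj_on :: "'a::complex_inner set \<Rightarrow> ('a \<Rightarrow> 'b::complex_inner) \<Rightarrow> 'b \<Rightarrow> 'a" where
  "adj_on K T y = (THE x. x \<in> K \<and> (\<forall>k\<in>K. cinner (T k) y = cinner k x))"

abbreviation adj :: "('a::complex_inner \<Rightarrow> 'b::complex_inner) \<Rightarrow> 'b \<Rightarrow> 'a" where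
  "adj \<equiv> adj_on UNIV"

definition proj :: "'a::complex_inner set \<Rightarrow> 'a \<Rightarrow> 'a" where
  "proj K x = (THE y. y \<in> K \<and> (\<forall>k\<in>K. cinner (x - y) k = 0))"

definition normal_on :: "'a::complex_inner set \<Rightarrow> ('a \<Rightarrow> 'a) \<Rightarrow> bool" where
  "normal_on K N \<longleftrightarrow> (\<forall>x\<in>K. N (adj_on K N x) = adj_on K N (N x))"

definition positive_on :: "'a::complex_inner set \<Rightarrow> ('a \<Rightarrow> 'a) \<Rightarrow> bool" where
  "positive_on K R \<longleftrightarrow> bounded_op_on K R \<and> (\<forall>x\<in>K. cinner (R x) x \<in> \<real>\<^sub>\<ge>\<^sub>0)"

text \<open>The positive square root of a positive operator on \<open>K\<close>; its values on \<open>K\<close> are uniquely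
  determined.\<close>

definition pos_sqrt_on :: "'a::complex_inner set \<Rightarrow> ('a \<Rightarrow> 'a) \<Rightarrow> 'a \<Rightarrow> 'a" where
  "pos_sqrt_on K T = (SOME R. positive_on K R \<and> (\<forall>x\<in>K. R (R x) = T x))"

definition numerical_radius_on :: "'a::complex_inner set \<Rightarrow> ('a \<Rightarrow> 'a) \<Rightarrow> real" where
  "numerical_radius_on K A = Sup {cmod (cinner (A h) h) | h. h \<in> K \<and> norm h \<le> 1}"

definition unitarily_equiv_on :: "'a::complex_inner set \<Rightarrow> ('a \<Rightarrow> 'a) \<Rightarrow> ('a \<Rightarrow> 'a) \<Rightarrow> bool" where
  "unitarily_equiv_on K A B \<longleftrightarrow>
     (\<exists>W. isometry_on K K W \<and> W ` K = K \<and> (\<forall>x\<in>K. W (A x) = B (W x)))"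


section \<open>Vector-valued Hardy space of the disc\<close>

text \<open>The element with coefficients \<open>a\<close> is the function \<open>z \<mapsto> (\<Sum>n. z ^ n *\<^sub>C a n)\<close> on the unit
  disc (see \<open>hardy_eval\<close>); the scalar space \<open>complex hardy\<close> is also \<open>\<ell>\<^sup>2\<close> of the natural numbers.\<close>

typedef (overloaded) 'a hardy = "{a :: nat \<Rightarrow> 'a::complex_inner. summable (\<lambda>n. (norm (a n))\<^sup>2)}"
  morphisms coef Abs_hardy
  by (rule exI[of _ "\<lambda>_. 0"]) simp

setup_lifting type_definition_hardy

lemma summable_norm_mult:
  assumes "summable (\<lambda>n. (norm (a n :: 'a::complex_inner))\<^sup>2)" "summable (\<lambda>n. (norm (b n :: 'a))\<^sup>2)"
  shows "summable (\<lambda>n. norm (a n) * norm (b n))"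
proof (rule summable_comparison_test'[OF summable_add[OF assms]])
  fix n
  have "2 * (norm (a n) * norm (b n)) \<le> (norm (a n))\<^sup>2 + (norm (b n))\<^sup>2"
    using sum_squares_bound[of "norm (a n)" "norm (b n)"] by (simp add: mult.assoc)
  moreover have "0 \<le> norm (a n) * norm (b n)" by simp
  ultimately show "norm (norm (a n) * norm (b n)) \<le> (norm (a n))\<^sup>2 + (norm (b n))\<^sup>2"
    unfolding real_norm_def by linarith
qed

lemma norm_add_sq_le: "(norm (x + y :: 'a::real_normed_vector))\<^sup>2 \<le> 2 * (norm x)\<^sup>2 + 2 * (norm y)\<^sup>2"
proof -
  have "(norm (x + y))\<^sup>2 \<le> (norm x + norm y)\<^sup>2"
    by (simp add: norm_triangle_ineq power_mono)
  also have "\<dots> \<le> 2 * (norm x)\<^sup>2 + 2 * (norm y)\<^sup>2"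
    using sum_squares_bound[of "norm x" "norm y"] by (simp add: power2_sum)
  finally show ?thesis .
qed

lemma summable_norm_add:
  assumes "summable (\<lambda>n. (norm (a n :: 'a::complex_inner))\<^sup>2)" "summable (\<lambda>n. (norm (b n :: 'a))\<^sup>2)"
  shows "summable (\<lambda>n. (norm (a n + b n))\<^sup>2)"
  by (rule summable_comparison_test'[OF summable_add[OF summable_mult[OF assms(1), of 2]
        summable_mult[OF assms(2), of 2]]]) (use norm_add_sq_le in auto)

lemma cmod_cinner_le: "cmod (cinner x y) \<le> norm x * norm (y::'a::complex_inner)"
proof (cases "cinner x y = 0")
  case False
  define u where "u = cnj (cinner x y) / cmod (cinner x y)"
  have u: "cmod u = 1" using False by (simp add: u_def norm_divide)
  have "u * cinner x y = cmod (cinner x y)"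
    using False by (simp add: u_def complex_norm_square[symmetric] mult.commute power2_eq_square)
  then have "cmod (cinner x y) = Re (cinner (u *\<^sub>C x) y)"
    by (simp add: cinner_scaleC_left)
  also have "\<dots> \<le> norm (u *\<^sub>C x) * norm y"
    unfolding Re_cinner by (rule norm_cauchy_schwarz)
  finally show ?thesis by (simp add: norm_scaleC u)
qed simp

lemma summable_cinner:
  assumes "summable (\<lambda>n. (norm (a n :: 'a::complex_inner))\<^sup>2)" "summable (\<lambda>n. (norm (b n :: 'a))\<^sup>2)"
  shows "summable (\<lambda>n. cinner (a n) (b n))"
  by (rule summable_comparison_test'[OF summable_norm_mult[OF assms]]) (rule cmod_cinner_le)

instantiation hardy :: (complex_inner) complex_inner
begin

lift_definition zero_hardy :: "'a hardy" is "\<lambda>_. 0" by simp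
lift_definition plus_hardy :: "'a hardy \<Rightarrow> 'a hardy \<Rightarrow> 'a hardy" is "\<lambda>a b n. a n + b n"
  by (rule summable_norm_add)
lift_definition uminus_hardy :: "'a hardy \<Rightarrow> 'a hardy" is "\<lambda>a n. - a n" by simp
lift_definition minus_hardy :: "'a hardy \<Rightarrow> 'a hardy \<Rightarrow> 'a hardy" is "\<lambda>a b n. a n - b n"
  subgoal for a b using summable_norm_add[of a "\<lambda>n. - b n"] by simp done
lift_definition scaleC_hardy :: "complex \<Rightarrow> 'a hardy \<Rightarrow> 'a hardy" is "\<lambda>c a n. c *\<^sub>C a n"
  by (simp add: norm_scaleC power_mult_distrib summable_mult)
definition scaleR_hardy :: "real \<Rightarrow> 'a hardy \<Rightarrow> 'a hardy"
  where "scaleR_hardy r f = complex_of_real r *\<^sub>C f"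
lift_definition cinner_hardy :: "'a hardy \<Rightarrow> 'a hardy \<Rightarrow> complex"
  is "\<lambda>a b. \<Sum>n. cinner (a n) (b n)" .
definition inner_hardy :: "'a hardy \<Rightarrow> 'a hardy \<Rightarrow> real"
  where "inner_hardy f g = Re (cinner f g)"
definition norm_hardy :: "'a hardy \<Rightarrow> real" where "norm_hardy f = sqrt (inner f f)"
definition sgn_hardy :: "'a hardy \<Rightarrow> 'a hardy" where "sgn_hardy f = scaleR (inverse (norm f)) f"
definition dist_hardy :: "'a hardy \<Rightarrow> 'a hardy \<Rightarrow> real" where "dist_hardy f g = norm (f - g)"
definition uniformity_hardy :: "('a hardy \<times> 'a hardy) filter"
  where "uniformity_hardy = (INF e\<in>{0<..}. principal {(x, y). dist x y < e})"
definition open_hardy :: "'a hardy set \<Rightarrow> bool"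
  where "open_hardy U = (\<forall>x\<in>U. eventually (\<lambda>(x', y). x' = x \<longrightarrow> y \<in> U) uniformity)"

instance
proof
  fix f g h :: "'a hardy" and r s :: real and c d :: complex
  show "f + g + h = f + (g + h)" by transfer (simp add: add.assoc)
  show "f + g = g + f" by transfer (simp add: add.commute)
  show "0 + f = f" by transfer simp
  show "- f + f = 0" by transfer simp
  show "f - g = f + - g" by transfer simp
  show C1: "c *\<^sub>C (f + g) = c *\<^sub>C f + c *\<^sub>C g" for f g :: "'a hardy" and c
    by transfer (simp add: scaleC_add_right)
  show C2: "(c + d) *\<^sub>C f = c *\<^sub>C f + d *\<^sub>C f" for c d by transfer (simp add: scaleC_add_left)
  show C3: "c *\<^sub>C d *\<^sub>C f = (c * d) *\<^sub>C f" for c d by transfer (simp add: scaleC_scaleC)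
  show "r *\<^sub>R f = complex_of_real r *\<^sub>C f" by (rule scaleR_hardy_def)
  show "r *\<^sub>R (f + g) = r *\<^sub>R f + r *\<^sub>R g" unfolding scaleR_hardy_def by (rule C1)
  show "(r + s) *\<^sub>R f = r *\<^sub>R f + s *\<^sub>R f" unfolding scaleR_hardy_def by (simp add: C2)
  show "r *\<^sub>R s *\<^sub>R f = (r * s) *\<^sub>R f" unfolding scaleR_hardy_def by (simp add: C3)
  show "1 *\<^sub>R f = f" unfolding scaleR_hardy_def
    by transfer simp
  show "sgn f = scaleR (inverse (norm f)) f" by (rule sgn_hardy_def)
  show "dist f g = norm (f - g)" by (rule dist_hardy_def)
  show "uniformity = (INF e\<in>{0<..}. principal {(x::'a hardy, y). dist x y < e})"
    by (rule uniformity_hardy_def)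
  show "open U = (\<forall>x\<in>U. eventually (\<lambda>(x', y). x' = x \<longrightarrow> y \<in> U) uniformity)" for U :: "'a hardy set"
    by (rule open_hardy_def)
  show comm: "cinner f g = cnj (cinner g f)" for f g :: "'a hardy"
  proof transfer
    fix a b :: "nat \<Rightarrow> 'a"
    assume "summable (\<lambda>n. (norm (a n))\<^sup>2)" "summable (\<lambda>n. (norm (b n))\<^sup>2)"
    then have "(\<lambda>n. cinner (b n) (a n)) sums (\<Sum>n. cinner (b n) (a n))"
      by (intro summable_sums summable_cinner)
    then have "(\<lambda>n. cnj (cinner (b n) (a n))) sums cnj (\<Sum>n. cinner (b n) (a n))"
      by (simp only: sums_cnj)
    then show "(\<Sum>n. cinner (a n) (b n)) = cnj (\<Sum>n. cinner (b n) (a n))"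
      unfolding cinner_commute[of "a _" "b _"] by (rule sums_unique[symmetric])
  qed
  show add: "cinner (f + g) h = cinner f h + cinner g h"
    by transfer (simp add: cinner_add_left suminf_add[symmetric] summable_cinner)
  show scale: "cinner (c *\<^sub>C f) g = c * cinner f g" for c and f g :: "'a hardy"
    by transfer (simp add: cinner_scaleC_left suminf_mult summable_cinner)
  show "Re (cinner f g) = inner f g" by (simp add: inner_hardy_def)
  show "inner f g = inner g f" unfolding inner_hardy_def by (subst comm) simp
  show "inner (f + g) h = inner f h + inner g h" by (simp add: inner_hardy_def add)
  show "inner (r *\<^sub>R f) g = r * inner f g" by (simp add: inner_hardy_def scaleR_hardy_def scale)
  have eq: "inner f f = (\<Sum>n. (norm (coef f n))\<^sup>2)"
    unfolding inner_hardy_def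
  proof transfer
    fix a :: "nat \<Rightarrow> 'a"
    assume "summable (\<lambda>n. (norm (a n))\<^sup>2)"
    then have "summable (\<lambda>n. cinner (a n) (a n))" by (intro summable_cinner)
    then have "Re (\<Sum>n. cinner (a n) (a n)) = (\<Sum>n. Re (cinner (a n) (a n)))"
      by (rule bounded_linear.suminf[OF bounded_linear_Re])
    then show "Re (\<Sum>n. cinner (a n) (a n)) = (\<Sum>n. (norm (a n))\<^sup>2)"
      by (simp add: Re_cinner power2_norm_eq_inner)
  qed
  have summ: "summable (\<lambda>n. (norm (coef f n))\<^sup>2)" by transfer
  show "0 \<le> inner f f" unfolding eq by (rule suminf_nonneg[OF summ]) simp
  show "inner f f = 0 \<longleftrightarrow> f = 0"
    unfolding eq suminf_eq_zero_iff[OF summ zero_le_power2]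
    by transfer (auto simp: fun_eq_iff)
  show "norm f = sqrt (inner f f)" by (rule norm_hardy_def)
qed

end

definition hardy_eval :: "'a::complex_inner hardy \<Rightarrow> complex \<Rightarrow> 'a" where
  "hardy_eval f z = (\<Sum>n. z ^ n *\<^sub>C coef f n)"

text \<open>For closed subspaces \<open>E\<close>, these are the functions with values in \<open>E\<close>.\<close>

definition hardy_in :: "'a::complex_inner set \<Rightarrow> 'a hardy set" where
  "hardy_in E = {f. \<forall>n. coef f n \<in> E}"

text \<open>\<open>M\<^sub>z\<close>, and \<open>I \<otimes> A\<close> for a bounded operator \<open>A\<close> on a subspace \<open>E\<close>
  (to be applied to elements of \<open>hardy_in E\<close>).\<close>

lift_definition hardy_Mz :: "'a::complex_inner hardy \<Rightarrow> 'a hardy"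
  is "\<lambda>a n. case n of 0 \<Rightarrow> 0 | Suc m \<Rightarrow> a m"
  by (subst summable_Suc_iff[symmetric]) simp

definition hardy_tensor :: "('a \<Rightarrow> 'a) \<Rightarrow> 'a::complex_inner hardy \<Rightarrow> 'a hardy" where
  "hardy_tensor A f = Abs_hardy (\<lambda>n. A (coef f n))"


section \<open>Vector-valued \<open>L\<^sup>2\<close> of the circle\<close>

text \<open>Functions on the circle are functions of the angle \<open>t \<in> [0, 2\<pi>]\<close>, with normalized
  Lebesgue measure; their values at other \<open>t\<close> are irrelevant.\<close>

definition circle :: "real measure" where
  "circle = uniform_measure lborel {0..2 * pi}"

lemma sets_circle [measurable_cong, simp]: "sets circle = sets borel"
  by (simp add: circle_def)

definition sq_integrable :: "(real \<Rightarrow> 'a::{complex_inner, second_countable_topology}) \<Rightarrow> bool" where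
  "sq_integrable f \<longleftrightarrow> f \<in> borel_measurable circle \<and> integrable circle (\<lambda>t. (norm (f t))\<^sup>2)"

definition L2rel :: "(real \<Rightarrow> 'a) \<Rightarrow> (real \<Rightarrow> 'a::{complex_inner, second_countable_topology}) \<Rightarrow> bool" where
  "L2rel f g \<longleftrightarrow> sq_integrable f \<and> sq_integrable g \<and> (AE t in circle. f t = g t)"

lemma sq_integrable_zero [simp]: "sq_integrable (\<lambda>_. 0)"
  by (simp add: sq_integrable_def)

lemma sq_integrable_add:
  assumes "sq_integrable f" "sq_integrable g" shows "sq_integrable (\<lambda>t. f t + g t)"
proof -
  have [measurable]: "f \<in> borel_measurable circle" "g \<in> borel_measurable circle"
    using assms by (auto simp: sq_integrable_def)
  have "integrable circle (\<lambda>t. 2 * (norm (f t))\<^sup>2 + 2 * (norm (g t))\<^sup>2)"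
    using assms by (auto simp: sq_integrable_def)
  then have "integrable circle (\<lambda>t. (norm (f t + g t))\<^sup>2)"
    by (rule Bochner_Integration.integrable_bound) (use norm_add_sq_le in auto)
  then show ?thesis by (simp add: sq_integrable_def)
qed

lemma borel_measurable_scaleC [measurable (raw)]:
  fixes f :: "'b \<Rightarrow> 'a::{complex_inner, second_countable_topology}"
  assumes [measurable]: "c \<in> borel_measurable M" and [measurable]: "f \<in> borel_measurable M"
  shows "(\<lambda>t. c t *\<^sub>C f t) \<in> borel_measurable M"
proof -
  have [measurable]: "(\<lambda>t. \<i> *\<^sub>C f t) \<in> borel_measurable M"
    by (rule borel_measurable_continuous_on[OF _ assms(2)])
      (rule linear_continuous_on[OF bounded_linear_scaleC])
  have "c t *\<^sub>C f t = Re (c t) *\<^sub>R f t + Im (c t) *\<^sub>R (\<i> *\<^sub>C f t)" for t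
    unfolding scaleR_scaleC scaleC_scaleC scaleC_add_left[symmetric]
    by (metis complex_eq mult.commute)
  then show ?thesis by simp
qed

lemma borel_measurable_cinner [measurable (raw)]:
  fixes f g :: "'b \<Rightarrow> 'a::{complex_inner, second_countable_topology}"
  assumes [measurable]: "f \<in> borel_measurable M" "g \<in> borel_measurable M"
  shows "(\<lambda>t. cinner (f t) (g t)) \<in> borel_measurable M"
proof -
  have "(\<lambda>t. complex_of_real (inner (f t) (g t)) - \<i> * complex_of_real (inner (\<i> *\<^sub>C f t) (g t)))
     \<in> borel_measurable M" by measurable
  moreover have "complex_of_real (inner x y) - \<i> * complex_of_real (inner (\<i> *\<^sub>C x) y) = cinner x y"
    for x y :: 'a
    unfolding Re_cinner[symmetric] cinner_scaleC_left by (simp add: complex_eq_iff)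
  ultimately show ?thesis by simp
qed

lemma sq_integrable_scaleC:
  assumes "sq_integrable f" "c \<in> borel_measurable circle" "\<And>t. cmod (c t) \<le> B"
  shows "sq_integrable (\<lambda>t. c t *\<^sub>C f t)"
proof -
  have [measurable]: "f \<in> borel_measurable circle" "c \<in> borel_measurable circle"
    using assms by (auto simp: sq_integrable_def)
  have "integrable circle (\<lambda>t. B\<^sup>2 * (norm (f t))\<^sup>2)"
    using assms by (auto simp: sq_integrable_def)
  then have "integrable circle (\<lambda>t. (norm (c t *\<^sub>C f t))\<^sup>2)"
    by (rule Bochner_Integration.integrable_bound)
      (auto simp: norm_scaleC power_mult_distrib intro!: mult_right_mono power_mono assms)
  then show ?thesis by (simp add: sq_integrable_def)
qed

lemma integrable_cinner:
  assumes "sq_integrable f" "sq_integrable g"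
  shows "integrable circle (\<lambda>t. cinner (f t) (g t))"
proof -
  have [measurable]: "f \<in> borel_measurable circle" "g \<in> borel_measurable circle"
    using assms by (auto simp: sq_integrable_def)
  have "integrable circle (\<lambda>t. (norm (f t))\<^sup>2 + (norm (g t))\<^sup>2)"
    using assms by (auto simp: sq_integrable_def)
  then show ?thesis
  proof (rule Bochner_Integration.integrable_bound)
    have "cmod (cinner (f t) (g t)) \<le> (norm (f t))\<^sup>2 + (norm (g t))\<^sup>2" for t
    proof -
      have "2 * (norm (f t) * norm (g t)) \<le> (norm (f t))\<^sup>2 + (norm (g t))\<^sup>2"
        using sum_squares_bound[of "norm (f t)" "norm (g t)"] by (simp add: mult.assoc)
      moreover have "0 \<le> norm (f t) * norm (g t)" by simp
      ultimately show ?thesis using cmod_cinner_le[of "f t" "g t"] by linarith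
    qed
    then show "AE t in circle. norm (cinner (f t) (g t)) \<le> norm ((norm (f t))\<^sup>2 + (norm (g t))\<^sup>2)"
      by simp
  qed measurable
qed

quotient_type (overloaded) 'a L2 = "real \<Rightarrow> 'a::{complex_inner, second_countable_topology}"
  / partial: L2rel
  morphisms rep_L2 abs_L2
proof (rule part_equivpI)
  show "\<exists>f. L2rel f (f :: real \<Rightarrow> 'a)" by (rule exI[of _ "\<lambda>_. 0"]) (simp add: L2rel_def)
  show "symp (L2rel :: (real \<Rightarrow> 'a) \<Rightarrow> _)" by (rule sympI) (auto simp: L2rel_def)
  show "transp (L2rel :: (real \<Rightarrow> 'a) \<Rightarrow> _)" by (rule transpI) (auto simp: L2rel_def)
qed

instantiation L2 :: ("{complex_inner, second_countable_topology}") complex_inner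
begin

lift_definition zero_L2 :: "'a L2" is "\<lambda>_. 0" by (simp add: L2rel_def)
lift_definition plus_L2 :: "'a L2 \<Rightarrow> 'a L2 \<Rightarrow> 'a L2" is "\<lambda>f g t. f t + g t"
  by (auto simp: L2rel_def sq_integrable_add)
lift_definition scaleC_L2 :: "complex \<Rightarrow> 'a L2 \<Rightarrow> 'a L2" is "\<lambda>c f t. c *\<^sub>C f t"
  by (auto simp: L2rel_def intro: sq_integrable_scaleC)
definition scaleR_L2 :: "real \<Rightarrow> 'a L2 \<Rightarrow> 'a L2"
  where "scaleR_L2 r f = complex_of_real r *\<^sub>C f"
definition uminus_L2 :: "'a L2 \<Rightarrow> 'a L2" where "uminus_L2 f = (-1) *\<^sub>C f"
definition minus_L2 :: "'a L2 \<Rightarrow> 'a L2 \<Rightarrow> 'a L2" where "minus_L2 f g = f + - g"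
lift_definition cinner_L2 :: "'a L2 \<Rightarrow> 'a L2 \<Rightarrow> complex"
  is "\<lambda>f g. \<integral>t. cinner (f t) (g t) \<partial>circle"
proof -
  fix f f' g g' :: "real \<Rightarrow> 'a"
  assume A: "L2rel f f'" "L2rel g g'"
  then have [measurable]: "f \<in> borel_measurable circle" "g \<in> borel_measurable circle"
      "f' \<in> borel_measurable circle" "g' \<in> borel_measurable circle"
    by (auto simp: L2rel_def sq_integrable_def)
  have ae: "AE t in circle. f t = f' t" "AE t in circle. g t = g' t"
    using A by (auto simp: L2rel_def)
  show "(\<integral>t. cinner (f t) (g t) \<partial>circle) = (\<integral>t. cinner (f' t) (g' t) \<partial>circle)"
    by (rule integral_cong_AE) (use ae in auto)
qed
definition inner_L2 :: "'a L2 \<Rightarrow> 'a L2 \<Rightarrow> real"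
  where "inner_L2 f g = Re (cinner f g)"
definition norm_L2 :: "'a L2 \<Rightarrow> real" where "norm_L2 f = sqrt (inner f f)"
definition sgn_L2 :: "'a L2 \<Rightarrow> 'a L2" where "sgn_L2 f = scaleR (inverse (norm f)) f"
definition dist_L2 :: "'a L2 \<Rightarrow> 'a L2 \<Rightarrow> real" where "dist_L2 f g = norm (f - g)"
definition uniformity_L2 :: "('a L2 \<times> 'a L2) filter"
  where "uniformity_L2 = (INF e\<in>{0<..}. principal {(x, y). dist x y < e})"
definition open_L2 :: "'a L2 set \<Rightarrow> bool"
  where "open_L2 U = (\<forall>x\<in>U. eventually (\<lambda>(x', y). x' = x \<longrightarrow> y \<in> U) uniformity)"

instance
proof
  fix f g h :: "'a L2" and r s :: real and c d :: complex
  have one: "1 *\<^sub>C x = x" for x :: 'a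
    using scaleR_scaleC[of 1 x] by simp
  have zero: "0 *\<^sub>C x = 0" for x :: 'a
    using scaleR_scaleC[of 0 x] by simp
  show "f + g + h = f + (g + h)"
    by transfer (auto simp: L2rel_def add.assoc intro!: sq_integrable_add)
  show "f + g = g + f" by transfer (auto simp: L2rel_def add.commute intro!: sq_integrable_add)
  show "0 + f = f" by transfer (auto simp: L2rel_def)
  have neg: "(- 1) *\<^sub>C x + x = 0" for x :: 'a
    using scaleC_add_left[of "-1" 1 x] by (simp add: one zero)
  show "- f + f = 0" unfolding uminus_L2_def
    by transfer (auto simp: L2rel_def neg)
  show "f - g = f + - g" by (rule minus_L2_def)
  show C1: "c *\<^sub>C (f + g) = c *\<^sub>C f + c *\<^sub>C g" for f g :: "'a L2" and c
    by transfer
      (auto simp: L2rel_def scaleC_add_right intro!: sq_integrable_add intro: sq_integrable_scaleC)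
  show C2: "(c + d) *\<^sub>C f = c *\<^sub>C f + d *\<^sub>C f" for c d
    by transfer
      (auto simp: L2rel_def scaleC_add_left intro!: sq_integrable_add intro: sq_integrable_scaleC)
  show C3: "c *\<^sub>C d *\<^sub>C f = (c * d) *\<^sub>C f" for c d
    by transfer (auto simp: L2rel_def scaleC_scaleC intro: sq_integrable_scaleC)
  show "r *\<^sub>R f = complex_of_real r *\<^sub>C f" by (rule scaleR_L2_def)
  show "r *\<^sub>R (f + g) = r *\<^sub>R f + r *\<^sub>R g" unfolding scaleR_L2_def by (rule C1)
  show "(r + s) *\<^sub>R f = r *\<^sub>R f + s *\<^sub>R f" unfolding scaleR_L2_def by (simp add: C2)
  show "r *\<^sub>R s *\<^sub>R f = (r * s) *\<^sub>R f" unfolding scaleR_L2_def by (simp add: C3)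
  show "1 *\<^sub>R f = f" unfolding scaleR_L2_def of_real_1
    by transfer (auto simp: L2rel_def one)
  show "sgn f = scaleR (inverse (norm f)) f" by (rule sgn_L2_def)
  show "dist f g = norm (f - g)" by (rule dist_L2_def)
  show "uniformity = (INF e\<in>{0<..}. principal {(x::'a L2, y). dist x y < e})"
    by (rule uniformity_L2_def)
  show "open U = (\<forall>x\<in>U. eventually (\<lambda>(x', y). x' = x \<longrightarrow> y \<in> U) uniformity)" for U :: "'a L2 set"
    by (rule open_L2_def)
  show comm: "cinner f g = cnj (cinner g f)" for f g :: "'a L2"
    unfolding cinner_L2.rep_eq cinner_commute[of "rep_L2 f _" "rep_L2 g _"] by simp
  show add: "cinner (f + g) h = cinner f h + cinner g h"
    by transfer (simp add: L2rel_def cinner_add_left integrable_cinner)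
  show scale: "cinner (c *\<^sub>C f) g = c * cinner f g" for c and f g :: "'a L2"
    by transfer (simp add: L2rel_def cinner_scaleC_left)
  show "Re (cinner f g) = inner f g" by (simp add: inner_L2_def)
  show "inner f g = inner g f" unfolding inner_L2_def by (subst comm) simp
  show "inner (f + g) h = inner f h + inner g h" by (simp add: inner_L2_def add)
  show "inner (r *\<^sub>R f) g = r * inner f g" by (simp add: inner_L2_def scaleR_L2_def scale)
  have eq: "Re (\<integral>t. cinner (f t) (f t) \<partial>circle) = (\<integral>t. (norm (f t))\<^sup>2 \<partial>circle)"
    if "sq_integrable f" for f :: "real \<Rightarrow> 'a"
    using integrable_cinner[OF that that]
    by (simp add: Re_cinner power2_norm_eq_inner flip: integral_Re)
  show "0 \<le> inner f f" unfolding inner_L2_def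
    by transfer (simp add: L2rel_def eq)
  show "inner f f = 0 \<longleftrightarrow> f = 0" unfolding inner_L2_def
  proof transfer
    fix f :: "real \<Rightarrow> 'a" assume "L2rel f f"
    then have sq: "sq_integrable f" by (simp add: L2rel_def)
    then have "(\<integral>t. (norm (f t))\<^sup>2 \<partial>circle) = 0 \<longleftrightarrow> (AE t in circle. (norm (f t))\<^sup>2 = 0)"
      by (intro integral_nonneg_eq_0_iff_AE) (auto simp: sq_integrable_def)
    then show "Re (\<integral>t. cinner (f t) (f t) \<partial>circle) = 0 \<longleftrightarrow> L2rel f (\<lambda>_. 0)"
      using sq by (simp add: eq L2rel_def)
  qed
  show "norm f = sqrt (inner f f)" by (rule norm_L2_def)
qed

end

definition L2_in :: "'a set \<Rightarrow> 'a::{complex_inner, second_countable_topology} L2 set" where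
  "L2_in E = {f. AE t in circle. rep_L2 f t \<in> E}"

text \<open>Multiplication by \<open>e\<^sup>i\<^sup>t\<close>.\<close>

lift_definition L2_Meit :: "'a::{complex_inner, second_countable_topology} L2 \<Rightarrow> 'a L2"
  is "\<lambda>f t. cis t *\<^sub>C f t"
proof -
  have "cis \<in> borel_measurable circle"
    by (simp add: measurable_cong_sets[OF sets_circle refl] borel_measurable_continuous_onI
        continuous_on_cis)
  then show "L2rel f g \<Longrightarrow> L2rel (\<lambda>t. cis t *\<^sub>C f t) (\<lambda>t. cis t *\<^sub>C g t)" for f g :: "real \<Rightarrow> 'a"
    unfolding L2rel_def by (auto intro: sq_integrable_scaleC[where B = 1])
qed


section \<open>\<open>\<Gamma>\<close>-contractions, \<open>\<Gamma>\<close>-unitaries, \<open>\<Gamma>\<close>-isometries\<close>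

definition Gamma :: "(complex \<times> complex) set" where
  "Gamma = {(z1 + z2, z1 * z2) | z1 z2. cmod z1 \<le> 1 \<and> cmod z2 \<le> 1}"

definition bGamma :: "(complex \<times> complex) set" where
  "bGamma = {(z1 + z2, z1 * z2) | z1 z2. cmod z1 = 1 \<and> cmod z2 = 1}"

text \<open>Elements of \<open>\<complex>[z\<^sub>1, z\<^sub>2]\<close> are polynomials in \<open>z\<^sub>2\<close> whose coefficients are polynomials in \<open>z\<^sub>1\<close>.\<close>

definition bipoly :: "complex poly poly \<Rightarrow> complex \<times> complex \<Rightarrow> complex" where
  "bipoly p z = poly (poly p [:snd z:]) (fst z)"

definition bipoly_op ::
  "complex poly poly \<Rightarrow> ('a::complex_inner \<Rightarrow> 'a) \<Rightarrow> ('a \<Rightarrow> 'a) \<Rightarrow> 'a \<Rightarrow> 'a" where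
  "bipoly_op p S P x =
     (\<Sum>j\<le>degree p. \<Sum>i\<le>degree (coeff p j). coeff (coeff p j) i *\<^sub>C (S ^^ i) ((P ^^ j) x))"

definition gamma_contraction :: "('a::complex_inner \<Rightarrow> 'a) \<Rightarrow> ('a \<Rightarrow> 'a) \<Rightarrow> bool" where
  "gamma_contraction S P \<longleftrightarrow> bounded_op_on UNIV S \<and> bounded_op_on UNIV P \<and>
     (\<forall>x. S (P x) = P (S x)) \<and>
     (\<forall>p. onorm (bipoly_op p S P) \<le> (SUP z\<in>Gamma. cmod (bipoly p z)))"

definition cnu :: "('a::complex_inner \<Rightarrow> 'a) \<Rightarrow> bool" where
  "cnu P \<longleftrightarrow> (\<forall>V. csubspace V \<and> closed V \<and> P ` V \<subseteq> V \<and> adj P ` V \<subseteq> V \<and>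
     isometry_on V V P \<and> P ` V = V \<longrightarrow> V = {0})"

text \<open>\<open>(A, B)\<close> is Taylor nonsingular on \<open>K\<close> if its Koszul complex
  \<open>0 \<rightarrow> K \<rightarrow> K \<oplus> K \<rightarrow> K \<rightarrow> 0\<close>, with maps \<open>x \<mapsto> (A x, B x)\<close> and \<open>(x, y) \<mapsto> B x - A y\<close>, is exact;
  the joint spectrum is the Taylor spectrum.\<close>

definition koszul_exact_on :: "'a::complex_inner set \<Rightarrow> ('a \<Rightarrow> 'a) \<Rightarrow> ('a \<Rightarrow> 'a) \<Rightarrow> bool" where
  "koszul_exact_on K A B \<longleftrightarrow>
     (\<forall>x\<in>K. A x = 0 \<and> B x = 0 \<longrightarrow> x = 0) \<and>
     (\<forall>x\<in>K. \<forall>y\<in>K. B x = A y \<longrightarrow> (\<exists>w\<in>K. x = A w \<and> y = B w)) \<and>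
     (\<forall>v\<in>K. \<exists>x\<in>K. \<exists>y\<in>K. v = B x - A y)"

definition joint_spectrum_on ::
  "'a::complex_inner set \<Rightarrow> ('a \<Rightarrow> 'a) \<Rightarrow> ('a \<Rightarrow> 'a) \<Rightarrow> (complex \<times> complex) set" where
  "joint_spectrum_on K S P =
     {(l, m). \<not> koszul_exact_on K (\<lambda>x. S x - l *\<^sub>C x) (\<lambda>x. P x - m *\<^sub>C x)}"

definition gamma_unitary_on :: "'a::complex_inner set \<Rightarrow> ('a \<Rightarrow> 'a) \<Rightarrow> ('a \<Rightarrow> 'a) \<Rightarrow> bool" where
  "gamma_unitary_on K S P \<longleftrightarrow> csubspace K \<and> closed K \<and>
     bounded_op_on K S \<and> bounded_op_on K P \<and> (\<forall>x\<in>K. S (P x) = P (S x)) \<and>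
     normal_on K S \<and> normal_on K P \<and> joint_spectrum_on K S P \<subseteq> bGamma"

text \<open>All Hilbert spaces being separable, the space of a \<open>\<Gamma>\<close>-unitary extension may be taken, up
  to a unitary, to be a closed subspace of \<open>\<ell>\<^sup>2\<close> of the natural numbers.\<close>

definition gamma_isometry_on :: "'a::complex_inner set \<Rightarrow> ('a \<Rightarrow> 'a) \<Rightarrow> ('a \<Rightarrow> 'a) \<Rightarrow> bool" where
  "gamma_isometry_on K S P \<longleftrightarrow> bounded_op_on K S \<and> bounded_op_on K P \<and>
     (\<forall>x\<in>K. S (P x) = P (S x)) \<and>
     (\<exists>(K' :: complex hardy set) S' P' V.
        gamma_unitary_on K' S' P' \<and> isometry_on K K' V \<and>
        (\<forall>x\<in>K. V (S x) = S' (V x) \<and> V (P x) = P' (V x)))"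

definition min_gamma_isometric_dilation ::
  "('a::complex_inner \<Rightarrow> 'a) \<Rightarrow> ('a \<Rightarrow> 'a) \<Rightarrow>
   'b::complex_inner set \<Rightarrow> ('b \<Rightarrow> 'b) \<Rightarrow> ('b \<Rightarrow> 'b) \<Rightarrow> ('a \<Rightarrow> 'b) \<Rightarrow> bool" where
  "min_gamma_isometric_dilation S P K S' P' J \<longleftrightarrow>
     gamma_isometry_on K S' P' \<and> isometry_on UNIV K J \<and>
     (\<forall>h. J (adj S h) = adj_on K S' (J h)) \<and>
     (\<forall>h. J (adj P h) = adj_on K P' (J h)) \<and>
     K = closure (cspan {(P' ^^ m) (J h) | m h. True})"


section \<open>The Sz.-Nagy--Foias model\<close>

definition defect :: "('a::complex_inner \<Rightarrow> 'a) \<Rightarrow> 'a \<Rightarrow> 'a" where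
  "defect P = pos_sqrt_on UNIV (\<lambda>x. x - adj P (P x))"

definition defect_star :: "('a::complex_inner \<Rightarrow> 'a) \<Rightarrow> 'a \<Rightarrow> 'a" where
  "defect_star P = pos_sqrt_on UNIV (\<lambda>x. x - P (adj P x))"

definition defect_space :: "('a::complex_inner \<Rightarrow> 'a) \<Rightarrow> 'a set" where
  "defect_space P = closure (range (defect P))"

definition defect_star_space :: "('a::complex_inner \<Rightarrow> 'a) \<Rightarrow> 'a set" where
  "defect_star_space P = closure (range (defect_star P))"

text \<open>The characteristic function; \<open>char_fun P z\<close> is to be applied to elements of
  \<open>defect_space P\<close>.\<close>

definition char_fun :: "('a::complex_inner \<Rightarrow> 'a) \<Rightarrow> complex \<Rightarrow> 'a \<Rightarrow> 'a" where
  "char_fun P z x = - P x + z *\<^sub>C defect_star P (inv (\<lambda>y. y - z *\<^sub>C adj P y) (defect P x))"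

text \<open>Boundary values are radial limits (for \<open>char_fun\<close>: in the strong operator topology), which
  exist for almost every \<open>t\<close>.\<close>

definition boundary :: "(complex \<Rightarrow> 'a::t2_space) \<Rightarrow> real \<Rightarrow> 'a" where
  "boundary f t = Lim (at_left 1) (\<lambda>r. f (complex_of_real r * cis t))"

definition Delta :: "('a::complex_inner \<Rightarrow> 'a) \<Rightarrow> real \<Rightarrow> 'a \<Rightarrow> 'a" where
  "Delta P t =
    (let Th = (\<lambda>x. boundary (\<lambda>z. char_fun P z x) t)
     in pos_sqrt_on (defect_space P) (\<lambda>x. x - adj_on (defect_space P) Th (Th x)))"

definition Delta_space ::
  "('a \<Rightarrow> 'a) \<Rightarrow> 'a::{complex_inner, second_countable_topology} L2 set" where
  "Delta_space P =
     closure {g. \<exists>f\<in>L2_in (defect_space P). AE t in circle. rep_L2 g t = Delta P t (rep_L2 f t)}"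

definition HP ::
  "('a \<Rightarrow> 'a) \<Rightarrow> ('a hardy \<times> 'a::{complex_inner, second_countable_topology} L2) set" where
  "HP P = hardy_in (defect_star_space P) \<times> Delta_space P"

definition SP ::
  "('a \<Rightarrow> 'a) \<Rightarrow> ('a hardy \<times> 'a::{complex_inner, second_countable_topology} L2) set" where
  "SP P = {(g, k) \<in> HP P. \<exists>f\<in>hardy_in (defect_space P).
     (\<forall>z. cmod z < 1 \<longrightarrow> hardy_eval g z = char_fun P z (hardy_eval f z)) \<and>
     (AE t in circle. rep_L2 k t = Delta P t (boundary (hardy_eval f) t))}"

definition QP ::
  "('a \<Rightarrow> 'a) \<Rightarrow> ('a hardy \<times> 'a::{complex_inner, second_countable_topology} L2) set" where
  "QP P = {x \<in> HP P. \<forall>y\<in>SP P. cinner x y = 0}"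

text \<open>\<open>M\<^sub>z \<oplus> M\<close> with \<open>M\<close> multiplication by \<open>e\<^sup>i\<^sup>t\<close>, and \<open>(A + A\<^sup>* M\<^sub>z) \<oplus> U\<close>, both as operators on
  \<open>HP P\<close>.\<close>

definition model_P ::
  "('a hardy \<times> 'a L2) \<Rightarrow> ('a hardy \<times> 'a::{complex_inner, second_countable_topology} L2)" where
  "model_P = map_prod hardy_Mz L2_Meit"

definition model_S ::
  "('a \<Rightarrow> 'a) \<Rightarrow> ('a \<Rightarrow> 'a) \<Rightarrow> ('a L2 \<Rightarrow> 'a L2) \<Rightarrow>
   ('a hardy \<times> 'a L2) \<Rightarrow> ('a hardy \<times> 'a::{complex_inner, second_countable_topology} L2)" where
  "model_S P A U = map_prod
     (\<lambda>f. hardy_tensor A f + hardy_Mz (hardy_tensor (adj_on (defect_star_space P) A) f)) U"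

definition NF_dilation ::
  "('a \<Rightarrow> 'a) \<Rightarrow> ('a::{complex_inner, second_countable_topology} \<Rightarrow> 'a hardy \<times> 'a L2) \<Rightarrow> bool" where
  "NF_dilation P J \<longleftrightarrow> isometry_on UNIV (HP P) J \<and> range J = QP P \<and>
     (\<forall>h. J (adj P h) = adj_on (HP P) model_P (J h)) \<and>
     HP P = closure (cspan {(model_P ^^ m) (J h) | m h. True})"

text \<open>\<open>S\<close> is carried by \<open>J\<close> to the compression of \<open>(A + A\<^sup>* M\<^sub>z) \<oplus> U\<close> to \<open>QP P\<close>.\<close>

definition representing ::
  "('a \<Rightarrow> 'a) \<Rightarrow> ('a \<Rightarrow> 'a) \<Rightarrow> ('a::{complex_inner, second_countable_topology} \<Rightarrow> 'a hardy \<times> 'a L2) \<Rightarrow>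
   ('a \<Rightarrow> 'a) \<Rightarrow> ('a L2 \<Rightarrow> 'a L2) \<Rightarrow> bool" where
  "representing S P J A U \<longleftrightarrow>
     bounded_op_on (defect_star_space P) A \<and> numerical_radius_on (defect_star_space P) A \<le> 1 \<and>
     bounded_op_on (Delta_space P) U \<and> gamma_unitary_on (Delta_space P) U L2_Meit \<and>
     (\<forall>h. J (S h) = proj (QP P) (model_S P A U (J h)))"

end

theory Submission
  imports Defs
begin

text \<open>Write \<open>K\<close> for the model space, \<open>V = M\<^sub>z \<oplus> M\<close> for the multiplication operators on it,
  \<open>T = (A + A\<^sup>*M\<^sub>z) \<oplus> U\<close> and \<open>J\<close> for the isometry of the dilation. The proof rests on three relations:
  \<open>V\<close> is isometric, \<open>TV = VT\<close>, and \<open>T = T\<^sup>*V\<close>, that is \<open>\<langle>Tx, y\<rangle> = \<langle>Vx, Ty\<rangle>\<close>. On the Hardy space they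
  follow from the form of \<open>A + A\<^sup>*M\<^sub>z\<close> (locale \<open>pencil_operators\<close>); on the residual space they express
  that \<open>(U, M)\<close> is a \<open>\<Gamma>\<close>-unitary.

  Given these relations, \<open>T\<close> is a Toeplitz operator with respect to \<open>V\<close>. Since \<open>S\<close> commutes with \<open>P\<close>
  and is the compression of \<open>T\<close>, one computes \<open>\<langle>TV\<^sup>mJh, Jk\<rangle> = \<langle>P\<^sup>mh, S\<^sup>*k\<rangle>\<close>. The vectors \<open>V\<^sup>mJh\<close> span \<open>K\<close>,
  so this says \<open>T\<^sup>*J = JS\<^sup>*\<close>: the compression is a dilation (\<open>adj_compression\<close>). The relation \<open>T = T\<^sup>*V\<close>
  reduces every other matrix entry \<open>\<langle>TV\<^sup>mJh, V\<^sup>nJk\<rangle>\<close> to these, so that \<open>S\<close> determines \<open>T\<close>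
  (\<open>toeplitz_lift_unique\<close>). Two representing pairs therefore agree on their spaces, and the unitary
  equivalences are implemented by the identity.

  The analytic part of the proof passes between the definition of a \<open>\<Gamma>\<close>-unitary by the Taylor joint
  spectrum and the relations \<open>P\<^sup>*P = PP\<^sup>* = 1\<close>, \<open>S = S\<^sup>*P\<close>, \<open>\<parallel>S\<parallel> \<le> 2\<close> (\<open>gamma_unitary_onD\<close>,
  \<open>gamma_unitary_onI\<close>). For commuting normal operators, exactness of the Koszul complex is equivalent to
  a lower bound for the pair, so the joint spectrum consists of the joint approximate eigenvalues. The
  spectral theorem is replaced by an extremal argument (\<open>approximate_eigenvalue_selfadjoint\<close>,
  \<open>joint_approximate_eigenvector\<close>), which finds joint approximate eigenvectors near which a given
  positive operator of the commutative algebra is as large as its form is anywhere. Applied to \<open>N\<^sup>*N\<close>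
  with \<open>N = S - S\<^sup>*P\<close> it gives \<open>N = 0\<close>; applied to \<open>S\<^sup>*S\<close> it gives the norm bound.

  That \<open>(T, V)\<close> is a \<open>\<Gamma>\<close>-isometry is seen on two-sided sequences, where the unilateral shift is replaced
  by the bilateral one. There \<open>A + A\<^sup>*V\<close> is normal, its joint approximate eigenvalues are controlled by
  the numerical radius of \<open>A\<close>, and the relations hold again. The extension space is separable because
  the dilation is minimal, so it embeds into \<open>\<ell>\<^sup>2\<close>.\<close>


section \<open>Complex inner products and closed subspaces\<close>

lemma bounded_bilinear_cinner:
  "bounded_bilinear (cinner :: 'a::complex_inner \<Rightarrow> 'a \<Rightarrow> complex)"
proof
  fix x y z :: 'a and r :: real
  show add: "cinner (x + y) z = cinner x z + cinner y z" for x y z :: 'a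
    by (rule cinner_add_left)
  show "cinner x (y + z) = cinner x y + cinner x z"
    by (metis add cinner_commute complex_cnj_add)
  show scale: "cinner (r *\<^sub>R x) y = r *\<^sub>R cinner x y" for x y :: 'a
    unfolding scaleR_scaleC[of r x] by (simp add: cinner_scaleC_left scaleR_conv_of_real)
  show "cinner x (r *\<^sub>R y) = r *\<^sub>R cinner x y"
    by (metis scale cinner_commute complex_cnj_scaleR)
  show "\<exists>K. \<forall>x y :: 'a. norm (cinner x y) \<le> norm x * norm y * K"
    by (rule exI[of _ 1]) (simp add: cmod_cinner_le)
qed

lemmas cinner_zero_left [simp] = bounded_bilinear.zero_left[OF bounded_bilinear_cinner]
  and cinner_zero_right [simp] = bounded_bilinear.zero_right[OF bounded_bilinear_cinner]
  and cinner_add_right = bounded_bilinear.add_right[OF bounded_bilinear_cinner]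
  and cinner_diff_left = bounded_bilinear.diff_left[OF bounded_bilinear_cinner]
  and cinner_diff_right = bounded_bilinear.diff_right[OF bounded_bilinear_cinner]

lemma cinner_scaleC_right: "cinner x (c *\<^sub>C y) = cnj c * cinner x (y::'a::complex_inner)"
  by (metis cinner_commute cinner_scaleC_left complex_cnj_mult)

lemma cinner_self: "cinner x x = complex_of_real ((norm (x::'a::complex_inner))\<^sup>2)"
  using cinner_commute[of x x] Re_cinner[of x x]
  by (simp add: complex_eq_iff power2_norm_eq_inner)

lemma bounded_bilinear_scaleC:
  "bounded_bilinear (scaleC :: complex \<Rightarrow> 'a::complex_inner \<Rightarrow> 'a)"
proof
  fix x y :: 'a and c d :: complex and r :: real
  show "(c + d) *\<^sub>C x = c *\<^sub>C x + d *\<^sub>C x" by (rule scaleC_add_left)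
  show "c *\<^sub>C (x + y) = c *\<^sub>C x + c *\<^sub>C y" by (rule scaleC_add_right)
  show "(r *\<^sub>R c) *\<^sub>C x = r *\<^sub>R c *\<^sub>C x"
    unfolding scaleR_scaleC[of r "c *\<^sub>C x"] scaleC_scaleC scaleR_conv_of_real ..
  show "c *\<^sub>C r *\<^sub>R x = r *\<^sub>R c *\<^sub>C x"
    by (simp add: scaleR_scaleC scaleC_scaleC mult.commute)
  show "\<exists>K. \<forall>(c::complex) (x::'a). norm (c *\<^sub>C x) \<le> norm c * norm x * K"
    by (rule exI[of _ 1]) (simp add: norm_scaleC)
qed

lemmas scaleC_zero_left [simp] = bounded_bilinear.zero_left[OF bounded_bilinear_scaleC]
  and scaleC_zero_right [simp] = bounded_bilinear.zero_right[OF bounded_bilinear_scaleC]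
  and scaleC_minus_left = bounded_bilinear.minus_left[OF bounded_bilinear_scaleC]
  and scaleC_diff_left = bounded_bilinear.diff_left[OF bounded_bilinear_scaleC]
  and scaleC_diff_right = bounded_bilinear.diff_right[OF bounded_bilinear_scaleC]
  and tendsto_scaleC = bounded_bilinear.tendsto[OF bounded_bilinear_scaleC]

lemma uminus_scaleC: "- x = (- 1) *\<^sub>C (x::'a::complex_inner)"
  by (simp add: scaleC_minus_left)

lemma cinner_eqI:
  fixes x y :: "'a::complex_inner"
  assumes "csubspace K" "x \<in> K" "y \<in> K" "\<And>k. k \<in> K \<Longrightarrow> cinner k x = cinner k y"
  shows "x = y"
proof -
  have "x - y \<in> K"
    using assms(1-3) by (metis csubspace_def diff_conv_add_uminus uminus_scaleC)
  then have "cinner (x - y) (x - y) = 0"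
    using assms(4) by (simp add: cinner_diff_right)
  then show ?thesis by (simp add: cinner_self)
qed

lemma
  fixes K :: "'a::complex_inner set"
  assumes "csubspace K"
  shows csubspace_0: "0 \<in> K"
    and csubspace_add: "x \<in> K \<Longrightarrow> y \<in> K \<Longrightarrow> x + y \<in> K"
    and csubspace_scaleC: "x \<in> K \<Longrightarrow> c *\<^sub>C x \<in> K"
    and csubspace_scaleR: "x \<in> K \<Longrightarrow> r *\<^sub>R x \<in> K"
    and csubspace_uminus: "x \<in> K \<Longrightarrow> - x \<in> K"
    and csubspace_diff: "x \<in> K \<Longrightarrow> y \<in> K \<Longrightarrow> x - y \<in> K"
  using assms uminus_scaleC[of x] uminus_scaleC[of y] unfolding csubspace_def diff_conv_add_uminus scaleR_scaleC
  by auto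

lemma csubspace_sum:
  assumes "csubspace K" "\<And>i. i \<in> I \<Longrightarrow> f i \<in> K"
  shows "sum f I \<in> K"
  using assms(2)
  by (induction I rule: infinite_finite_induct)
    (auto intro: csubspace_0[OF assms(1)] csubspace_add[OF assms(1)])

lemma csubspace_UNIV: "csubspace UNIV"
  by (simp add: csubspace_def)

lemma csubspace_cspan: "csubspace (cspan X)"
  by (rule hull_in) (auto simp: csubspace_def)

lemma csubspace_closure:
  fixes K :: "'a::complex_inner set"
  assumes K: "csubspace K"
  shows "csubspace (closure K)"
  unfolding csubspace_def
proof (intro conjI ballI allI)
  show "0 \<in> closure K" using csubspace_0[OF K] closure_subset by blast
next
  fix x y :: 'a assume "x \<in> closure K" "y \<in> closure K"
  then obtain f g where "\<forall>n. f n \<in> K" "f \<longlonglongrightarrow> x" "\<forall>n. g n \<in> K" "g \<longlonglongrightarrow> y"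
    unfolding closure_sequential by blast
  then show "x + y \<in> closure K"
    unfolding closure_sequential
    by (intro exI[of _ "\<lambda>n. f n + g n"]) (auto intro: tendsto_add csubspace_add[OF K])
next
  fix c and x :: 'a assume "x \<in> closure K"
  then obtain f where "\<forall>n. f n \<in> K" "f \<longlonglongrightarrow> x"
    unfolding closure_sequential by blast
  then show "c *\<^sub>C x \<in> closure K"
    unfolding closure_sequential
    by (intro exI[of _ "\<lambda>n. c *\<^sub>C f n"])
      (auto intro: tendsto_scaleC tendsto_const csubspace_scaleC[OF K])
qed


section \<open>Orthogonal projections and adjoints\<close>

lemma orthogonal_projection_exists:
  fixes K :: "'a::chilbert_space set"
  assumes K: "csubspace K" and cl: "closed K"
  shows "\<exists>y\<in>K. \<forall>k\<in>K. cinner (x - y) k = 0"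
proof -
  define D where "D = (\<lambda>y. (norm (x - y))\<^sup>2) ` K"
  define d where "d = Inf D"
  have bdd: "bdd_below D" by (rule bdd_belowI[of _ 0]) (auto simp: D_def)
  have ne: "D \<noteq> {}" using csubspace_0[OF K] by (auto simp: D_def)
  have d_le: "d \<le> (norm (x - y))\<^sup>2" if "y \<in> K" for y
    unfolding d_def using that bdd by (intro cInf_lower) (auto simp: D_def)
  have "\<exists>y. y \<in> K \<and> (norm (x - y))\<^sup>2 < d + inverse (real (Suc n))" for n
  proof -
    have "Inf D < d + inverse (real (Suc n))" by (simp add: d_def)
    then show ?thesis using cInf_lessD[OF ne] by (auto simp: D_def)
  qed
  then obtain f where fK: "f n \<in> K" and f: "(norm (x - f n))\<^sup>2 < d + inverse (real (Suc n))" for n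
    by metis
  have par: "(norm (f m - f n))\<^sup>2 \<le> 2 * inverse (real (Suc m)) + 2 * inverse (real (Suc n))" for m n
  proof -
    let ?h = "(1/2) *\<^sub>R (f m + f n)"
    have "?h \<in> K" by (intro csubspace_scaleR csubspace_add K fK)
    then have "d \<le> (norm (x - ?h))\<^sup>2" by (rule d_le)
    moreover have "(norm (f m - f n))\<^sup>2
        = 2 * (norm (x - f m))\<^sup>2 + 2 * (norm (x - f n))\<^sup>2 - 4 * (norm (x - ?h))\<^sup>2"
      unfolding power2_norm_eq_inner
      by (simp add: inner_diff_left inner_diff_right inner_add_left inner_add_right inner_commute
          algebra_simps)
    ultimately show ?thesis using f[of m] f[of n] by linarith
  qed
  have "Cauchy f"
  proof (rule CauchyI)
    fix e :: real assume e: "e > 0"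
    obtain N where N: "inverse (real (Suc N)) < e\<^sup>2 / 4"
      using reals_Archimedean[of "e\<^sup>2 / 4"] e by auto
    have "norm (f m - f n) < e" if "m \<ge> N" "n \<ge> N" for m n
    proof -
      have "inverse (real (Suc m)) \<le> inverse (real (Suc N))" "inverse (real (Suc n)) \<le> inverse (real (Suc N))"
        using that by (auto intro!: le_imp_inverse_le)
      then have "(norm (f m - f n))\<^sup>2 < e\<^sup>2" using par[of m n] N by linarith
      then show ?thesis using e by (simp add: power_less_imp_less_base)
    qed
    then show "\<exists>M. \<forall>m\<ge>M. \<forall>n\<ge>M. norm (f m - f n) < e" by blast
  qed
  then obtain y where y: "f \<longlonglongrightarrow> y" by (auto simp: Cauchy_convergent_iff convergent_def)
  have yK: "y \<in> K" using closed_sequentially[OF cl fK y] .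
  have "(\<lambda>n. d + inverse (real (Suc n))) \<longlonglongrightarrow> d + 0"
    by (intro tendsto_add tendsto_const LIMSEQ_inverse_real_of_nat)
  moreover have "(\<lambda>n. (norm (x - f n))\<^sup>2) \<longlonglongrightarrow> (norm (x - y))\<^sup>2"
    by (intro tendsto_intros y)
  ultimately have min: "(norm (x - y))\<^sup>2 \<le> d"
    using f by (metis (lifting) LIMSEQ_le add.right_neutral less_imp_le)
  have re: "inner (x - y) k = 0" if k: "k \<in> K" for k
  proof (rule ccontr)
    assume ne: "inner (x - y) k \<noteq> 0"
    then have k0: "norm k > 0" by auto
    define t where "t = inner (x - y) k / (norm k)\<^sup>2"
    have "y + t *\<^sub>R k \<in> K" by (intro csubspace_add csubspace_scaleR K yK k)
    then have "(norm (x - y))\<^sup>2 \<le> (norm (x - (y + t *\<^sub>R k)))\<^sup>2" using d_le min order_trans by blast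
    also have "x - (y + t *\<^sub>R k) = (x - y) - t *\<^sub>R k" by simp
    also have "(norm ((x - y) - t *\<^sub>R k))\<^sup>2 = (norm (x - y))\<^sup>2 - 2 * t * inner (x - y) k + t\<^sup>2 * (norm k)\<^sup>2"
      unfolding power2_norm_eq_inner
      by (simp add: inner_diff_left inner_diff_right inner_commute algebra_simps power2_eq_square)
    also have "\<dots> = (norm (x - y))\<^sup>2 - (inner (x - y) k)\<^sup>2 / (norm k)\<^sup>2"
      using k0 by (simp add: t_def field_simps power2_eq_square)
    finally show False using ne k0 by (simp add: divide_le_0_iff)
  qed
  have "cinner (x - y) k = 0" if k: "k \<in> K" for k
  proof -
    have "Re (cinner (x - y) k) = 0" using re[OF k] by (simp add: Re_cinner)
    moreover have "Re (cinner (x - y) (\<i> *\<^sub>C k)) = 0"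
      using re[OF csubspace_scaleC[OF K k]] by (simp add: Re_cinner)
    ultimately show ?thesis by (simp add: cinner_scaleC_right complex_eq_iff)
  qed
  then show ?thesis using yK by blast
qed

lemma proj_eqI:
  assumes K: "csubspace K" and y: "y \<in> K" "\<And>k. k \<in> K \<Longrightarrow> cinner (x - y) k = 0"
  shows "proj K x = y"
  unfolding proj_def
proof (rule the_equality)
  show "y \<in> K \<and> (\<forall>k\<in>K. cinner (x - y) k = 0)" using y by blast
next
  fix z assume z: "z \<in> K \<and> (\<forall>k\<in>K. cinner (x - z) k = 0)"
  have "cinner k y = cinner k z" if "k \<in> K" for k
  proof -
    have "cinner y k = cinner z k"
      using y(2)[OF that] z that by (simp add: cinner_diff_left)
    then show ?thesis by (metis cinner_commute)
  qed
  then show "z = y" using cinner_eqI[OF K, of y z] y z by auto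
qed

lemma cinner_proj:
  fixes K :: "'a::chilbert_space set"
  assumes "csubspace K" "closed K" "k \<in> K"
  shows "cinner (proj K x) k = cinner x k"
proof -
  obtain y where y: "y \<in> K" "\<forall>k\<in>K. cinner (x - y) k = 0"
    using orthogonal_projection_exists[OF assms(1,2)] by blast
  then have "proj K x = y" by (intro proj_eqI assms(1)) auto
  then show ?thesis using y assms(3) by (auto simp: cinner_diff_left)
qed

lemma riesz_representation_on:
  fixes K :: "'a::chilbert_space set" and \<phi> :: "'a \<Rightarrow> complex"
  assumes K: "csubspace K" and cl: "closed K"
    and add: "\<And>x y. x \<in> K \<Longrightarrow> y \<in> K \<Longrightarrow> \<phi> (x + y) = \<phi> x + \<phi> y"
    and scale: "\<And>c x. x \<in> K \<Longrightarrow> \<phi> (c *\<^sub>C x) = c * \<phi> x"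
    and bound: "\<And>x. x \<in> K \<Longrightarrow> cmod (\<phi> x) \<le> B * norm x"
  shows "\<exists>u\<in>K. \<forall>k\<in>K. \<phi> k = cinner k u"
proof (cases "\<forall>k\<in>K. \<phi> k = 0")
  case True
  then show ?thesis using csubspace_0[OF K] by (auto intro!: bexI[of _ 0])
next
  case False
  then obtain k0 where k0: "k0 \<in> K" "\<phi> k0 \<noteq> 0" by blast
  have diff: "\<phi> (x - y) = \<phi> x - \<phi> y" if "x \<in> K" "y \<in> K" for x y
    using add[of "x - y" y] that csubspace_diff[OF K] by simp
  define N where "N = {k \<in> K. \<phi> k = 0}"
  have N: "csubspace N"
    using K scale[of 0 0] csubspace_0[OF K] unfolding csubspace_def N_def by (simp add: add scale)
  have "closed N"
    unfolding closed_sequential_limits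
  proof (intro allI impI)
    fix f l assume f: "(\<forall>n. f n \<in> N) \<and> f \<longlonglongrightarrow> l"
    then have l: "l \<in> K" using closed_sequentially[OF cl] unfolding N_def by blast
    have "(\<lambda>n. \<bar>B\<bar> * norm (l - f n)) \<longlonglongrightarrow> \<bar>B\<bar> * norm (l - l)"
      using f by (intro tendsto_intros) auto
    moreover have "cmod (\<phi> l) \<le> \<bar>B\<bar> * norm (l - f n)" for n
    proof -
      have fn: "f n \<in> K" "\<phi> (f n) = 0" using f by (auto simp: N_def)
      have "cmod (\<phi> l) = cmod (\<phi> (l - f n))" using fn l diff by simp
      also have "\<dots> \<le> B * norm (l - f n)" using fn l csubspace_diff[OF K] bound by blast
      also have "\<dots> \<le> \<bar>B\<bar> * norm (l - f n)" by (simp add: mult_right_mono)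
      finally show ?thesis .
    qed
    ultimately have "cmod (\<phi> l) \<le> \<bar>B\<bar> * norm (l - l)"
      by (intro LIMSEQ_le_const) auto
    then show "l \<in> N" using l by (simp add: N_def)
  qed
  then obtain n where n: "n \<in> N" "\<forall>k\<in>N. cinner (k0 - n) k = 0"
    using orthogonal_projection_exists[OF N] by blast
  define z where "z = k0 - n"
  have zK: "z \<in> K" and pz: "\<phi> z = \<phi> k0"
    using n k0 csubspace_diff[OF K] diff by (auto simp: z_def N_def)
  have z0: "z \<noteq> 0" using pz k0 scale[of 0 0] csubspace_0[OF K] by auto
  define u where "u = (cnj (\<phi> z) / of_real ((norm z)\<^sup>2)) *\<^sub>C z"
  have "\<phi> k = cinner k u" if k: "k \<in> K" for k
  proof -
    define c where "c = \<phi> k / \<phi> z"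
    have cz: "c *\<^sub>C z \<in> K" using zK csubspace_scaleC[OF K] by blast
    have "k - c *\<^sub>C z \<in> N"
      using k zK cz csubspace_diff[OF K] pz k0(2) by (auto simp: N_def diff scale c_def)
    then have "cinner z (k - c *\<^sub>C z) = 0" using n by (simp add: z_def)
    then have "cinner (k - c *\<^sub>C z) z = 0" by (metis cinner_commute complex_cnj_zero)
    then have "cinner k z = c * of_real ((norm z)\<^sup>2)"
      by (simp add: cinner_diff_left cinner_scaleC_left cinner_self)
    then show ?thesis using z0 pz k0(2) by (simp add: u_def cinner_scaleC_right c_def)
  qed
  moreover have "u \<in> K" unfolding u_def using zK csubspace_scaleC[OF K] by blast
  ultimately show ?thesis by blast
qed

lemma adj_on_eqI:
  assumes K: "csubspace K" and x: "x \<in> K" "\<And>k. k \<in> K \<Longrightarrow> cinner (T k) y = cinner k x"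
  shows "adj_on K T y = x"
  unfolding adj_on_def
proof (rule the_equality)
  show "x \<in> K \<and> (\<forall>k\<in>K. cinner (T k) y = cinner k x)" using x by blast
  show "z = x" if "z \<in> K \<and> (\<forall>k\<in>K. cinner (T k) y = cinner k z)" for z
    using cinner_eqI[OF K, of z x] that x by auto
qed

lemma
  fixes K :: "'a::chilbert_space set" and T :: "'a \<Rightarrow> 'b::complex_inner"
  assumes K: "csubspace K" and cl: "closed K" and lin: "clinear_on K L T"
    and bound: "\<And>x. x \<in> K \<Longrightarrow> norm (T x) \<le> B * norm x"
  shows adj_on_in': "adj_on K T y \<in> K"
    and cinner_adj_on': "k \<in> K \<Longrightarrow> cinner (T k) y = cinner k (adj_on K T y)"
proof -
  have "\<exists>u\<in>K. \<forall>k\<in>K. cinner (T k) y = cinner k u"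
  proof (rule riesz_representation_on[OF K cl])
    fix x assume x: "x \<in> K"
    have "cmod (cinner (T x) y) \<le> norm (T x) * norm y" by (rule cmod_cinner_le)
    also have "\<dots> \<le> (B * norm x) * norm y" by (intro mult_right_mono bound x) simp
    finally show "cmod (cinner (T x) y) \<le> (B * norm y) * norm x" by (simp add: mult_ac)
  qed (use lin in \<open>auto simp: clinear_on_def cinner_add_left cinner_scaleC_left\<close>)
  then obtain u where u: "u \<in> K" "\<And>k. k \<in> K \<Longrightarrow> cinner (T k) y = cinner k u" by blast
  then have "adj_on K T y = u" by (intro adj_on_eqI[OF K])
  then show "adj_on K T y \<in> K" and "k \<in> K \<Longrightarrow> cinner (T k) y = cinner k (adj_on K T y)"
    using u by auto
qed

lemma
  assumes "bounded_op_on K T"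
  shows bounded_op_on_in: "x \<in> K \<Longrightarrow> T x \<in> K"
    and bounded_op_on_add: "x \<in> K \<Longrightarrow> y \<in> K \<Longrightarrow> T (x + y) = T x + T y"
    and bounded_op_on_scaleC: "x \<in> K \<Longrightarrow> T (c *\<^sub>C x) = c *\<^sub>C T x"
    and bounded_op_on_clinear: "clinear_on K K T"
  using assms by (auto simp: bounded_op_on_def clinear_on_def)

lemma
  assumes K: "csubspace K" and T: "bounded_op_on K T"
  shows bounded_op_on_zero: "T 0 = 0"
    and bounded_op_on_diff: "x \<in> K \<Longrightarrow> y \<in> K \<Longrightarrow> T (x - y) = T x - T y"
  using bounded_op_on_scaleC[OF T csubspace_0[OF K], of 0]
    bounded_op_on_add[OF T, of "x - y" y] csubspace_diff[OF K, of x y]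
  by (simp_all add: algebra_simps)

lemma bounded_op_on_bound:
  assumes "bounded_op_on K T"
  obtains B where "B > 0" "\<And>x. x \<in> K \<Longrightarrow> norm (T x) \<le> B * norm x"
proof -
  obtain B where B: "\<forall>x\<in>K. norm (T x) \<le> B * norm x"
    using assms by (auto simp: bounded_op_on_def)
  have "norm (T x) \<le> (\<bar>B\<bar> + 1) * norm x" if "x \<in> K" for x
  proof -
    have "B * norm x \<le> (\<bar>B\<bar> + 1) * norm x" by (intro mult_right_mono) auto
    then show ?thesis using B that by force
  qed
  then show ?thesis using that[of "\<bar>B\<bar> + 1"] by auto
qed

lemma bounded_op_onI:
  assumes "\<And>x. x \<in> K \<Longrightarrow> T x \<in> K"
    and "\<And>x y. x \<in> K \<Longrightarrow> y \<in> K \<Longrightarrow> T (x + y) = T x + T y"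
    and "\<And>c x. x \<in> K \<Longrightarrow> T (c *\<^sub>C x) = c *\<^sub>C T x"
    and "\<And>x. x \<in> K \<Longrightarrow> norm (T x) \<le> B * norm x"
  shows "bounded_op_on K T"
  using assms unfolding bounded_op_on_def clinear_on_def by blast

lemma
  fixes K :: "'a::chilbert_space set" and T :: "'a \<Rightarrow> 'a"
  assumes K: "csubspace K" and cl: "closed K" and T: "bounded_op_on K T"
  shows adj_on_in: "adj_on K T y \<in> K"
    and cinner_adj_on: "k \<in> K \<Longrightarrow> cinner (T k) y = cinner k (adj_on K T y)"
proof -
  obtain B where B: "\<And>x. x \<in> K \<Longrightarrow> norm (T x) \<le> B * norm x"
    using bounded_op_on_bound[OF T] by blast
  note A = adj_on_in'[OF K cl bounded_op_on_clinear[OF T] B] cinner_adj_on'[OF K cl bounded_op_on_clinear[OF T] B]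
  show "adj_on K T y \<in> K" by (rule A)
  show "k \<in> K \<Longrightarrow> cinner (T k) y = cinner k (adj_on K T y)" by (intro A(2))
qed

lemma bounded_op_on_adj_on:
  fixes K :: "'a::chilbert_space set" and T :: "'a \<Rightarrow> 'a"
  assumes K: "csubspace K" and cl: "closed K" and T: "bounded_op_on K T"
  shows "bounded_op_on K (adj_on K T)"
proof -
  note A = adj_on_in[OF K cl T] cinner_adj_on[OF K cl T]
  obtain B where B: "B > 0" "\<And>x. x \<in> K \<Longrightarrow> norm (T x) \<le> B * norm x"
    using bounded_op_on_bound[OF T] by blast
  show ?thesis
  proof (rule bounded_op_onI[where B = B])
    fix x y assume "x \<in> K" "y \<in> K"
    then show "adj_on K T (x + y) = adj_on K T x + adj_on K T y"
      by (intro adj_on_eqI K csubspace_add[OF K] A(1)) (simp add: cinner_add_right A(2))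
  next
    fix c x assume "x \<in> K"
    then show "adj_on K T (c *\<^sub>C x) = c *\<^sub>C adj_on K T x"
      by (intro adj_on_eqI K csubspace_scaleC[OF K] A(1)) (simp add: cinner_scaleC_right A(2))
  next
    fix x assume x: "x \<in> K"
    let ?y = "adj_on K T x"
    have "(norm ?y)\<^sup>2 = cmod (cinner ?y ?y)" by (simp add: cinner_self norm_power)
    also have "\<dots> = cmod (cinner (T ?y) x)" by (simp add: A)
    also have "\<dots> \<le> norm (T ?y) * norm x" by (rule cmod_cinner_le)
    also have "\<dots> \<le> (B * norm ?y) * norm x" by (intro mult_right_mono B A) simp
    finally have "norm ?y * norm ?y \<le> norm ?y * (B * norm x)" by (simp add: power2_eq_square mult_ac)
    then show "norm ?y \<le> B * norm x"
      by (cases "norm ?y = 0") (use B in \<open>auto simp: mult_le_cancel_left\<close>)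
  qed (rule A)
qed


section \<open>Completeness of the Hardy space and of \<open>L\<^sup>2\<close>\<close>

lemma summable_coef: "summable (\<lambda>n. (norm (coef f n))\<^sup>2)"
  by transfer

lemma norm_hardy_sq: "(norm f)\<^sup>2 = (\<Sum>n. (norm (coef f n))\<^sup>2)"
proof -
  have "complex_of_real ((norm f)\<^sup>2) = (\<Sum>n. complex_of_real ((norm (coef f n))\<^sup>2))"
    unfolding cinner_self[symmetric] by (simp add: cinner_hardy.rep_eq)
  also have "\<dots> = complex_of_real (\<Sum>n. (norm (coef f n))\<^sup>2)"
    by (rule suminf_of_real[OF summable_coef, symmetric])
  finally show ?thesis using of_real_eq_iff by blast
qed

lemma norm_coef_le: "norm (coef f n) \<le> norm f"
proof -
  have "(norm (coef f n))\<^sup>2 \<le> (norm f)\<^sup>2"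
    unfolding norm_hardy_sq using sum_le_suminf[OF summable_coef, of "{n}" f] by simp
  then show ?thesis by (rule power2_le_imp_le) simp
qed

lemma hardy_eqI: "(\<And>n. coef f n = coef g n) \<Longrightarrow> f = g"
  by (metis coef_inject ext)

lemmas coef_simps [simp] = zero_hardy.rep_eq plus_hardy.rep_eq minus_hardy.rep_eq
  uminus_hardy.rep_eq scaleC_hardy.rep_eq

lemma norm_hardy_le_if_partial_sums_le:
  assumes "\<And>N. (\<Sum>n<N. (norm (coef f n))\<^sup>2) \<le> b\<^sup>2" "b \<ge> 0"
  shows "norm f \<le> b"
  using suminf_le_const[OF summable_coef assms(1)] assms(2)
  unfolding norm_hardy_sq[symmetric] by (rule power2_le_imp_le)

instance hardy :: (chilbert_space) chilbert_space
proof
  fix X :: "nat \<Rightarrow> 'a hardy" assume X: "Cauchy X"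
  have "Cauchy (\<lambda>k. coef (X k) n)" for n
  proof (rule CauchyI)
    fix e :: real assume "e > 0"
    then obtain M where M: "\<And>j k. j \<ge> M \<Longrightarrow> k \<ge> M \<Longrightarrow> norm (X j - X k) < e"
      using CauchyD[OF X] by metis
    have "norm (coef (X j) n - coef (X k) n) < e" if "j \<ge> M" "k \<ge> M" for j k
      using norm_coef_le[of "X j - X k" n] M[OF that] by simp
    then show "\<exists>M. \<forall>m\<ge>M. \<forall>k\<ge>M. norm (coef (X m) n - coef (X k) n) < e" by blast
  qed
  then have "\<exists>l. (\<lambda>k. coef (X k) n) \<longlonglongrightarrow> l" for n
    by (simp add: Cauchy_convergent_iff convergent_def)
  then obtain a where a: "\<And>n. (\<lambda>k. coef (X k) n) \<longlonglongrightarrow> a n" by metis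
  have tail: "(\<Sum>n<N. (norm (a n - coef (X k) n))\<^sup>2) \<le> e\<^sup>2"
    if M: "\<And>j k. j \<ge> M \<Longrightarrow> k \<ge> M \<Longrightarrow> norm (X j - X k) < e" and k: "k \<ge> M" for e M k N
  proof (rule LIMSEQ_le_const2)
    show "(\<lambda>j. \<Sum>n<N. (norm (coef (X j) n - coef (X k) n))\<^sup>2)
        \<longlonglongrightarrow> (\<Sum>n<N. (norm (a n - coef (X k) n))\<^sup>2)"
      by (intro tendsto_intros a)
    have "(\<Sum>n<N. (norm (coef (X j) n - coef (X k) n))\<^sup>2) \<le> e\<^sup>2" if "j \<ge> M" for j
    proof -
      have "(\<Sum>n<N. (norm (coef (X j) n - coef (X k) n))\<^sup>2) \<le> (norm (X j - X k))\<^sup>2"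
        unfolding norm_hardy_sq using sum_le_suminf[OF summable_coef, of "{..<N}" "X j - X k"] by simp
      also have "\<dots> \<le> e\<^sup>2" using M[OF that k] by (intro power_mono) auto
      finally show ?thesis .
    qed
    then show "\<exists>J. \<forall>j\<ge>J. (\<Sum>n<N. (norm (coef (X j) n - coef (X k) n))\<^sup>2) \<le> e\<^sup>2" by blast
  qed
  have summ: "summable (\<lambda>n. (norm (a n))\<^sup>2)"
  proof -
    obtain M where M: "\<And>j k. j \<ge> M \<Longrightarrow> k \<ge> M \<Longrightarrow> norm (X j - X k) < 1"
      using CauchyD[OF X, of 1] by auto
    have "summable (\<lambda>n. (norm (a n - coef (X M) n))\<^sup>2)"
      by (rule summableI_nonneg_bounded[OF _ tail[OF M order_refl]]) simp_all
    then have "summable (\<lambda>n. (norm (a n - coef (X M) n + coef (X M) n))\<^sup>2)"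
      by (intro summable_norm_add summable_coef)
    then show ?thesis by simp
  qed
  define f where "f = Abs_hardy a"
  have f: "coef f n = a n" for n using summ by (simp add: f_def Abs_hardy_inverse)
  have "X \<longlonglongrightarrow> f"
  proof (rule LIMSEQ_I)
    fix e :: real assume e: "e > 0"
    then obtain M where M: "\<And>j k. j \<ge> M \<Longrightarrow> k \<ge> M \<Longrightarrow> norm (X j - X k) < e / 2"
      using CauchyD[OF X, of "e / 2"] by auto
    have "norm (X k - f) < e" if "k \<ge> M" for k
    proof -
      have "norm (f - X k) \<le> e / 2"
        using tail[OF M that] e by (intro norm_hardy_le_if_partial_sums_le) (auto simp: f)
      then show ?thesis using e by (simp add: norm_minus_commute)
    qed
    then show "\<exists>M. \<forall>k\<ge>M. norm (X k - f) < e" by blast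
  qed
  then show "convergent X" by (auto simp: convergent_def)
qed

lemma L2rel_refl: "L2rel f f \<longleftrightarrow> sq_integrable f"
  by (auto simp: L2rel_def)

lemma sq_integrable_rep_L2: "sq_integrable (rep_L2 f)"
  using Quotient3_rep_reflp[OF Quotient3_L2] by (simp add: L2rel_refl)

lemma abs_rep_L2: "abs_L2 (rep_L2 f) = f"
  by (rule Quotient3_abs_rep[OF Quotient3_L2])

lemma norm_abs_L2: "sq_integrable u \<Longrightarrow> (norm (abs_L2 u))\<^sup>2 = (\<integral>t. (norm (u t))\<^sup>2 \<partial>circle)"
proof -
  assume u: "sq_integrable u"
  have "complex_of_real ((norm (abs_L2 u))\<^sup>2) = (\<integral>t. cinner (u t) (u t) \<partial>circle)"
    unfolding cinner_self[symmetric] using u by (simp add: cinner_L2.abs_eq L2rel_refl)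
  also have "\<dots> = complex_of_real (\<integral>t. (norm (u t))\<^sup>2 \<partial>circle)"
    unfolding cinner_self by (rule integral_complex_of_real)
  finally show ?thesis using of_real_eq_iff by blast
qed

lemma sq_integrable_diff:
  "sq_integrable f \<Longrightarrow> sq_integrable g \<Longrightarrow> sq_integrable (\<lambda>t. f t - g t)"
  using sq_integrable_add[of f "\<lambda>t. (-1) *\<^sub>C g t"] sq_integrable_scaleC[of g "\<lambda>_. -1" 1]
  by (simp add: scaleC_minus_left)

lemma abs_L2_diff:
  assumes "sq_integrable u" "sq_integrable v"
  shows "abs_L2 u - abs_L2 v = abs_L2 (\<lambda>t. u t - v t)"
proof -
  have "sq_integrable (\<lambda>t. (-1) *\<^sub>C v t)"
    by (rule sq_integrable_scaleC[OF assms(2), where B = 1]) auto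
  then show ?thesis
    unfolding minus_L2_def uminus_L2_def
    using assms by (simp add: scaleC_L2.abs_eq plus_L2.abs_eq L2rel_refl)
      (simp add: scaleC_minus_left)
qed

lemma norm_diff_L2:
  "(norm (f - g))\<^sup>2 = (\<integral>t. (norm (rep_L2 f t - rep_L2 g t))\<^sup>2 \<partial>circle)"
proof -
  have "f - g = abs_L2 (\<lambda>t. rep_L2 f t - rep_L2 g t)"
    using abs_L2_diff[OF sq_integrable_rep_L2 sq_integrable_rep_L2, of f g]
    by (simp add: abs_rep_L2)
  then show ?thesis
    by (simp add: norm_abs_L2 sq_integrable_diff sq_integrable_rep_L2)
qed

lemma emeasure_circle_space: "emeasure circle (space circle) = 1"
  unfolding circle_def by (rule prob_space.emeasure_space_1, rule prob_space_uniform_measure) simp_all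

lemma nn_integral_norm_diff_L2:
  "(\<integral>\<^sup>+t. ennreal ((norm (rep_L2 f t - rep_L2 g t))\<^sup>2) \<partial>circle) = ennreal ((norm (f - g))\<^sup>2)"
  unfolding norm_diff_L2
  using sq_integrable_diff[OF sq_integrable_rep_L2[of f] sq_integrable_rep_L2[of g]]
  by (intro nn_integral_eq_integral) (auto simp: sq_integrable_def)

lemma quarter_power: "(1/4::real) ^ i = ((1/2) ^ i)\<^sup>2"
proof -
  have "((1/2) ^ i)\<^sup>2 = ((1/2::real)\<^sup>2) ^ i" by (metis mult.commute power_mult)
  also have "(1/2::real)\<^sup>2 = 1/4" by (simp add: power2_eq_square)
  finally show ?thesis by simp
qed

lemma double_le_square_bound:
  fixes d :: real
  assumes "d \<ge> 0"
  shows "d \<le> 2 ^ i * d\<^sup>2 + (1/2) ^ i"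
proof -
  define p :: real where "p = 2 ^ i"
  have p: "p > 0" by (simp add: p_def)
  have "0 \<le> (p * d - 1)\<^sup>2" by simp
  then have "2 * d * p \<le> (p * d\<^sup>2) * p + 1"
    by (simp add: power2_eq_square algebra_simps)
  also have "\<dots> = (p * d\<^sup>2 + 1 / p) * p" using p by (simp add: field_simps)
  finally have "2 * d \<le> p * d\<^sup>2 + 1 / p" using p by simp
  then have "d \<le> p * d\<^sup>2 + 1 / p" using assms by linarith
  then show ?thesis by (simp add: p_def power_one_over)
qed

text \<open>Riesz--Fischer: a rapidly converging subsequence converges almost everywhere, and Fatou's lemma
  turns pointwise into norm convergence.\<close>

lemma L2_complete:
  fixes X :: "nat \<Rightarrow> 'a::{chilbert_space, second_countable_topology} L2"
  assumes X: "Cauchy X"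
  shows "convergent X"
proof -
  have "\<exists>N. \<forall>j\<ge>N. \<forall>k\<ge>N. norm (X j - X k) < (1/2) ^ i" for i
    using CauchyD[OF X, of "(1/2) ^ i"] by auto
  then obtain N where N: "\<And>i j k. j \<ge> N i \<Longrightarrow> k \<ge> N i \<Longrightarrow> norm (X j - X k) < (1/2) ^ i" by metis
  define M where "M i = (\<Sum>k\<le>i. N k)" for i
  have MN: "N i \<le> M i" for i unfolding M_def by (rule member_le_sum) auto
  have Mm: "M i \<le> M j" if "i \<le> j" for i j unfolding M_def using that by (intro sum_mono2) auto
  define Y where "Y i = X (M i)" for i
  have Y: "norm (Y j - Y i) < (1/2) ^ i" if "i \<le> j" for i j
    unfolding Y_def using MN[of i] Mm[OF that] by (intro N) auto
  define f where "f i = rep_L2 (Y i)" for i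
  have sq: "sq_integrable (f i)" for i unfolding f_def by (rule sq_integrable_rep_L2)
  then have [measurable]: "f i \<in> borel_measurable circle" for i by (simp add: sq_integrable_def)
  have nn: "(\<integral>\<^sup>+t. ennreal ((norm (f j t - f i t))\<^sup>2) \<partial>circle) \<le> ennreal ((1/4) ^ i)" if "i \<le> j" for i j
  proof -
    have "(norm (Y j - Y i))\<^sup>2 \<le> ((1/2) ^ i)\<^sup>2" using Y[OF that] by (intro power_mono) auto
    also have "\<dots> = (1/4) ^ i" by (rule quarter_power[symmetric])
    finally show ?thesis unfolding f_def nn_integral_norm_diff_L2 by (rule ennreal_leI)
  qed
  \<comment> \<open>\<open>d \<le> 2\<^sup>i d\<^sup>2 + 2\<^sup>-\<^sup>i\<close> turns the \<open>L\<^sup>2\<close> bound on consecutive differences into a summable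
    \<open>L\<^sup>1\<close> bound.\<close>
  have one: "(\<integral>\<^sup>+t. ennreal (norm (f (Suc i) t - f i t)) \<partial>circle) \<le> ennreal (2 * (1/2) ^ i)" for i
  proof -
    have "(\<integral>\<^sup>+t. ennreal (norm (f (Suc i) t - f i t)) \<partial>circle)
      \<le> (\<integral>\<^sup>+t. ennreal (2 ^ i) * ennreal ((norm (f (Suc i) t - f i t))\<^sup>2) + ennreal ((1/2) ^ i) \<partial>circle)"
    proof (rule nn_integral_mono)
      fix t
      let ?d = "norm (f (Suc i) t - f i t)"
      have "ennreal ?d \<le> ennreal (2 ^ i * ?d\<^sup>2 + (1/2) ^ i)"
        by (intro ennreal_leI double_le_square_bound) simp
      also have "\<dots> = ennreal (2 ^ i) * ennreal (?d\<^sup>2) + ennreal ((1/2) ^ i)"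
        by (subst ennreal_plus) (simp_all add: ennreal_mult del: ennreal_plus)
      finally show "ennreal ?d \<le> ennreal (2 ^ i) * ennreal (?d\<^sup>2) + ennreal ((1/2) ^ i)" .
    qed
    also have "\<dots> = ennreal (2 ^ i) * (\<integral>\<^sup>+t. ennreal ((norm (f (Suc i) t - f i t))\<^sup>2) \<partial>circle) + ennreal ((1/2) ^ i)"
      by (simp add: nn_integral_add nn_integral_cmult emeasure_circle_space)
    also have "\<dots> \<le> ennreal (2 ^ i) * ennreal ((1/4) ^ i) + ennreal ((1/2) ^ i)"
      by (intro add_mono mult_left_mono nn) auto
    also have "\<dots> = ennreal (2 ^ i * (1/4) ^ i + (1/2) ^ i)"
      by (subst ennreal_plus) (simp_all add: ennreal_mult del: ennreal_plus)
    also have "2 ^ i * (1/4) ^ i + (1/2) ^ i = 2 * (1/2::real) ^ i"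
      using power_mult_distrib[of 2 "1/4::real" i] by simp
    finally show ?thesis .
  qed
  have "(\<integral>\<^sup>+t. (\<Sum>i. ennreal (norm (f (Suc i) t - f i t))) \<partial>circle)
      = (\<Sum>i. \<integral>\<^sup>+t. ennreal (norm (f (Suc i) t - f i t)) \<partial>circle)"
    by (rule nn_integral_suminf) measurable
  also have "\<dots> \<le> (\<Sum>i. ennreal (2 * (1/2) ^ i))"
    by (intro suminf_le one) auto
  also have "\<dots> < \<infinity>"
    by (simp add: suminf_ennreal2 summable_mult summable_geometric)
  finally have "AE t in circle. (\<Sum>i. ennreal (norm (f (Suc i) t - f i t))) \<noteq> \<infinity>"
    by (intro nn_integral_PInf_AE) auto
  then have conv: "AE t in circle. convergent (\<lambda>i. f i t)"
  proof eventually_elim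
    case (elim t)
    then have "summable (\<lambda>i. norm (f (Suc i) t - f i t))"
      by (intro summable_suminf_not_top) auto
    then have "summable (\<lambda>i. f (Suc i) t - f i t)" by (rule summable_norm_cancel)
    then have "convergent (\<lambda>n. \<Sum>i<n. f (Suc i) t - f i t)"
      by (simp add: summable_iff_convergent)
    then have "convergent (\<lambda>n. f n t - f 0 t)" using sum_lessThan_telescope[of "\<lambda>i. f i t"] by simp
    then have "convergent (\<lambda>n. (f n t - f 0 t) + f 0 t)" by (intro convergent_add convergent_const)
    then show ?case by simp
  qed
  define g where "g t = lim (\<lambda>i. f i t)" for t
  have [measurable]: "g \<in> borel_measurable circle" unfolding g_def by measurable
  have lim: "AE t in circle. (\<lambda>i. f i t) \<longlonglongrightarrow> g t"
    using conv by eventually_elim (simp add: g_def convergent_LIMSEQ_iff)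
  have fatou: "(\<integral>\<^sup>+t. ennreal ((norm (g t - f i t))\<^sup>2) \<partial>circle) \<le> ennreal ((1/4) ^ i)" for i
  proof -
    have "(\<integral>\<^sup>+t. ennreal ((norm (g t - f i t))\<^sup>2) \<partial>circle)
        = (\<integral>\<^sup>+t. liminf (\<lambda>j. ennreal ((norm (f j t - f i t))\<^sup>2)) \<partial>circle)"
    proof (rule nn_integral_cong_AE, use lim in eventually_elim)
      fix t assume "(\<lambda>j. f j t) \<longlonglongrightarrow> g t"
      then have "(\<lambda>j. ennreal ((norm (f j t - f i t))\<^sup>2)) \<longlonglongrightarrow> ennreal ((norm (g t - f i t))\<^sup>2)"
        by (intro tendsto_ennrealI tendsto_intros)
      then show "ennreal ((norm (g t - f i t))\<^sup>2) = liminf (\<lambda>j. ennreal ((norm (f j t - f i t))\<^sup>2))"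
        by (intro lim_imp_Liminf[symmetric]) auto
    qed
    also have "\<dots> \<le> liminf (\<lambda>j. \<integral>\<^sup>+t. ennreal ((norm (f j t - f i t))\<^sup>2) \<partial>circle)"
      by (rule nn_integral_liminf) measurable
    also have "\<dots> \<le> liminf (\<lambda>j. ennreal ((1/4) ^ i))"
      by (intro Liminf_mono eventually_sequentiallyI[of i] nn)
    also have "\<dots> = ennreal ((1/4) ^ i)" by (simp add: Liminf_const)
    finally show ?thesis .
  qed
  have sqd: "sq_integrable (\<lambda>t. g t - f i t)" for i
    unfolding sq_integrable_def
    by (intro conjI integrableI_bounded) (use fatou[of i] in \<open>auto intro: le_less_trans\<close>)
  then have sqg: "sq_integrable g"
    using sq_integrable_add[OF sqd[of 0] sq[of 0]] by simp
  define G where "G = abs_L2 g"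
  have G: "norm (G - Y i) \<le> (1/2) ^ i" for i
  proof -
    have "G - Y i = abs_L2 (\<lambda>t. g t - f i t)"
      using abs_L2_diff[OF sqg sq, of i] by (simp add: G_def f_def abs_rep_L2)
    then have "ennreal ((norm (G - Y i))\<^sup>2) = ennreal (\<integral>t. (norm (g t - f i t))\<^sup>2 \<partial>circle)"
      by (simp add: norm_abs_L2 sqd)
    also have "\<dots> = (\<integral>\<^sup>+t. ennreal ((norm (g t - f i t))\<^sup>2) \<partial>circle)"
      using sqd[of i] by (intro nn_integral_eq_integral[symmetric]) (auto simp: sq_integrable_def)
    also have "\<dots> \<le> ennreal ((1/4) ^ i)" by (rule fatou)
    finally have "(norm (G - Y i))\<^sup>2 \<le> (1/4) ^ i" by simp
    also have "\<dots> = ((1/2) ^ i)\<^sup>2" by (rule quarter_power)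
    finally show ?thesis by (rule power2_le_imp_le) simp
  qed
  have "X \<longlonglongrightarrow> G"
  proof (rule LIMSEQ_I)
    fix e :: real assume e: "e > 0"
    then obtain i where i: "(1/2::real) ^ i < e / 2"
      using real_arch_pow_inv[of "e / 2" "1/2"] by auto
    have "norm (X k - G) < e" if "k \<ge> M i" for k
    proof -
      have "norm (X k - Y i) < (1/2) ^ i" unfolding Y_def using that MN[of i] by (intro N) auto
      moreover have "norm (X k - G) \<le> norm (X k - Y i) + norm (G - Y i)"
        using norm_triangle_ineq4[of "X k - Y i" "G - Y i"] by simp
      ultimately show ?thesis using G[of i] i by linarith
    qed
    then show "\<exists>K. \<forall>k\<ge>K. norm (X k - G) < e" by blast
  qed
  then show ?thesis by (auto simp: convergent_def)
qed

instance L2 :: ("{chilbert_space, second_countable_topology}") chilbert_space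
  by intro_classes (rule L2_complete)

instance prod :: (chilbert_space, chilbert_space) chilbert_space
  by intro_classes


section \<open>Commuting normal operators and their joint spectrum\<close>

text \<open>Carrying the adjoint along as a second operator avoids the description operator in \<open>adj_on\<close>, whose
  values are meaningful only on complete subspaces.\<close>

definition adjoint_pair :: "'a::complex_inner set \<Rightarrow> ('a \<Rightarrow> 'a) \<Rightarrow> ('a \<Rightarrow> 'a) \<Rightarrow> bool" where
  "adjoint_pair K T T' \<longleftrightarrow> bounded_op_on K T \<and> bounded_op_on K T' \<and>
     (\<forall>x\<in>K. \<forall>y\<in>K. cinner (T x) y = cinner x (T' y))"

lemma adjoint_pairD:
  assumes "adjoint_pair K T T'" "x \<in> K" "y \<in> K"
  shows "cinner (T x) y = cinner x (T' y)" "cinner (T' x) y = cinner x (T y)"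
  using assms unfolding adjoint_pair_def by (blast, metis cinner_commute)

lemma adjoint_pair_adj_on:
  fixes K :: "'a::chilbert_space set"
  assumes "csubspace K" "closed K" "bounded_op_on K T"
  shows "adjoint_pair K T (adj_on K T)"
  unfolding adjoint_pair_def
  using assms(3) bounded_op_on_adj_on[OF assms] cinner_adj_on[OF assms] by blast

lemma bounded_op_on_compose:
  assumes "bounded_op_on K S" "bounded_op_on K T"
  shows "bounded_op_on K (\<lambda>x. S (T x))"
proof -
  obtain B C where B: "B > 0" "\<And>x. x \<in> K \<Longrightarrow> norm (S x) \<le> B * norm x"
    and C: "C > 0" "\<And>x. x \<in> K \<Longrightarrow> norm (T x) \<le> C * norm x"
    using assms[THEN bounded_op_on_bound] by metis
  show ?thesis
  proof (rule bounded_op_onI[where B = "B * C"])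
    fix x assume x: "x \<in> K"
    have "norm (S (T x)) \<le> B * norm (T x)" using x by (intro B bounded_op_on_in[OF assms(2)])
    also have "\<dots> \<le> B * (C * norm x)" using x B(1) by (intro mult_left_mono C) auto
    finally show "norm (S (T x)) \<le> B * C * norm x" by (simp add: mult.assoc)
  qed (simp_all add: bounded_op_on_in[OF assms(1)] bounded_op_on_in[OF assms(2)]
      bounded_op_on_add[OF assms(1)] bounded_op_on_add[OF assms(2)]
      bounded_op_on_scaleC[OF assms(1)] bounded_op_on_scaleC[OF assms(2)])
qed

lemma bounded_op_on_lincomb:
  assumes K: "csubspace K" and ST: "bounded_op_on K S" "bounded_op_on K T"
  shows "bounded_op_on K (\<lambda>x. c *\<^sub>C S x + d *\<^sub>C T x)"
proof -
  obtain B C where B: "B > 0" "\<And>x. x \<in> K \<Longrightarrow> norm (S x) \<le> B * norm x"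
    and C: "C > 0" "\<And>x. x \<in> K \<Longrightarrow> norm (T x) \<le> C * norm x"
    using ST[THEN bounded_op_on_bound] by metis
  show ?thesis
  proof (rule bounded_op_onI[where B = "cmod c * B + cmod d * C"])
    fix x assume x: "x \<in> K"
    have "norm (c *\<^sub>C S x + d *\<^sub>C T x) \<le> cmod c * norm (S x) + cmod d * norm (T x)"
      by (metis norm_scaleC norm_triangle_ineq)
    also have "\<dots> \<le> cmod c * (B * norm x) + cmod d * (C * norm x)"
      using x by (intro add_mono mult_left_mono B C) auto
    finally show "norm (c *\<^sub>C S x + d *\<^sub>C T x) \<le> (cmod c * B + cmod d * C) * norm x"
      by (simp add: algebra_simps)
  next
    fix x y assume "x \<in> K" "y \<in> K"
    then show "c *\<^sub>C S (x + y) + d *\<^sub>C T (x + y) = c *\<^sub>C S x + d *\<^sub>C T x + (c *\<^sub>C S y + d *\<^sub>C T y)"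
      by (simp add: bounded_op_on_add[OF ST(1)] bounded_op_on_add[OF ST(2)] scaleC_add_right)
  next
    fix e x assume "x \<in> K"
    then show "c *\<^sub>C S (e *\<^sub>C x) + d *\<^sub>C T (e *\<^sub>C x) = e *\<^sub>C (c *\<^sub>C S x + d *\<^sub>C T x)"
      by (simp add: bounded_op_on_scaleC[OF ST(1)] bounded_op_on_scaleC[OF ST(2)]
          scaleC_add_right scaleC_scaleC mult.commute)
  qed (intro csubspace_add[OF K] csubspace_scaleC[OF K] bounded_op_on_in[OF ST(1)] bounded_op_on_in[OF ST(2)])
qed

lemma bounded_op_on_id: "bounded_op_on K (\<lambda>x. x)"
  by (rule bounded_op_onI[where B = 1]) auto

lemma bounded_op_on_shift:
  assumes K: "csubspace K" and T: "bounded_op_on K T"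
  shows "bounded_op_on K (\<lambda>x. T x - l *\<^sub>C x)"
  using bounded_op_on_lincomb[OF K T bounded_op_on_id, of 1 "- l"] by (simp add: scaleC_minus_left)

lemma adjoint_pair_shift:
  assumes K: "csubspace K" and T: "adjoint_pair K T T'"
  shows "adjoint_pair K (\<lambda>x. T x - l *\<^sub>C x) (\<lambda>x. T' x - cnj l *\<^sub>C x)"
  using T by (auto simp: adjoint_pair_def bounded_op_on_shift[OF K] cinner_diff_left cinner_diff_right
      cinner_scaleC_left cinner_scaleC_right)

lemma norm_adjoint_eq:
  assumes T: "adjoint_pair K T T'" and n: "\<And>x. x \<in> K \<Longrightarrow> T (T' x) = T' (T x)" and x: "x \<in> K"
  shows "norm (T' x) = norm (T x)"
proof -
  have in': "T x \<in> K" "T' x \<in> K"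
    using T x bounded_op_on_in[of K T x] bounded_op_on_in[of K T' x] by (auto simp: adjoint_pair_def)
  have "cinner (T' x) (T' x) = cinner (T (T' x)) x" by (rule adjoint_pairD(1)[OF T in'(2) x, symmetric])
  also have "\<dots> = cinner (T' (T x)) x" by (simp add: n x)
  also have "\<dots> = cinner (T x) (T x)" by (rule adjoint_pairD(2)[OF T in'(1) x])
  finally have "(norm (T' x))\<^sup>2 = (norm (T x))\<^sup>2"
    unfolding cinner_self using of_real_eq_iff by blast
  then show ?thesis by simp
qed


lemma normal_shift:
  assumes K: "csubspace K" and T: "adjoint_pair K T T'" and n: "T (T' x) = T' (T x)" and x: "x \<in> K"
  shows "T (T' x - cnj l *\<^sub>C x) - l *\<^sub>C (T' x - cnj l *\<^sub>C x) = T' (T x - l *\<^sub>C x) - cnj l *\<^sub>C (T x - l *\<^sub>C x)"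
proof -
  have b: "bounded_op_on K T" "bounded_op_on K T'" using T by (auto simp: adjoint_pair_def)
  show ?thesis
    using x b[THEN bounded_op_on_in, of x]
    by (simp add: bounded_op_on_diff[OF K b(1)] bounded_op_on_diff[OF K b(2)] csubspace_scaleC[OF K]
        bounded_op_on_scaleC[OF b(1)] bounded_op_on_scaleC[OF b(2)] n scaleC_diff_right scaleC_scaleC mult.commute)
qed


section \<open>Koszul exactness and lower bounds\<close>

text \<open>The gliding hump: if the norms were unbounded, a series \<open>\<Sum> \<plusminus>3\<^sup>-\<^sup>n u\<^sub>n/\<parallel>u\<^sub>n\<parallel>\<close> along a subsequence
  with \<open>\<parallel>u\<^sub>n\<parallel> \<ge> 4\<^sup>n\<close>, its signs chosen so that the \<open>n\<close>-th term does not cancel against the earlier ones,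
  would have unbounded inner products with the \<open>u\<^sub>n\<close>.\<close>

lemma uniform_boundedness_cinner:
  fixes K :: "'a::chilbert_space set" and v :: "nat \<Rightarrow> 'a"
  assumes K: "csubspace K" and cl: "closed K" and v: "\<And>n. v n \<in> K"
    and pw: "\<And>w. w \<in> K \<Longrightarrow> \<exists>C. \<forall>n. cmod (cinner w (v n)) \<le> C"
  shows "\<exists>C. \<forall>n. norm (v n) \<le> C"
proof (rule ccontr)
  assume "\<not> (\<exists>C. \<forall>n. norm (v n) \<le> C)"
  then have "\<exists>k. norm (v k) > 4 ^ n" for n by (meson not_le)
  then obtain k where k: "\<And>n. norm (v (k n)) > 4 ^ n" by metis
  define u where "u n = v (k n)" for n
  have uK: "u n \<in> K" for n by (simp add: u_def v)
  have u4: "norm (u n) > 4 ^ n" for n by (simp add: u_def k)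
  have u0: "u n \<noteq> 0" for n using u4[of n] zero_less_power[of "4::real" n] by fastforce
  define d where "d n y = (if inner y (u n) \<ge> 0 then 1 else - 1) *\<^sub>R (1/3) ^ n *\<^sub>R sgn (u n)" for n y
  define x where "x = rec_nat 0 (\<lambda>n y. y + d n y)"
  have x0: "x 0 = 0" and xS: "x (Suc n) = x n + d n (x n)" for n by (simp_all add: x_def)
  have dK: "d n y \<in> K" for n y
    unfolding d_def sgn_div_norm by (intro csubspace_scaleR K uK)
  have nd: "norm (d n y) = (1/3) ^ n" for n y
    using u0 by (simp add: d_def norm_sgn)
  have xK: "x n \<in> K" for n
    by (induction n) (auto simp: x0 xS csubspace_0[OF K] intro: csubspace_add[OF K] dK)
  have hump: "\<bar>inner (x (Suc n)) (u n)\<bar> \<ge> (1/3) ^ n * norm (u n)" for n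
  proof -
    have "inner (sgn (u n)) (u n) = norm (u n)"
      using u0[of n] by (simp add: sgn_div_norm power2_norm_eq_inner[symmetric] power2_eq_square)
    then have "inner (d n (x n)) (u n) = (if inner (x n) (u n) \<ge> 0 then 1 else - 1) * ((1/3) ^ n * norm (u n))"
      by (simp add: d_def)
    moreover have "(1/3) ^ n * norm (u n) \<ge> 0" by simp
    ultimately show ?thesis unfolding xS inner_add_left by (auto split: if_splits)
  qed
  have step: "norm (x (Suc n + j) - x (Suc n)) \<le> (1/2) * ((1/3) ^ n - (1/3) ^ (n + j))" for n j
  proof (induction j)
    case (Suc j)
    have "norm (x (Suc n + Suc j) - x (Suc n)) = norm ((x (Suc n + j) - x (Suc n)) + d (Suc n + j) (x (Suc n + j)))"
      using xS[of "Suc n + j"] by (simp add: algebra_simps)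
    also have "\<dots> \<le> norm (x (Suc n + j) - x (Suc n)) + (1/3) ^ (Suc n + j)"
      using norm_triangle_ineq nd by metis
    also have "\<dots> \<le> (1/2) * ((1/3) ^ n - (1/3) ^ (n + j)) + (1/3) ^ (Suc n + j)"
      using Suc.IH by simp
    also have "\<dots> = (1/2) * ((1/3) ^ n - (1/3) ^ (n + Suc j))" by (simp add: algebra_simps)
    finally show ?case .
  qed simp
  have step': "norm (x m - x (Suc n)) \<le> (1/2) * (1/3) ^ n" if "m > n" for m n
  proof -
    have "norm (x (Suc n + (m - Suc n)) - x (Suc n)) \<le> (1/2) * ((1/3) ^ n - (1/3) ^ (n + (m - Suc n)))"
      by (rule step)
    also have "\<dots> \<le> (1/2) * (1/3) ^ n" by simp
    finally show ?thesis using that by simp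
  qed
  have "Cauchy x"
  proof (rule CauchyI)
    fix e :: real assume "e > 0"
    then obtain N where N: "(1/3::real) ^ N < e" using real_arch_pow_inv[of e "1/3"] by auto
    have "norm (x m - x n) < e" if "m \<ge> Suc N" "n \<ge> Suc N" for m n
    proof -
      have "norm (x m - x n) \<le> norm (x m - x (Suc N)) + norm (x n - x (Suc N))"
        using norm_triangle_ineq4[of "x m - x (Suc N)" "x n - x (Suc N)"] by simp
      then show ?thesis using step'[of N m] step'[of N n] that N by simp
    qed
    then show "\<exists>M. \<forall>m\<ge>M. \<forall>n\<ge>M. norm (x m - x n) < e" by blast
  qed
  then obtain w where w: "x \<longlonglongrightarrow> w" by (auto simp: Cauchy_convergent_iff convergent_def)
  have wK: "w \<in> K" using closed_sequentially[OF cl xK w] .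
  have wx: "norm (w - x (Suc n)) \<le> (1/2) * (1/3) ^ n" for n
  proof (rule LIMSEQ_le_const2)
    show "(\<lambda>m. norm (x m - x (Suc n))) \<longlonglongrightarrow> norm (w - x (Suc n))" by (intro tendsto_intros w)
    show "\<exists>N. \<forall>m\<ge>N. norm (x m - x (Suc n)) \<le> (1/2) * (1/3) ^ n"
      using step' by (intro exI[of _ "Suc n"]) simp
  qed
  obtain C where C: "\<And>n. cmod (cinner w (v n)) \<le> C" using pw[OF wK] by blast
  have low: "(1/2) * (4/3) ^ n \<le> C" for n
  proof -
    have "\<bar>inner (w - x (Suc n)) (u n)\<bar> \<le> norm (w - x (Suc n)) * norm (u n)"
      by (rule Cauchy_Schwarz_ineq2)
    also have "\<dots> \<le> ((1/2) * (1/3) ^ n) * norm (u n)" by (intro mult_right_mono wx) simp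
    finally have "\<bar>inner w (u n)\<bar> \<ge> (1/2) * ((1/3) ^ n * norm (u n))"
      using hump[of n] unfolding inner_diff_left by linarith
    moreover have "\<bar>inner w (u n)\<bar> \<le> cmod (cinner w (u n))"
      unfolding Re_cinner[symmetric] by (rule abs_Re_le_cmod)
    moreover have "(1/3) ^ n * norm (u n) \<ge> (1/3) ^ n * 4 ^ n"
      using u4[of n] by (intro mult_left_mono) auto
    moreover have "(1/3) ^ n * 4 ^ n = (4/3::real) ^ n" by (simp add: power_mult_distrib[symmetric])
    ultimately show ?thesis using C[of "k n"] by (simp add: u_def)
  qed
  obtain n where "2 * C < (4/3::real) ^ n" using real_arch_pow[of "4/3" "2 * C"] by auto
  then show False using low[of n] by linarith
qed


text \<open>If the lower bound failed, there would be vectors \<open>v\<^sub>n\<close> of unbounded norm with \<open>Av\<^sub>n\<close> and \<open>Bv\<^sub>n\<close>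
  bounded. By normality \<open>A\<^sup>*v\<^sub>n\<close> and \<open>B\<^sup>*v\<^sub>n\<close> are bounded too, so exactness at the last place, where every
  \<open>w\<close> has the form \<open>Bp - Aq\<close>, bounds all \<open>\<langle>w, v\<^sub>n\<rangle>\<close>, against uniform boundedness.\<close>

lemma koszul_exact_imp_bounded_below:
  fixes K :: "'a::chilbert_space set"
  assumes K: "csubspace K" and cl: "closed K"
    and A: "adjoint_pair K A A'" and An: "\<And>x. x \<in> K \<Longrightarrow> A (A' x) = A' (A x)"
    and B: "adjoint_pair K B B'" and Bn: "\<And>x. x \<in> K \<Longrightarrow> B (B' x) = B' (B x)"
    and ex: "koszul_exact_on K A B"
  shows "\<exists>e>0. \<forall>x\<in>K. e * norm x \<le> norm (A x) + norm (B x)"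
proof (rule ccontr)
  assume "\<not> ?thesis"
  then have "\<exists>x\<in>K. norm (A x) + norm (B x) < inverse (real (Suc n)) * norm x" for n
    by (metis inverse_positive_iff_positive not_le of_nat_0_less_iff zero_less_Suc)
  then obtain x where xK: "x n \<in> K" and x: "norm (A (x n)) + norm (B (x n)) < inverse (real (Suc n)) * norm (x n)" for n
    by metis
  have nz: "norm (x n) > 0" for n
  proof (rule ccontr)
    assume "\<not> norm (x n) > 0"
    then have "norm (A (x n)) + norm (B (x n)) < 0" using x[of n] by simp
    then show False using norm_ge_zero[of "A (x n)"] norm_ge_zero[of "B (x n)"] by linarith
  qed
  define v where "v n = complex_of_real (real (Suc n) / norm (x n)) *\<^sub>C x n" for n
  have vK: "v n \<in> K" for n unfolding v_def by (intro csubspace_scaleC[OF K] xK)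
  have nv: "norm (v n) = real (Suc n)" for n
    unfolding v_def norm_scaleC norm_of_real using nz[of n] by simp
  have bA: "bounded_op_on K A" and bB: "bounded_op_on K B" using A B by (auto simp: adjoint_pair_def)
  have small: "norm (A (v n)) + norm (B (v n)) \<le> 1" for n
  proof -
    let ?c = "real (Suc n) / norm (x n)"
    have c: "?c > 0" using nz[of n] by simp
    have "norm (A (v n)) + norm (B (v n)) = ?c * (norm (A (x n)) + norm (B (x n)))"
      unfolding v_def bounded_op_on_scaleC[OF bA xK] bounded_op_on_scaleC[OF bB xK] norm_scaleC norm_of_real
      using c by (simp add: distrib_left)
    also have "\<dots> \<le> ?c * (inverse (real (Suc n)) * norm (x n))"
      using c x[of n] by (intro mult_left_mono) auto
    also have "\<dots> = 1" using nz[of n] by (simp add: field_simps del: of_nat_Suc)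
    finally show ?thesis .
  qed
  have sur: "\<forall>w\<in>K. \<exists>p\<in>K. \<exists>q\<in>K. w = B p - A q"
    using ex unfolding koszul_exact_on_def by (elim conjE)
  have "\<exists>C. \<forall>n. cmod (cinner w (v n)) \<le> C" if w: "w \<in> K" for w
  proof -
    obtain p q where pq: "p \<in> K" "q \<in> K" "w = B p - A q"
      using sur w by blast
    have "cmod (cinner w (v n)) \<le> norm p + norm q" for n
    proof -
      have "cinner w (v n) = cinner p (B' (v n)) - cinner q (A' (v n))"
        unfolding pq(3) cinner_diff_left
          adjoint_pairD(1)[OF A pq(2) vK[of n]] adjoint_pairD(1)[OF B pq(1) vK[of n]] ..
      then have "cmod (cinner w (v n)) \<le> cmod (cinner p (B' (v n))) + cmod (cinner q (A' (v n)))"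
        by (metis norm_triangle_ineq4)
      also have "\<dots> \<le> norm p * norm (B' (v n)) + norm q * norm (A' (v n))"
        by (intro add_mono cmod_cinner_le)
      also have "\<dots> = norm p * norm (B (v n)) + norm q * norm (A (v n))"
        by (simp add: norm_adjoint_eq[OF A An vK] norm_adjoint_eq[OF B Bn vK])
      also have "\<dots> \<le> norm p * 1 + norm q * 1"
      proof -
        have "norm (A (v n)) \<le> 1" "norm (B (v n)) \<le> 1"
          using small[of n] norm_ge_zero[of "A (v n)"] norm_ge_zero[of "B (v n)"] by linarith+
        then show ?thesis by (intro add_mono mult_left_mono) auto
      qed
      finally show ?thesis by simp
    qed
    then show ?thesis by blast
  qed
  then obtain C where C: "\<And>n. norm (v n) \<le> C"
    using uniform_boundedness_cinner[of K v, OF K cl vK] by blast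
  obtain n where "C < real n" using reals_Archimedean2 by blast
  then show False using C[of n] by (simp add: nv)
qed

text \<open>For small \<open>t\<close> the map \<open>x \<mapsto> x - t(Ex - v)\<close> is a contraction.\<close>

lemma lax_milgram_on:
  fixes K :: "'a::chilbert_space set"
  assumes K: "csubspace K" and cl: "closed K" and E: "bounded_op_on K E"
    and al: "a > 0" and low: "\<And>x. x \<in> K \<Longrightarrow> a * (norm x)\<^sup>2 \<le> inner (E x) x" and v: "v \<in> K"
  shows "\<exists>w\<in>K. E w = v"
proof -
  obtain C0 where C0: "C0 > 0" "\<And>x. x \<in> K \<Longrightarrow> norm (E x) \<le> C0 * norm x"
    using bounded_op_on_bound[OF E] by blast
  define C where "C = C0 + a"
  have C: "C > a" "\<And>x. x \<in> K \<Longrightarrow> norm (E x) \<le> C * norm x"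
  proof -
    show "C > a" using C0 by (simp add: C_def)
    fix x assume "x \<in> K"
    have "C0 * norm x \<le> C * norm x" using al by (intro mult_right_mono) (auto simp: C_def)
    then show "norm (E x) \<le> C * norm x" using C0(2)[OF \<open>x \<in> K\<close>] by linarith
  qed
  define t where "t = a / C\<^sup>2"
  have t: "t > 0" using al C by (simp add: t_def)
  have tC: "t * C\<^sup>2 = a" using al C by (simp add: t_def)
  define q where "q = sqrt (1 - t * a)"
  have ta: "0 < t * a" "t * a < 1"
  proof -
    show "0 < t * a" using t al by simp
    have "a * a < C * C" using al C by (intro mult_strict_mono) auto
    then show "t * a < 1" using al C by (simp add: t_def power2_eq_square)
  qed
  have contr: "norm (x - t *\<^sub>R E x) \<le> q * norm x" if x: "x \<in> K" for x
  proof -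
    have "(norm (x - t *\<^sub>R E x))\<^sup>2 = (norm x)\<^sup>2 - 2 * t * inner (E x) x + t\<^sup>2 * (norm (E x))\<^sup>2"
      unfolding power2_norm_eq_inner
      by (simp add: inner_diff_left inner_diff_right inner_commute algebra_simps power2_eq_square)
    also have "\<dots> \<le> (norm x)\<^sup>2 - 2 * t * (a * (norm x)\<^sup>2) + t\<^sup>2 * (C * norm x)\<^sup>2"
      using low[OF x] C(2)[OF x] t
      by (intro add_mono diff_mono mult_left_mono power_mono) auto
    also have "\<dots> = (norm x)\<^sup>2 * (1 - 2 * t * a + t * (t * C\<^sup>2))"
      by (simp add: power2_eq_square algebra_simps)
    also have "\<dots> = (norm x)\<^sup>2 * (1 - t * a)" unfolding tC by (simp add: algebra_simps)
    also have "\<dots> = (q * norm x)\<^sup>2"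
      using ta by (simp add: q_def power_mult_distrib mult.commute)
    finally show ?thesis by (rule power2_le_imp_le) (use ta in \<open>simp add: q_def\<close>)
  qed
  have "\<exists>!x. x \<in> K \<and> x - t *\<^sub>R (E x - v) = x"
  proof (rule Banach_fix)
    show "complete K" using cl by (simp add: complete_eq_closed)
    show "K \<noteq> {}" using v by blast
    show "0 \<le> q" "q < 1" using ta by (auto simp: q_def)
    show "(\<lambda>x. x - t *\<^sub>R (E x - v)) ` K \<subseteq> K"
      using v by (auto intro!: csubspace_diff[OF K] csubspace_scaleR[OF K] bounded_op_on_in[OF E])
    fix x y assume xy: "x \<in> K" "y \<in> K"
    have d: "x - y \<in> K" using xy csubspace_diff[OF K] by blast
    have "(x - t *\<^sub>R (E x - v)) - (y - t *\<^sub>R (E y - v)) = (x - y) - t *\<^sub>R E (x - y)"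
      by (simp add: bounded_op_on_diff[OF K E xy] algebra_simps)
    then show "dist (x - t *\<^sub>R (E x - v)) (y - t *\<^sub>R (E y - v)) \<le> q * dist x y"
      using contr[OF d] unfolding dist_norm by metis
  qed
  then show ?thesis using t by auto
qed

text \<open>Under the lower bound, \<open>E = A\<^sup>*A + B\<^sup>*B\<close> is invertible and commutes with \<open>A\<close> and \<open>B\<close>, so
  \<open>E\<^sup>-\<^sup>1A\<^sup>*\<close> and \<open>E\<^sup>-\<^sup>1B\<^sup>*\<close> provide a contracting homotopy of the Koszul complex.\<close>

lemma bounded_below_imp_koszul_exact:
  fixes K :: "'a::chilbert_space set"
  assumes K: "csubspace K" and cl: "closed K"
    and A: "adjoint_pair K A A'" and An: "\<And>x. x \<in> K \<Longrightarrow> A (A' x) = A' (A x)"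
    and B: "adjoint_pair K B B'" and Bn: "\<And>x. x \<in> K \<Longrightarrow> B (B' x) = B' (B x)"
    and AB: "\<And>x. x \<in> K \<Longrightarrow> A (B x) = B (A x)" and AB': "\<And>x. x \<in> K \<Longrightarrow> A (B' x) = B' (A x)"
    and e: "e > 0" and low: "\<And>x. x \<in> K \<Longrightarrow> e * norm x \<le> norm (A x) + norm (B x)"
  shows "koszul_exact_on K A B"
proof -
  have bd: "bounded_op_on K A" "bounded_op_on K A'" "bounded_op_on K B" "bounded_op_on K B'"
    using A B by (auto simp: adjoint_pair_def)
  note mem = bd[THEN bounded_op_on_in]
  note add = bd[THEN bounded_op_on_add]
  have BA': "B (A' x) = A' (B x)" if x: "x \<in> K" for x
  proof (rule cinner_eqI[OF K])
    fix k assume k: "k \<in> K"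
    have "cinner k (B (A' x)) = cinner (A (B' k)) x"
      using adjoint_pairD(2)[OF B k mem(2)[OF x]] adjoint_pairD(1)[OF A mem(4)[OF k] x] by simp
    also have "\<dots> = cinner (B' (A k)) x" by (simp add: AB'[OF k])
    also have "\<dots> = cinner k (A' (B x))"
      using adjoint_pairD(2)[OF B mem(1)[OF k] x] adjoint_pairD(1)[OF A k mem(3)[OF x]] by simp
    finally show "cinner k (B (A' x)) = cinner k (A' (B x))" .
  qed (use mem x in blast)+
  define E where "E x = A' (A x) + B' (B x)" for x
  have bE: "bounded_op_on K E"
    using bounded_op_on_lincomb[OF K bounded_op_on_compose[OF bd(2,1)] bounded_op_on_compose[OF bd(4,3)], of 1 1]
    by (simp add: E_def[abs_def])
  have Ein: "cinner (E x) x = complex_of_real ((norm (A x))\<^sup>2 + (norm (B x))\<^sup>2)" if x: "x \<in> K" for x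
    using adjoint_pairD(2)[OF A mem(1)[OF x] x] adjoint_pairD(2)[OF B mem(3)[OF x] x]
    by (simp add: E_def cinner_add_left cinner_self)
  have Elow: "(e\<^sup>2 / 2) * (norm x)\<^sup>2 \<le> inner (E x) x" if x: "x \<in> K" for x
  proof -
    have "(e * norm x)\<^sup>2 \<le> (norm (A x) + norm (B x))\<^sup>2" using low[OF x] e by (intro power_mono) auto
    also have "\<dots> \<le> 2 * ((norm (A x))\<^sup>2 + (norm (B x))\<^sup>2)"
      using sum_squares_bound[of "norm (A x)" "norm (B x)"] by (simp add: power2_sum)
    finally show ?thesis
      unfolding Re_cinner[symmetric] Ein[OF x] by (simp add: power_mult_distrib)
  qed
  have onto: "\<exists>w\<in>K. E w = v" if "v \<in> K" for v
    using lax_milgram_on[OF K cl bE _ Elow that] e by simp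
  have inj: "x = y" if "x \<in> K" "y \<in> K" "E x = E y" for x y
  proof -
    have d: "x - y \<in> K" using that csubspace_diff[OF K] by blast
    have "E (x - y) = 0" using that by (simp add: bounded_op_on_diff[OF K bE])
    then show ?thesis using Elow[OF d] e by (simp add: mult_le_0_iff)
  qed
  have EA: "E (A x) = A (E x)" if x: "x \<in> K" for x
    using x by (simp add: E_def add mem An AB AB')
  have EB: "E (B x) = B (E x)" if x: "x \<in> K" for x
    using x by (simp add: E_def add mem Bn AB[symmetric] BA')
  show ?thesis
    unfolding koszul_exact_on_def
  proof (intro conjI ballI impI)
    fix x assume "x \<in> K" "A x = 0 \<and> B x = 0"
    then show "x = 0" using low[of x] e by (simp add: mult_le_0_iff)
  next
    fix x y assume x: "x \<in> K" and y: "y \<in> K" and xy: "B x = A y"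
    have "A' x + B' y \<in> K" by (intro csubspace_add[OF K] mem x y)
    then obtain w where w: "w \<in> K" "E w = A' x + B' y"
      using onto[of "A' x + B' y"] by blast
    have "E (A w) = A (A' x) + A (B' y)" using w x y by (simp add: EA add mem)
    also have "\<dots> = E x" using x y by (simp add: E_def An AB' xy)
    finally have "x = A w" using inj w x mem by metis
    moreover have "E (B w) = B (A' x) + B (B' y)" using w x y by (simp add: EB add mem)
    then have "E (B w) = E y" using x y by (simp add: E_def Bn BA' xy)
    then have "y = B w" using inj w y mem by metis
    ultimately show "\<exists>w\<in>K. x = A w \<and> y = B w" using w by blast
  next
    fix v assume "v \<in> K"
    then obtain w where w: "w \<in> K" "E w = v" using onto by blast
    have m: "- A' w \<in> K" using csubspace_uminus[OF K] mem w by blast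
    have "A (- A' w) = - A (A' w)"
      using bounded_op_on_diff[OF K bd(1) csubspace_0[OF K] mem(2)[OF w(1)]] bounded_op_on_zero[OF K bd(1)]
      by simp
    moreover have "v = A (A' w) + B (B' w)"
      unfolding An[OF w(1)] Bn[OF w(1)] using w(2) by (simp add: E_def)
    ultimately have "v = B (B' w) - A (- A' w)" by simp
    then show "\<exists>x\<in>K. \<exists>y\<in>K. v = B x - A y" using m mem w by blast
  qed
qed


section \<open>Joint approximate eigenvectors\<close>

text \<open>Joint approximate eigenvectors are found for one operator after the other. A seminorm \<open>g\<close> records
  the defects \<open>\<parallel>Tx - sx\<parallel>\<close> of the operators treated so far; an operator commuting with these is bounded
  with respect to \<open>g\<close>, so that it preserves approximate smallness of \<open>g\<close>.\<close>

definition seminorm_on :: "'a::complex_inner set \<Rightarrow> ('a \<Rightarrow> real) \<Rightarrow> bool" where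
  "seminorm_on K g \<longleftrightarrow> (\<forall>x\<in>K. \<forall>y\<in>K. g (x + y) \<le> g x + g y) \<and>
     (\<forall>c. \<forall>x\<in>K. g (c *\<^sub>C x) = cmod c * g x)"

definition bounded_wrt :: "'a::complex_inner set \<Rightarrow> ('a \<Rightarrow> real) \<Rightarrow> ('a \<Rightarrow> 'a) \<Rightarrow> bool" where
  "bounded_wrt K g T \<longleftrightarrow> (\<exists>B\<ge>0. \<forall>x\<in>K. g (T x) \<le> B * g x)"

lemma bounded_wrt_zero: "bounded_wrt K (\<lambda>_. 0) T"
  unfolding bounded_wrt_def by (rule exI[of _ 0]) simp

lemma seminorm_on_zero: "seminorm_on K (\<lambda>_. 0)"
  by (simp add: seminorm_on_def)

lemma seminorm_on_nonneg:
  assumes K: "csubspace K" and g: "seminorm_on K g" and x: "x \<in> K"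
  shows "0 \<le> g x"
proof -
  have m: "(-1) *\<^sub>C x \<in> K" by (rule csubspace_scaleC[OF K x])
  have "g (0 *\<^sub>C x) = cmod 0 * g x" using g x unfolding seminorm_on_def by blast
  moreover have "g (x + (-1) *\<^sub>C x) \<le> g x + g ((-1) *\<^sub>C x)"
    using g x m unfolding seminorm_on_def by blast
  moreover have "g ((-1) *\<^sub>C x) = cmod (-1) * g x" using g x unfolding seminorm_on_def by blast
  moreover have "x + (-1) *\<^sub>C x = 0" by (simp add: scaleC_minus_left)
  ultimately show ?thesis by simp
qed

lemma seminorm_on_diff:
  assumes "seminorm_on K g" "csubspace K" "x \<in> K" "y \<in> K"
  shows "g (x - y) \<le> g x + g y"
proof -
  have m: "(-1) *\<^sub>C y \<in> K" by (rule csubspace_scaleC[OF assms(2,4)])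
  have "g (x + (-1) *\<^sub>C y) \<le> g x + g ((-1) *\<^sub>C y)"
    using assms m unfolding seminorm_on_def by blast
  moreover have "g ((-1) *\<^sub>C y) = cmod (-1) * g y" using assms unfolding seminorm_on_def by blast
  ultimately show ?thesis by (simp add: scaleC_minus_left)
qed

lemma seminorm_on_add_defect:
  assumes K: "csubspace K" and g: "seminorm_on K g" and a: "bounded_op_on K a"
  shows "seminorm_on K (\<lambda>x. g x + norm (a x - s *\<^sub>C x))"
  unfolding seminorm_on_def
proof (intro conjI ballI allI)
  fix x y assume x: "x \<in> K" and y: "y \<in> K"
  have "a (x + y) - s *\<^sub>C (x + y) = (a x - s *\<^sub>C x) + (a y - s *\<^sub>C y)"
    using x y by (simp add: bounded_op_on_add[OF a] scaleC_add_right)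
  then have "norm (a (x + y) - s *\<^sub>C (x + y)) \<le> norm (a x - s *\<^sub>C x) + norm (a y - s *\<^sub>C y)"
    using norm_triangle_ineq by metis
  moreover have "g (x + y) \<le> g x + g y" using g x y unfolding seminorm_on_def by blast
  ultimately show "g (x + y) + norm (a (x + y) - s *\<^sub>C (x + y))
      \<le> g x + norm (a x - s *\<^sub>C x) + (g y + norm (a y - s *\<^sub>C y))" by linarith
next
  fix c x assume x: "x \<in> K"
  have "a (c *\<^sub>C x) - s *\<^sub>C c *\<^sub>C x = c *\<^sub>C (a x - s *\<^sub>C x)"
    using x by (simp add: bounded_op_on_scaleC[OF a] scaleC_diff_right scaleC_scaleC mult.commute)
  moreover have "g (c *\<^sub>C x) = cmod c * g x" using g x unfolding seminorm_on_def by blast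
  ultimately show "g (c *\<^sub>C x) + norm (a (c *\<^sub>C x) - s *\<^sub>C c *\<^sub>C x) = cmod c * (g x + norm (a x - s *\<^sub>C x))"
    by (simp add: norm_scaleC distrib_left)
qed

lemma bounded_wrt_add_defect:
  assumes K: "csubspace K" and g: "seminorm_on K g" and a: "bounded_op_on K a"
    and T: "bounded_op_on K T" and gT: "bounded_wrt K g T"
    and com: "\<And>x. x \<in> K \<Longrightarrow> T (a x) = a (T x)"
  shows "bounded_wrt K (\<lambda>x. g x + norm (a x - s *\<^sub>C x)) T"
proof -
  obtain B where B: "B > 0" "\<And>x. x \<in> K \<Longrightarrow> norm (T x) \<le> B * norm x"
    using bounded_op_on_bound[OF T] by blast
  obtain C where C: "C \<ge> 0" "\<And>x. x \<in> K \<Longrightarrow> g (T x) \<le> C * g x" using gT by (auto simp: bounded_wrt_def)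
  have "g (T x) + norm (a (T x) - s *\<^sub>C T x) \<le> (B + C) * (g x + norm (a x - s *\<^sub>C x))" if x: "x \<in> K" for x
  proof -
    have sx: "s *\<^sub>C x \<in> K" "a x \<in> K" using x csubspace_scaleC[OF K] bounded_op_on_in[OF a] by auto
    then have d: "a x - s *\<^sub>C x \<in> K" using csubspace_diff[OF K] by blast
    have "T (a x - s *\<^sub>C x) + T (s *\<^sub>C x) = T (a x)" using bounded_op_on_add[OF T d sx(1)] by simp
    then have "a (T x) - s *\<^sub>C T x = T (a x - s *\<^sub>C x)"
      using x by (simp add: com bounded_op_on_scaleC[OF T] algebra_simps)
    then have "norm (a (T x) - s *\<^sub>C T x) \<le> B * norm (a x - s *\<^sub>C x)" using B(2)[OF d] by simp
    moreover have "g (T x) \<le> C * g x" using C(2)[OF x] .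
    moreover have "0 \<le> B * g x" "0 \<le> C * norm (a x - s *\<^sub>C x)"
      using B C seminorm_on_nonneg[OF K g x] by auto
    ultimately show ?thesis by (simp add: algebra_simps)
  qed
  then show ?thesis using B C unfolding bounded_wrt_def by (intro exI[of _ "B + C"]) auto
qed

text \<open>Let \<open>s\<close> be the largest asymptotic value of \<open>\<langle>ax,x\<rangle>\<close> along unit vectors with \<open>g x \<rightarrow> 0\<close>. Along
  such vectors the form of \<open>s - a\<close> is asymptotically nonnegative. If \<open>x\<close> nearly attains \<open>s\<close>, so that
  this form nearly vanishes at \<open>x\<close>, then testing it on \<open>x - t(s - a)x\<close> forces \<open>(s - a)x\<close> to be small.\<close>

lemma approximate_eigenvalue_selfadjoint:
  fixes K :: "'a::complex_inner set"
  assumes K: "csubspace K" and a: "adjoint_pair K a a"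
    and g: "seminorm_on K g" and ga: "bounded_wrt K g a"
    and ex: "\<And>d. d > 0 \<Longrightarrow> \<exists>x\<in>K. norm x = 1 \<and> g x \<le> d \<and> c \<le> inner (a x) x"
  shows "\<exists>s\<ge>c. \<forall>d>0. \<exists>x\<in>K. norm x = 1 \<and> g x \<le> d \<and> norm (a x - complex_of_real s *\<^sub>C x) \<le> d"
proof -
  have ba: "bounded_op_on K a" using a by (simp add: adjoint_pair_def)
  obtain B where B: "B > 0" "\<And>x. x \<in> K \<Longrightarrow> norm (a x) \<le> B * norm x"
    using bounded_op_on_bound[OF ba] by blast
  obtain G where G: "G \<ge> 0" "\<And>x. x \<in> K \<Longrightarrow> g (a x) \<le> G * g x" using ga by (auto simp: bounded_wrt_def)
  define attained where "attained d s \<longleftrightarrow> (\<exists>x\<in>K. norm x = 1 \<and> g x \<le> d \<and> s \<le> inner (a x) x)" for d s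
  define L where "L = {s. \<forall>d>0. attained d s}"
  have cL: "c \<in> L" using ex by (simp add: L_def attained_def)
  have "s \<le> B" if "s \<in> L" for s
  proof -
    obtain x where x: "x \<in> K" "norm x = 1" "s \<le> inner (a x) x"
      using \<open>s \<in> L\<close> zero_less_one unfolding L_def attained_def by blast
    have "inner (a x) x \<le> norm (a x) * norm x" by (rule norm_cauchy_schwarz)
    then show ?thesis using B(2)[OF x(1)] x by simp
  qed
  then have bdd: "bdd_above L" by (rule bdd_aboveI)
  define s where "s = Sup L"
  have cs: "c \<le> s" unfolding s_def by (rule cSup_upper[OF cL bdd])
  have below: "attained d (s - e)" if "d > 0" "e > 0" for d e
  proof -
    have "s - e < Sup L" using that by (simp add: s_def)
    then obtain r where r: "r \<in> L" "s - e < r" using less_cSupE cL by (metis empty_iff)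
    then have "attained d r" using that by (simp add: L_def)
    then show ?thesis using r unfolding attained_def by (meson less_le_trans less_imp_le order_trans)
  qed
  have above: "\<exists>d>0. \<not> attained d (s + e)" if "e > 0" for e
  proof (rule ccontr)
    assume "\<not> ?thesis"
    then have "s + e \<in> L" by (auto simp: L_def)
    then have "s + e \<le> s" unfolding s_def by (rule cSup_upper[OF _ bdd])
    then show False using that by simp
  qed
  have "\<exists>x\<in>K. norm x = 1 \<and> g x \<le> d \<and> norm (a x - complex_of_real s *\<^sub>C x) \<le> d" if d: "d > 0" for d
  proof -
    define C where "C = 2 * (\<bar>s\<bar> + B + G) + 1"
    define t where "t = 1 / C"
    have C: "C > 0" using B G by (simp add: C_def add_nonneg_pos)
    have t: "t > 0" "t * C = 1" using C by (auto simp: t_def)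
    define e where "e = t * d\<^sup>2 / 5"
    have e: "e > 0" using t d by (simp add: e_def)
    obtain d1 where d1: "d1 > 0" "\<not> attained d1 (s + e)" using above[OF e] by blast
    define d2 where "d2 = min d (d1 / 4)"
    have d2: "d2 > 0" "d2 \<le> d" "4 * d2 \<le> d1" using d d1 by (auto simp: d2_def)
    obtain x where x: "x \<in> K" "norm x = 1" "g x \<le> d2" "s - e \<le> inner (a x) x"
      using below[OF d2(1) e] by (auto simp: attained_def)
    define y where "y = complex_of_real s *\<^sub>C x - a x"
    have yK: "y \<in> K" unfolding y_def
      by (intro csubspace_diff[OF K] csubspace_scaleC[OF K] bounded_op_on_in[OF ba] x)
    define z where "z = x - complex_of_real t *\<^sub>C y"
    have tyK: "complex_of_real t *\<^sub>C y \<in> K" using csubspace_scaleC[OF K yK] .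
    have zK: "z \<in> K" unfolding z_def by (intro csubspace_diff[OF K] tyK x)
    have ny: "norm y \<le> \<bar>s\<bar> + B"
      using norm_triangle_ineq4[of "complex_of_real s *\<^sub>C x" "a x"] B(2)[OF x(1)] x(2)
      by (simp add: y_def norm_scaleC)
    have tny: "norm (complex_of_real t *\<^sub>C y) \<le> 1/2"
    proof -
      have "norm (complex_of_real t *\<^sub>C y) = t * norm y" using t by (simp add: norm_scaleC)
      also have "\<dots> \<le> t * (C / 2)"
        using ny G t(1) by (intro mult_left_mono) (auto simp: C_def)
      finally show ?thesis using t(2) by simp
    qed
    have nz: "1/2 \<le> norm z" "norm z \<le> 2"
      using norm_triangle_ineq2[of x "complex_of_real t *\<^sub>C y"]
        norm_triangle_ineq4[of x "complex_of_real t *\<^sub>C y"] tny x(2) by (auto simp: z_def)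
    have gsc: "g (c *\<^sub>C w) = cmod c * g w" if "w \<in> K" for c w
      using g that unfolding seminorm_on_def by blast
    have gx0: "0 \<le> g x" by (rule seminorm_on_nonneg[OF K g x(1)])
    have gy: "g y \<le> (\<bar>s\<bar> + G) * g x"
      using seminorm_on_diff[OF g K csubspace_scaleC[OF K x(1)] bounded_op_on_in[OF ba x(1)], of "complex_of_real s"]
        G(2)[OF x(1)] gsc[OF x(1), of "complex_of_real s"] by (simp add: y_def algebra_simps)
    have "g z \<le> 2 * d2"
    proof -
      have "g z \<le> g x + t * g y"
        using seminorm_on_diff[OF g K x(1) tyK] gsc[OF yK, of "complex_of_real t"] t by (simp add: z_def)
      also have "\<dots> \<le> g x + t * ((\<bar>s\<bar> + G) * g x)" using gy t by simp
      also have "\<dots> = g x + (t * (\<bar>s\<bar> + G)) * g x" by simp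
      also have "\<dots> \<le> g x + 1 * g x"
      proof -
        have "t * (\<bar>s\<bar> + G) \<le> t * C" using t B G by (intro mult_left_mono) (auto simp: C_def)
        then show ?thesis using gx0 t(2) by (intro add_left_mono mult_right_mono) auto
      qed
      finally show ?thesis using x(3) by simp
    qed
    then have gz: "g z \<le> d1 * norm z"
    proof -
      have "2 * d2 \<le> d1 * (1/2)" using d2 by simp
      also have "\<dots> \<le> d1 * norm z" using nz d1(1) by (intro mult_left_mono) auto
      finally show ?thesis using \<open>g z \<le> 2 * d2\<close> by simp
    qed
    define u where "u = complex_of_real (1 / norm z) *\<^sub>C z"
    have uK: "u \<in> K" unfolding u_def by (rule csubspace_scaleC[OF K zK])
    have zpos: "norm z > 0" using nz by linarith
    have nu: "norm u = 1" unfolding u_def norm_scaleC norm_of_real using zpos by simp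
    have gu: "g u \<le> d1"
      unfolding u_def gsc[OF zK] norm_of_real using gz zpos by (simp add: divide_le_eq)
    then have "inner (a u) u < s + e" using d1(2) uK nu unfolding attained_def by force
    moreover have "a u = (1 / norm z) *\<^sub>R a z" "u = (1 / norm z) *\<^sub>R z"
      unfolding u_def bounded_op_on_scaleC[OF ba zK] scaleR_scaleC by (rule refl)+
    then have "inner (a u) u = inner (a z) z / (norm z)\<^sup>2"
      by (simp add: power2_eq_square)
    ultimately have "inner (a z) z < (s + e) * (norm z)\<^sup>2" using zpos by (simp add: divide_less_eq)
    then have form: "inner (s *\<^sub>R z - a z) z \<ge> - e * (norm z)\<^sup>2"
      by (simp add: inner_diff_left power2_norm_eq_inner algebra_simps)
    have asym: "inner (a p) q = inner p (a q)" if "p \<in> K" "q \<in> K" for p q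
      unfolding Re_cinner[symmetric] using adjoint_pairD(1)[OF a that] by simp
    have az: "a z = a x - t *\<^sub>R a y"
    proof -
      have "a x = a (z + complex_of_real t *\<^sub>C y)" by (simp add: z_def)
      also have "\<dots> = a z + complex_of_real t *\<^sub>C a y"
        using bounded_op_on_add[OF ba zK tyK] bounded_op_on_scaleC[OF ba yK] by simp
      finally show ?thesis by (simp add: scaleR_scaleC)
    qed
    have zR: "z = x - t *\<^sub>R y" and yR: "y = s *\<^sub>R x - a x" by (simp_all add: z_def y_def scaleR_scaleC)
    define w where "w = s *\<^sub>R y - a y"
    have yx: "inner w x = inner y y"
      unfolding w_def using asym[OF yK x(1)] by (subst (4) yR) (simp add: inner_diff_left inner_diff_right)
    have "s *\<^sub>R z - a z = (s *\<^sub>R x - a x) - t *\<^sub>R w"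
      unfolding az w_def by (simp add: zR algebra_simps)
    then have "inner (s *\<^sub>R z - a z) z = inner (y - t *\<^sub>R w) (x - t *\<^sub>R y)"
      by (simp add: zR yR[symmetric])
    also have "\<dots> = inner y x - t * inner y y - t * inner w x + t\<^sup>2 * inner w y"
      by (simp add: inner_diff_left inner_diff_right power2_eq_square algebra_simps)
    finally have "inner (s *\<^sub>R z - a z) z = inner y x - 2 * t * inner y y + t\<^sup>2 * inner (s *\<^sub>R y - a y) y"
      unfolding yx by (simp add: w_def)
    moreover have "inner y x \<le> e"
    proof -
      have "inner x x = 1" using x(2) by (simp add: power2_norm_eq_inner[symmetric])
      then show ?thesis using x(4) by (simp add: yR inner_diff_left)
    qed
    moreover have "t\<^sup>2 * inner (s *\<^sub>R y - a y) y \<le> t * inner y y"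
    proof -
      have "inner (s *\<^sub>R y - a y) y \<le> norm (s *\<^sub>R y - a y) * norm y" by (rule norm_cauchy_schwarz)
      also have "\<dots> \<le> (\<bar>s\<bar> * norm y + B * norm y) * norm y"
        using norm_triangle_ineq4[of "s *\<^sub>R y" "a y"] B(2)[OF yK] by (intro mult_right_mono) auto
      also have "\<dots> = (\<bar>s\<bar> + B) * inner y y"
        by (simp add: power2_norm_eq_inner[symmetric] power2_eq_square algebra_simps)
      also have "\<dots> \<le> C * inner y y" using B(1) G by (intro mult_right_mono) (auto simp: C_def)
      finally have "t\<^sup>2 * inner (s *\<^sub>R y - a y) y \<le> t\<^sup>2 * (C * inner y y)" by (intro mult_left_mono) auto
      also have "\<dots> = t * (t * C) * inner y y" by (simp add: power2_eq_square)
      finally show ?thesis using t(2) by simp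
    qed
    moreover have "- e * (norm z)\<^sup>2 \<ge> - e * 4"
    proof -
      have "(norm z)\<^sup>2 \<le> 2\<^sup>2" using nz by (intro power_mono) auto
      then show ?thesis using e by simp
    qed
    ultimately have "t * inner y y \<le> 5 * e" using form by linarith
    then have "inner y y \<le> d\<^sup>2" using t(1) by (simp add: e_def)
    then have "(norm y)\<^sup>2 \<le> d\<^sup>2" by (simp add: power2_norm_eq_inner)
    then have "norm y \<le> d" by (rule power2_le_imp_le) (use d in simp)
    then have "norm (a x - complex_of_real s *\<^sub>C x) \<le> d" by (simp add: y_def norm_minus_commute)
    moreover have "g x \<le> d" using x(3) d2(2) by simp
    ultimately show ?thesis using x(1,2) by blast
  qed
  then show ?thesis using cs by blast
qed

text \<open>The real and the imaginary part of \<open>T\<close> are treated in turn.\<close>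

lemma approximate_eigenvalue_normal:
  fixes K :: "'a::complex_inner set"
  assumes K: "csubspace K" and T: "adjoint_pair K T T'" and n: "\<And>x. x \<in> K \<Longrightarrow> T (T' x) = T' (T x)"
    and g: "seminorm_on K g" and gT: "bounded_wrt K g T" "bounded_wrt K g T'"
    and ex: "\<And>d. d > 0 \<Longrightarrow> \<exists>x\<in>K. norm x = 1 \<and> g x \<le> d"
  shows "\<exists>l. \<forall>d>0. \<exists>x\<in>K. norm x = 1 \<and> g x \<le> d \<and> norm (T x - l *\<^sub>C x) \<le> d"
proof -
  have bT: "bounded_op_on K T" "bounded_op_on K T'" using T by (auto simp: adjoint_pair_def)
  note mem = bT[THEN bounded_op_on_in]
  have bw: "bounded_wrt K g (\<lambda>x. c *\<^sub>C T x + d *\<^sub>C T' x)" for c d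
  proof -
    obtain B C where B: "B \<ge> 0" "\<And>x. x \<in> K \<Longrightarrow> g (T x) \<le> B * g x"
      and C: "C \<ge> 0" "\<And>x. x \<in> K \<Longrightarrow> g (T' x) \<le> C * g x"
      using gT unfolding bounded_wrt_def by blast
    have "g (c *\<^sub>C T x + d *\<^sub>C T' x) \<le> (cmod c * B + cmod d * C) * g x" if x: "x \<in> K" for x
    proof -
      have "g (c *\<^sub>C T x + d *\<^sub>C T' x) \<le> g (c *\<^sub>C T x) + g (d *\<^sub>C T' x)"
        using g csubspace_scaleC[OF K mem(1)[OF x]] csubspace_scaleC[OF K mem(2)[OF x]]
        unfolding seminorm_on_def by blast
      also have "\<dots> = cmod c * g (T x) + cmod d * g (T' x)"
        using g mem(1)[OF x] mem(2)[OF x] unfolding seminorm_on_def by simp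
      also have "\<dots> \<le> cmod c * (B * g x) + cmod d * (C * g x)"
        using B(2)[OF x] C(2)[OF x] by (intro add_mono mult_left_mono) auto
      finally show ?thesis by (simp add: algebra_simps)
    qed
    then show ?thesis unfolding bounded_wrt_def using B C
      by (intro exI[of _ "cmod c * B + cmod d * C"]) auto
  qed
  define a where "a x = (1/2) *\<^sub>C T x + (1/2) *\<^sub>C T' x" for x
  define b where "b x = (- \<i>/2) *\<^sub>C T x + (\<i>/2) *\<^sub>C T' x" for x
  have ba: "bounded_op_on K a" unfolding a_def by (rule bounded_op_on_lincomb[OF K bT])
  have bb: "bounded_op_on K b" unfolding b_def by (rule bounded_op_on_lincomb[OF K bT])
  have a: "adjoint_pair K a a"
    unfolding adjoint_pair_def using ba
    by (auto simp: a_def cinner_add_left cinner_add_right cinner_scaleC_left cinner_scaleC_right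
        adjoint_pairD[OF T])
  have b: "adjoint_pair K b b"
    unfolding adjoint_pair_def using bb
    by (auto simp: b_def cinner_add_left cinner_add_right cinner_scaleC_left cinner_scaleC_right
        adjoint_pairD[OF T])
  have com: "b (a x) = a (b x)" if x: "x \<in> K" for x
    using x by (simp add: a_def b_def bounded_op_on_add[OF bT(1)] bounded_op_on_add[OF bT(2)]
        bounded_op_on_scaleC[OF bT(1)] bounded_op_on_scaleC[OF bT(2)] mem csubspace_scaleC[OF K]
        scaleC_add_right scaleC_scaleC n)
  have ga: "bounded_wrt K g a" and gb: "bounded_wrt K g b"
    unfolding a_def b_def by (rule bw)+
  define c where "c = - (SOME B. \<forall>x\<in>K. norm (a x) \<le> B * norm x)"
  have "\<exists>B. \<forall>x\<in>K. norm (a x) \<le> B * norm x" using ba by (simp add: bounded_op_on_def)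
  then have "\<forall>x\<in>K. norm (a x) \<le> - c * norm x" unfolding c_def minus_minus by (rule someI_ex)
  then have c: "c \<le> inner (a x) x" if "x \<in> K" "norm x = 1" for x
    using Cauchy_Schwarz_ineq2[of "a x" x] that by force
  obtain s where s: "\<And>d. d > 0 \<Longrightarrow> \<exists>x\<in>K. norm x = 1 \<and> g x \<le> d \<and> norm (a x - complex_of_real s *\<^sub>C x) \<le> d"
    using approximate_eigenvalue_selfadjoint[OF K a g ga, of c] ex c by blast
  define g1 where "g1 x = g x + norm (a x - complex_of_real s *\<^sub>C x)" for x
  have g1: "seminorm_on K g1" unfolding g1_def by (rule seminorm_on_add_defect[OF K g ba])
  have g1b: "bounded_wrt K g1 b" unfolding g1_def by (rule bounded_wrt_add_defect[OF K g ba bb gb com])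
  obtain c' where c': "\<forall>x\<in>K. norm (b x) \<le> - c' * norm x"
    using bb unfolding bounded_op_on_def by (metis minus_minus)
  then have c': "c' \<le> inner (b x) x" if "x \<in> K" "norm x = 1" for x
    using Cauchy_Schwarz_ineq2[of "b x" x] that by force
  have "\<exists>x\<in>K. norm x = 1 \<and> g1 x \<le> d \<and> c' \<le> inner (b x) x" if "d > 0" for d
    using s[of "d / 2"] that c' unfolding g1_def by force
  then obtain r where r: "\<And>d. d > 0 \<Longrightarrow> \<exists>x\<in>K. norm x = 1 \<and> g1 x \<le> d \<and> norm (b x - complex_of_real r *\<^sub>C x) \<le> d"
    using approximate_eigenvalue_selfadjoint[OF K b g1 g1b, of c'] by blast
  have "\<exists>x\<in>K. norm x = 1 \<and> g x \<le> d \<and> norm (T x - Complex s r *\<^sub>C x) \<le> d" if d: "d > 0" for d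
  proof -
    obtain x where x: "x \<in> K" "norm x = 1" "g1 x \<le> d / 2" "norm (b x - complex_of_real r *\<^sub>C x) \<le> d / 2"
      using r[of "d / 2"] d by auto
    have "T x - Complex s r *\<^sub>C x = (a x - complex_of_real s *\<^sub>C x) + \<i> *\<^sub>C (b x - complex_of_real r *\<^sub>C x)"
    proof -
      have "a x + \<i> *\<^sub>C b x = (1/2 + 1/2) *\<^sub>C T x"
        by (simp only: a_def b_def scaleC_add_right scaleC_scaleC scaleC_add_left) (simp add: scaleC_minus_left)
      then have "T x = a x + \<i> *\<^sub>C b x" by simp
      then show ?thesis
        by (simp add: Complex_eq scaleC_add_left scaleC_diff_right scaleC_scaleC)
    qed
    then have "norm (T x - Complex s r *\<^sub>C x)
        \<le> norm (a x - complex_of_real s *\<^sub>C x) + norm (\<i> *\<^sub>C (b x - complex_of_real r *\<^sub>C x))"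
      by (metis norm_triangle_ineq)
    then have "norm (T x - Complex s r *\<^sub>C x)
        \<le> norm (a x - complex_of_real s *\<^sub>C x) + norm (b x - complex_of_real r *\<^sub>C x)"
      by (simp add: norm_scaleC)
    moreover have "0 \<le> g x" by (rule seminorm_on_nonneg[OF K g x(1)])
    moreover have "g x \<le> d"
      using x(3) norm_ge_zero[of "a x - complex_of_real s *\<^sub>C x"] d unfolding g1_def by linarith
    ultimately show ?thesis using x d unfolding g1_def by (intro bexI[of _ x]) auto
  qed
  then show ?thesis by blast
qed


locale commuting_normal_pair =
  fixes K :: "'a::complex_inner set" and S S' P P' :: "'a \<Rightarrow> 'a"
  assumes K: "csubspace K"
    and S: "adjoint_pair K S S'" and P: "adjoint_pair K P P'"
    and SS': "x \<in> K \<Longrightarrow> S (S' x) = S' (S x)" and PP': "x \<in> K \<Longrightarrow> P (P' x) = P' (P x)"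
    and SP: "x \<in> K \<Longrightarrow> S (P x) = P (S x)" and SP': "x \<in> K \<Longrightarrow> S (P' x) = P' (S x)"
begin

lemma bounded_ops: "bounded_op_on K S" "bounded_op_on K S'" "bounded_op_on K P" "bounded_op_on K P'"
  using S P by (auto simp: adjoint_pair_def)

lemmas mem = bounded_ops[THEN bounded_op_on_in]
  and add = bounded_ops[THEN bounded_op_on_add]
  and scale = bounded_ops[THEN bounded_op_on_scaleC]
  and diff = bounded_ops[THEN bounded_op_on_diff[OF K]]

lemma S'P: "x \<in> K \<Longrightarrow> S' (P x) = P (S' x)"
proof (rule cinner_eqI[OF K])
  fix k assume x: "x \<in> K" and k: "k \<in> K"
  have "cinner k (S' (P x)) = cinner (P' (S k)) x"
    using adjoint_pairD(1)[OF S k mem(3)[OF x]] adjoint_pairD(2)[OF P mem(1)[OF k] x] by simp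
  also have "\<dots> = cinner (S (P' k)) x" by (simp add: SP'[OF k])
  also have "\<dots> = cinner k (P (S' x))"
    using adjoint_pairD(1)[OF S mem(4)[OF k] x] adjoint_pairD(2)[OF P k mem(2)[OF x]] by simp
  finally show "cinner k (S' (P x)) = cinner k (P (S' x))" .
qed (simp_all add: mem)

lemma S'P': "x \<in> K \<Longrightarrow> S' (P' x) = P' (S' x)"
proof (rule cinner_eqI[OF K])
  fix k assume x: "x \<in> K" and k: "k \<in> K"
  have "cinner k (S' (P' x)) = cinner (P (S k)) x"
    using adjoint_pairD(1)[OF S k mem(4)[OF x]] adjoint_pairD(1)[OF P mem(1)[OF k] x] by simp
  also have "\<dots> = cinner (S (P k)) x" by (simp add: SP[OF k])
  also have "\<dots> = cinner k (P' (S' x))"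
    using adjoint_pairD(1)[OF S mem(3)[OF k] x] adjoint_pairD(1)[OF P k mem(2)[OF x]] by simp
  finally show "cinner k (S' (P' x)) = cinner k (P' (S' x))" .
qed (simp_all add: mem)

definition approximate_joint_eigenvalue :: "complex \<Rightarrow> complex \<Rightarrow> bool" where
  "approximate_joint_eigenvalue l m \<longleftrightarrow>
     (\<forall>d>0. \<exists>x\<in>K. norm x = 1 \<and> norm (S x - l *\<^sub>C x) \<le> d \<and> norm (P x - m *\<^sub>C x) \<le> d)"

text \<open>The operators \<open>R\<close>, \<open>P\<close>, \<open>S\<close> are treated in this order. Starting with \<open>R\<close> and the trivial seminorm
  makes the eigenvalue \<open>s\<close> of \<open>R\<close> at least as large as any prescribed value \<open>\<langle>Rx\<^sub>0,x\<^sub>0\<rangle>\<close> of its form.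
  For \<open>R = N\<^sup>*N\<close> this turns a bound for \<open>N\<close> at the joint approximate eigenvalues \<open>(l, m)\<close> into a bound for
  \<open>\<parallel>Nx\<^sub>0\<parallel>\<^sup>2 \<le> s\<close>.\<close>

lemma joint_approximate_eigenvector:
  assumes R: "adjoint_pair K R R"
    and com: "\<And>x. x \<in> K \<Longrightarrow> S (R x) = R (S x)" "\<And>x. x \<in> K \<Longrightarrow> S' (R x) = R (S' x)"
      "\<And>x. x \<in> K \<Longrightarrow> P (R x) = R (P x)" "\<And>x. x \<in> K \<Longrightarrow> P' (R x) = R (P' x)"
    and x0: "x0 \<in> K" "norm x0 = 1"
  shows "\<exists>s l m. inner (R x0) x0 \<le> s \<and>
    (\<forall>d>0. \<exists>x\<in>K. norm x = 1 \<and> norm (R x - complex_of_real s *\<^sub>C x) \<le> d \<and>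
       norm (S x - l *\<^sub>C x) \<le> d \<and> norm (P x - m *\<^sub>C x) \<le> d)"
proof -
  have bR: "bounded_op_on K R" using R by (simp add: adjoint_pair_def)
  define g where "g x = (0::real)" for x :: 'a
  have g: "seminorm_on K g" and gT: "bounded_wrt K g T" for T
    unfolding g_def by (rule seminorm_on_zero, rule bounded_wrt_zero)
  obtain s where s: "inner (R x0) x0 \<le> s"
    "\<And>d. d > 0 \<Longrightarrow> \<exists>x\<in>K. norm x = 1 \<and> g x \<le> d \<and> norm (R x - complex_of_real s *\<^sub>C x) \<le> d"
  proof -
    have "\<exists>x\<in>K. norm x = 1 \<and> g x \<le> d \<and> inner (R x0) x0 \<le> inner (R x) x" if "d > 0" for d
      using x0 that by (intro bexI[of _ x0]) (auto simp: g_def)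
    then show ?thesis using approximate_eigenvalue_selfadjoint[OF K R g gT] that by blast
  qed
  define g1 where "g1 x = g x + norm (R x - complex_of_real s *\<^sub>C x)" for x
  have g1: "seminorm_on K g1" unfolding g1_def by (rule seminorm_on_add_defect[OF K g bR])
  have g1T: "bounded_wrt K g1 S" "bounded_wrt K g1 S'" "bounded_wrt K g1 P" "bounded_wrt K g1 P'"
    unfolding g1_def
    by (rule bounded_wrt_add_defect[OF K g bR _ gT], rule bounded_ops, rule com, assumption)+
  have "\<exists>x\<in>K. norm x = 1 \<and> g1 x \<le> d" if "d > 0" for d
    using s(2)[OF that] by (auto simp: g1_def g_def)
  then obtain m where m: "\<And>d. d > 0 \<Longrightarrow> \<exists>x\<in>K. norm x = 1 \<and> g1 x \<le> d \<and> norm (P x - m *\<^sub>C x) \<le> d"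
    using approximate_eigenvalue_normal[OF K P PP' g1 g1T(3,4)] by blast
  define g2 where "g2 x = g1 x + norm (P x - m *\<^sub>C x)" for x
  have g2: "seminorm_on K g2" unfolding g2_def by (rule seminorm_on_add_defect[OF K g1 bounded_ops(3)])
  have g2T: "bounded_wrt K g2 S" "bounded_wrt K g2 S'"
    unfolding g2_def
    by (rule bounded_wrt_add_defect[OF K g1 bounded_ops(3,1) g1T(1) SP], assumption)
      (rule bounded_wrt_add_defect[OF K g1 bounded_ops(3,2) g1T(2) S'P], assumption)
  have g1_nonneg: "0 \<le> g1 x" if "x \<in> K" for x by (rule seminorm_on_nonneg[OF K g1 that])
  have "\<exists>x\<in>K. norm x = 1 \<and> g2 x \<le> d" if "d > 0" for d
    using m[of "d / 2"] that unfolding g2_def by force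
  then obtain l where l: "\<And>d. d > 0 \<Longrightarrow> \<exists>x\<in>K. norm x = 1 \<and> g2 x \<le> d \<and> norm (S x - l *\<^sub>C x) \<le> d"
    using approximate_eigenvalue_normal[OF K S SS' g2 g2T] by blast
  have "\<exists>x\<in>K. norm x = 1 \<and> norm (R x - complex_of_real s *\<^sub>C x) \<le> d \<and>
       norm (S x - l *\<^sub>C x) \<le> d \<and> norm (P x - m *\<^sub>C x) \<le> d" if d: "d > 0" for d
  proof -
    obtain x where x: "x \<in> K" "norm x = 1" "g2 x \<le> d" "norm (S x - l *\<^sub>C x) \<le> d" using l[OF d] by blast
    have "norm (R x - complex_of_real s *\<^sub>C x) \<le> d" "norm (P x - m *\<^sub>C x) \<le> d"
      using x(3) g1_nonneg[OF x(1)] norm_ge_zero[of "R x - complex_of_real s *\<^sub>C x"]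
        norm_ge_zero[of "P x - m *\<^sub>C x"]
      unfolding g2_def g1_def g_def by linarith+
    then show ?thesis using x by blast
  qed
  then show ?thesis using s(1) by blast
qed

end

lemma le_square_if_le_perturbed:
  fixes s c k :: real
  assumes "\<And>d. d > 0 \<Longrightarrow> s \<le> (c + k * d)\<^sup>2 + d"
  shows "s \<le> c\<^sup>2"
proof -
  have "((\<lambda>d. (c + k * d)\<^sup>2 + d) \<longlongrightarrow> (c + k * 0)\<^sup>2 + 0) (at_right 0)"
    by (intro tendsto_intros)
  moreover have "\<forall>\<^sub>F d in at_right 0. s \<le> (c + k * d)\<^sup>2 + d"
    using assms by (auto simp: eventually_at_right_field intro: exI[of _ 1])
  ultimately have "s \<le> (c + k * 0)\<^sup>2 + 0" by (intro tendsto_lowerbound) auto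
  then show ?thesis by simp
qed

lemma adjoint_pair_square:
  assumes T: "adjoint_pair K T T'"
  shows "adjoint_pair K (\<lambda>x. T' (T x)) (\<lambda>x. T' (T x))"
proof -
  have b: "bounded_op_on K T" "bounded_op_on K T'" using T by (auto simp: adjoint_pair_def)
  have "cinner (T' (T x)) y = cinner x (T' (T y))" if "x \<in> K" "y \<in> K" for x y
    using adjoint_pairD(2)[OF T bounded_op_on_in[OF b(1) that(1)] that(2)]
      adjoint_pairD(1)[OF T that(1) bounded_op_on_in[OF b(1) that(2)]] by simp
  then show ?thesis using bounded_op_on_compose[OF b(2,1)] by (simp add: adjoint_pair_def)
qed

lemma approximate_eigenvalue_square_le:
  assumes T: "adjoint_pair K T T'" and x: "x \<in> K" "norm x = 1"
    and s: "norm (T' (T x) - complex_of_real s *\<^sub>C x) \<le> d"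
  shows "s \<le> (norm (T x))\<^sup>2 + d"
proof -
  have b: "bounded_op_on K T" using T by (auto simp: adjoint_pair_def)
  have "cinner (T' (T x)) x = cinner (T x) (T x)"
    by (rule adjoint_pairD(2)[OF T bounded_op_on_in[OF b x(1)] x(1)])
  then have "inner (T' (T x)) x = (norm (T x))\<^sup>2"
    by (simp add: Re_cinner[symmetric] cinner_self)
  moreover have "inner x x = 1" using x by (simp add: power2_norm_eq_inner[symmetric])
  ultimately have "(norm (T x))\<^sup>2 - s = inner (T' (T x) - complex_of_real s *\<^sub>C x) x"
    by (simp add: inner_diff_left scaleR_scaleC[symmetric])
  then have "\<bar>(norm (T x))\<^sup>2 - s\<bar> \<le> norm (T' (T x) - complex_of_real s *\<^sub>C x) * norm x"
    by (metis Cauchy_Schwarz_ineq2)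
  then show ?thesis using s x by simp
qed

context commuting_normal_pair
begin

text \<open>With \<open>R = S\<^sup>*S\<close> the eigenvalue \<open>s \<ge> \<parallel>Sx\<^sub>0\<parallel>\<^sup>2\<close> is the square of the modulus of the eigenvalue of \<open>S\<close>.\<close>

lemma norm_le_if_joint_spectrum_le:
  assumes b: "\<And>l m. approximate_joint_eigenvalue l m \<Longrightarrow> cmod l \<le> b" and x: "x \<in> K"
  shows "norm (S x) \<le> b * norm x"
proof (cases "x = 0")
  case True
  then show ?thesis using scale(1)[OF x, of 0] by simp
next
  case False
  define x0 where "x0 = complex_of_real (1 / norm x) *\<^sub>C x"
  have x0: "x0 \<in> K" "norm x0 = 1"
    using False x csubspace_scaleC[OF K] by (auto simp: x0_def norm_scaleC norm_divide)
  have com: "S (S' (S y)) = S' (S (S y))" "S' (S' (S y)) = S' (S (S' y))"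
    "P (S' (S y)) = S' (S (P y))" "P' (S' (S y)) = S' (S (P' y))" if "y \<in> K" for y
    using that by (simp_all add: SS' SP SP'[symmetric] S'P S'P'[symmetric] mem)
  obtain s l m where s: "inner (S' (S x0)) x0 \<le> s"
    and d: "\<And>d. d > 0 \<Longrightarrow> \<exists>x\<in>K. norm x = 1 \<and> norm (S' (S x) - complex_of_real s *\<^sub>C x) \<le> d \<and>
       norm (S x - l *\<^sub>C x) \<le> d \<and> norm (P x - m *\<^sub>C x) \<le> d"
    using joint_approximate_eigenvector[OF adjoint_pair_square[OF S] com x0] by blast
  have "approximate_joint_eigenvalue l m" unfolding approximate_joint_eigenvalue_def using d by blast
  then have lb: "cmod l \<le> b" by (rule b)
  have "s \<le> b\<^sup>2"
  proof (rule le_square_if_le_perturbed[where k = 1])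
    fix d :: real assume "d > 0"
    then obtain y where y: "y \<in> K" "norm y = 1" "norm (S' (S y) - complex_of_real s *\<^sub>C y) \<le> d"
      "norm (S y - l *\<^sub>C y) \<le> d" using d by blast
    have "norm (S y) \<le> norm (S y - l *\<^sub>C y) + norm (l *\<^sub>C y)"
      using norm_triangle_ineq[of "S y - l *\<^sub>C y" "l *\<^sub>C y"] by simp
    then have "norm (S y) \<le> b + 1 * d" using y lb by (simp add: norm_scaleC)
    then have "(norm (S y))\<^sup>2 \<le> (b + 1 * d)\<^sup>2" by (intro power_mono) auto
    then show "s \<le> (b + 1 * d)\<^sup>2 + d" using approximate_eigenvalue_square_le[OF S y(1-3)] by linarith
  qed
  moreover have "inner (S' (S x0)) x0 = (norm (S x0))\<^sup>2"
    using adjoint_pairD(2)[OF S mem(1)[OF x0(1)] x0(1)] by (simp add: Re_cinner[symmetric] cinner_self)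
  ultimately have "(norm (S x0))\<^sup>2 \<le> b\<^sup>2" using s by simp
  moreover have "b \<ge> 0" using lb norm_ge_zero order_trans by blast
  ultimately have "norm (S x0) \<le> b" by (rule power2_le_imp_le)
  moreover have "norm (S x0) = norm (S x) / norm x"
    unfolding x0_def scale(1)[OF x] norm_scaleC norm_of_real by simp
  ultimately show ?thesis using False by (simp add: divide_le_eq)
qed

text \<open>\<open>N = S - S\<^sup>*P\<close> belongs to the commutative algebra generated by the operators, and its
  value \<open>l - cnj l * m\<close> at a joint approximate eigenvalue is zero by hypothesis.\<close>

lemma eq_adjoint_mult_if_joint_spectrum:
  assumes eq: "\<And>l m. approximate_joint_eigenvalue l m \<Longrightarrow> l = cnj l * m" and x: "x \<in> K"
  shows "S x = S' (P x)"
proof (rule ccontr)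
  assume ne: "S x \<noteq> S' (P x)"
  define N where "N x = S x - S' (P x)" for x
  define N' where "N' x = S' x - P' (S x)" for x
  have bN: "bounded_op_on K N" "bounded_op_on K N'"
    using bounded_op_on_lincomb[OF K bounded_ops(1) bounded_op_on_compose[OF bounded_ops(2,3)], of 1 "-1"]
      bounded_op_on_lincomb[OF K bounded_ops(2) bounded_op_on_compose[OF bounded_ops(4,1)], of 1 "-1"]
    by (simp_all add: N_def[abs_def] N'_def[abs_def] scaleC_minus_left)
  have N: "adjoint_pair K N N'"
    unfolding adjoint_pair_def using bN
    by (simp add: N_def N'_def cinner_diff_left cinner_diff_right adjoint_pairD[OF S] adjoint_pairD[OF P] mem)
  have x0: "N x \<noteq> 0" "x \<noteq> 0" using ne bounded_op_on_scaleC[OF bN(1) x, of 0] by (auto simp: N_def)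
  define x0 where "x0 = complex_of_real (1 / norm x) *\<^sub>C x"
  have x0': "x0 \<in> K" "norm x0 = 1"
    using x0 x csubspace_scaleC[OF K] by (auto simp: x0_def norm_scaleC norm_divide)
  have Nx0: "N x0 \<noteq> 0"
  proof -
    have "norm (N x0) = norm (N x) / norm x"
      unfolding x0_def bounded_op_on_scaleC[OF bN(1) x] norm_scaleC norm_of_real by simp
    then show ?thesis using x0 by auto
  qed
  have NK: "N y \<in> K" "N' y \<in> K" if "y \<in> K" for y
    using bN[THEN bounded_op_on_in] that by auto
  have comN: "S (N y) = N (S y)" "S' (N y) = N (S' y)" "P (N y) = N (P y)" "P' (N y) = N (P' y)"
    if "y \<in> K" for y
    using that by (simp_all add: N_def diff mem SS' SP SP' S'P S'P' PP')
  have comN': "S (N' y) = N' (S y)" "S' (N' y) = N' (S' y)" "P (N' y) = N' (P y)" "P' (N' y) = N' (P' y)"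
    if "y \<in> K" for y
    using that by (simp_all add: N'_def diff mem SS' SP SP' S'P S'P' PP')
  have com: "S (N' (N y)) = N' (N (S y))" "S' (N' (N y)) = N' (N (S' y))"
    "P (N' (N y)) = N' (N (P y))" "P' (N' (N y)) = N' (N (P' y))" if "y \<in> K" for y
    using that by (simp_all add: NK comN comN')
  obtain s l m where s: "inner (N' (N x0)) x0 \<le> s"
    and d: "\<And>d. d > 0 \<Longrightarrow> \<exists>x\<in>K. norm x = 1 \<and> norm (N' (N x) - complex_of_real s *\<^sub>C x) \<le> d \<and>
       norm (S x - l *\<^sub>C x) \<le> d \<and> norm (P x - m *\<^sub>C x) \<le> d"
    using joint_approximate_eigenvector[OF adjoint_pair_square[OF N] com x0'] by blast
  have "approximate_joint_eigenvalue l m" unfolding approximate_joint_eigenvalue_def using d by blast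
  then have lm: "l = cnj l * m" by (rule eq)
  obtain B where B: "B > 0" "\<And>x. x \<in> K \<Longrightarrow> norm (S' x) \<le> B * norm x"
    using bounded_op_on_bound[OF bounded_ops(2)] by blast
  have "s \<le> 0\<^sup>2"
  proof (rule le_square_if_le_perturbed[where k = "1 + B + cmod m"])
    fix d :: real assume "d > 0"
    then obtain y where y: "y \<in> K" "norm y = 1" "norm (N' (N y) - complex_of_real s *\<^sub>C y) \<le> d"
      "norm (S y - l *\<^sub>C y) \<le> d" "norm (P y - m *\<^sub>C y) \<le> d" using d by blast
    have my: "m *\<^sub>C y \<in> K" using csubspace_scaleC[OF K y(1)] .
    have pK: "P y - m *\<^sub>C y \<in> K" using csubspace_diff[OF K mem(3)[OF y(1)] my] .
    have sh: "norm (S' y - cnj l *\<^sub>C y) = norm (S y - l *\<^sub>C y)"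
      by (rule norm_adjoint_eq[OF adjoint_pair_shift[OF K S] _ y(1)])
        (rule normal_shift[OF K S], rule SS')
    have "N y = (S y - l *\<^sub>C y) - S' (P y - m *\<^sub>C y) - m *\<^sub>C (S' y - cnj l *\<^sub>C y)"
      using lm by (simp add: N_def diff mem y my scale scaleC_diff_right scaleC_scaleC mult.commute)
    then have "norm (N y) \<le> norm ((S y - l *\<^sub>C y) - S' (P y - m *\<^sub>C y)) + norm (m *\<^sub>C (S' y - cnj l *\<^sub>C y))"
      by (metis norm_triangle_ineq4)
    also have "\<dots> \<le> norm (S y - l *\<^sub>C y) + norm (S' (P y - m *\<^sub>C y)) + cmod m * norm (S y - l *\<^sub>C y)"
      unfolding norm_scaleC sh by (intro add_right_mono norm_triangle_ineq4)
    also have "\<dots> \<le> d + B * d + cmod m * d"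
    proof (intro add_mono mult_left_mono y)
      show "norm (S' (P y - m *\<^sub>C y)) \<le> B * d"
        by (rule order_trans[OF B(2)[OF pK] mult_left_mono[OF y(5)]]) (use B(1) in simp)
    qed simp
    finally have "norm (N y) \<le> 0 + (1 + B + cmod m) * d" by (simp add: algebra_simps)
    then have "(norm (N y))\<^sup>2 \<le> (0 + (1 + B + cmod m) * d)\<^sup>2" by (intro power_mono) auto
    then show "s \<le> (0 + (1 + B + cmod m) * d)\<^sup>2 + d"
      using approximate_eigenvalue_square_le[OF N y(1-3)] by linarith
  qed
  moreover have "inner (N' (N x0)) x0 = (norm (N x0))\<^sup>2"
    using adjoint_pairD(2)[OF N NK(1)[OF x0'(1)] x0'(1)] by (simp add: Re_cinner[symmetric] cinner_self)
  moreover have "0 < (norm (N x0))\<^sup>2" using Nx0 by simp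
  ultimately show False using s by simp
qed

end


section \<open>Algebraic description of \<open>\<Gamma>\<close>-unitaries\<close>

lemma bGammaD:
  assumes "(l, m) \<in> bGamma"
  shows "l = cnj l * m" "cmod l \<le> 2"
proof -
  obtain z1 z2 where z: "l = z1 + z2" "m = z1 * z2" "cmod z1 = 1" "cmod z2 = 1"
    using assms by (auto simp: bGamma_def)
  have "cnj z1 * z1 = 1" "cnj z2 * z2 = 1"
    using z by (metis complex_norm_square mult.commute of_real_1 one_power2)+
  moreover have "cnj l * m = (cnj z1 * z1) * z2 + (cnj z2 * z2) * z1"
    by (simp add: z algebra_simps)
  ultimately show "l = cnj l * m" by (simp add: z)
  show "cmod l \<le> 2" using norm_triangle_ineq[of z1 z2] z by simp
qed

text \<open>With \<open>w\<^sup>2 = m\<close> the number \<open>a = l/w\<close> is real and \<open>\<bar>a\<bar> \<le> 2\<close>; the roots of \<open>z\<^sup>2 - lz + m\<close> are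
  \<open>w(a \<plusminus> i\<surd>(4 - a\<^sup>2))/2\<close>.\<close>

lemma bGammaI:
  assumes m: "cmod m = 1" and l: "l = cnj l * m" "cmod l \<le> 2"
  shows "(l, m) \<in> bGamma"
proof -
  define w where "w = csqrt m"
  have w: "w\<^sup>2 = m" "cmod w = 1" by (simp_all add: w_def m)
  have ww: "cnj w * w = 1" using w(2) by (metis complex_norm_square mult.commute of_real_1 one_power2)
  define a where "a = cnj w * l"
  have wa: "w * a = l" using ww by (simp add: a_def mult.assoc[symmetric] mult.commute[of w])
  have "cnj a = w * cnj l" by (simp add: a_def)
  also have "\<dots> = (cnj w * w) * (w * cnj l)" by (simp add: ww)
  also have "\<dots> = cnj w * (cnj l * w\<^sup>2)" by (simp add: power2_eq_square)
  also have "\<dots> = a" using l(1) by (simp add: w a_def)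
  finally have "a \<in> \<real>" by (simp add: Reals_cnj_iff)
  then obtain r where r: "a = complex_of_real r" by (auto elim: Reals_cases)
  have "cmod a = cmod l" using w by (simp add: a_def norm_mult)
  then have r2: "\<bar>r\<bar> \<le> 2" using l(2) by (simp add: r)
  then have r4: "r\<^sup>2 \<le> 4" using power_mono[OF r2, of 2] by simp
  define q where "q = sqrt (4 - r\<^sup>2) / 2"
  have q: "(r / 2)\<^sup>2 + q\<^sup>2 = 1" using r4 by (simp add: q_def power_divide flip: add_divide_distrib)
  define u where "u = Complex (r / 2) q"
  have u: "cmod u = 1" using q by (simp add: u_def cmod_def)
  have uu: "u * cnj u = 1" using u by (metis complex_norm_square of_real_1 one_power2)
  have "l = w * u + w * cnj u"
    using wa r by (simp add: u_def complex_eq_iff algebra_simps)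
  moreover have "m = (w * u) * (w * cnj u)"
  proof -
    have "(w * u) * (w * cnj u) = w\<^sup>2 * (u * cnj u)" by (simp add: power2_eq_square)
    then show ?thesis by (simp add: uu w)
  qed
  ultimately show ?thesis
    unfolding bGamma_def using w u by (intro CollectI exI[of _ "w * u"] exI[of _ "w * cnj u"]) (simp add: norm_mult)
qed

lemma
  fixes K :: "'a::chilbert_space set"
  assumes K: "csubspace K" and cl: "closed K" and P: "bounded_op_on K P"
    and iso: "\<And>x y. x \<in> K \<Longrightarrow> y \<in> K \<Longrightarrow> cinner (P x) (P y) = cinner x y"
  shows adj_on_isometry: "x \<in> K \<Longrightarrow> adj_on K P (P x) = x"
    and adj_on_unitary: "P ` K = K \<Longrightarrow> x \<in> K \<Longrightarrow> P (adj_on K P x) = x"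
proof -
  show *: "adj_on K P (P x) = x" if x: "x \<in> K" for x
    by (rule adj_on_eqI[OF K x]) (rule iso[OF _ x])
  show "P ` K = K \<Longrightarrow> x \<in> K \<Longrightarrow> P (adj_on K P x) = x" 
  proof -
    assume "P ` K = K" "x \<in> K"
    then obtain y where "y \<in> K" "x = P y" by blast
    then show ?thesis by (simp add: *)
  qed
qed

text \<open>For unitary \<open>P\<close>, \<open>P\<^sup>* = P\<^sup>-\<^sup>1\<close> commutes with whatever commutes with \<open>P\<close>.\<close>

lemma commuting_normal_pair_unitary:
  fixes K :: "'a::chilbert_space set"
  assumes K: "csubspace K" and cl: "closed K" and S: "bounded_op_on K S" and P: "bounded_op_on K P"
    and SP: "\<And>x. x \<in> K \<Longrightarrow> S (P x) = P (S x)"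
    and iso: "\<And>x y. x \<in> K \<Longrightarrow> y \<in> K \<Longrightarrow> cinner (P x) (P y) = cinner x y"
    and onto: "P ` K = K"
    and normal: "\<And>x. x \<in> K \<Longrightarrow> S (adj_on K S x) = adj_on K S (S x)"
  shows "commuting_normal_pair K S (adj_on K S) P (adj_on K P)"
proof -
  let ?P' = "adj_on K P"
  note SK = bounded_op_on_in[OF S] and P'K = adj_on_in[OF K cl P]
  have P'P: "?P' (P x) = x" and PP': "P (?P' x) = x" if "x \<in> K" for x
    using adj_on_isometry[OF K cl P] adj_on_unitary[OF K cl P] iso onto that by blast+
  have "S (?P' x) = ?P' (S x)" if x: "x \<in> K" for x
  proof -
    have "S (?P' x) = ?P' (P (S (?P' x)))" using P'P[OF SK[OF P'K]] by simp
    also have "\<dots> = ?P' (S (P (?P' x)))" using SP[OF P'K] by simp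
    finally show ?thesis using PP'[OF x] by simp
  qed
  then show ?thesis
    using K adjoint_pair_adj_on[OF K cl S] adjoint_pair_adj_on[OF K cl P] SP normal
    by unfold_locales (simp_all add: PP' P'P)
qed

text \<open>The relation \<open>S = S\<^sup>*P\<close> says \<open>S\<^sup>* = P\<^sup>*S\<close>, which commutes with \<open>S\<close>.\<close>

lemma commuting_normal_pair_of_unitary:
  fixes K :: "'a::chilbert_space set"
  assumes K: "csubspace K" and cl: "closed K" and S: "bounded_op_on K S" and P: "bounded_op_on K P"
    and SP: "\<And>x. x \<in> K \<Longrightarrow> S (P x) = P (S x)"
    and iso: "\<And>x y. x \<in> K \<Longrightarrow> y \<in> K \<Longrightarrow> cinner (P x) (P y) = cinner x y"
    and onto: "P ` K = K"
    and SSP: "\<And>x y. x \<in> K \<Longrightarrow> y \<in> K \<Longrightarrow> cinner (S x) y = cinner (P x) (S y)"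
  shows "commuting_normal_pair K S (adj_on K S) P (adj_on K P)"
proof (rule commuting_normal_pair_unitary[OF K cl S P SP iso onto])
  let ?P' = "adj_on K P"
  note SK = bounded_op_on_in[OF S] and P'K = adj_on_in[OF K cl P]
  have S': "adj_on K S x = ?P' (S x)" if x: "x \<in> K" for x
  proof (rule adj_on_eqI[OF K P'K])
    fix k assume k: "k \<in> K"
    then show "cinner (S k) x = cinner k (?P' (S x))"
      using SSP[OF k x] cinner_adj_on[OF K cl P k] by simp
  qed
  fix x assume x: "x \<in> K"
  have "S (?P' (S x)) = ?P' (P (S (?P' (S x))))"
    by (rule adj_on_isometry[OF K cl P, symmetric]) (rule iso SK P'K | assumption)+
  also have "\<dots> = ?P' (S (P (?P' (S x))))" by (simp add: SP[OF P'K])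
  also have "\<dots> = ?P' (S (S x))" using adj_on_unitary[OF K cl P _ onto SK[OF x]] iso by simp
  finally show "S (adj_on K S x) = adj_on K S (S x)" by (simp add: S' x SK)
qed

text \<open>A joint approximate eigenvalue violates the lower bound that Koszul exactness provides, hence
  lies in the joint spectrum and so in the distinguished boundary, where \<open>l = cnj l * m\<close> and \<open>\<bar>l\<bar> \<le> 2\<close>.\<close>

lemma gamma_unitary_onD:
  fixes K :: "'a::chilbert_space set"
  assumes G: "gamma_unitary_on K S P"
    and iso: "\<And>x y. x \<in> K \<Longrightarrow> y \<in> K \<Longrightarrow> cinner (P x) (P y) = cinner x y"
  shows "P ` K = K"
    and "\<And>x y. x \<in> K \<Longrightarrow> y \<in> K \<Longrightarrow> cinner (S x) y = cinner (P x) (S y)"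
    and "\<And>x. x \<in> K \<Longrightarrow> norm (S x) \<le> 2 * norm x"
proof -
  have K: "csubspace K" and cl: "closed K" and bS: "bounded_op_on K S" and bP: "bounded_op_on K P"
    and SP: "\<And>x. x \<in> K \<Longrightarrow> S (P x) = P (S x)"
    and nS: "\<And>x. x \<in> K \<Longrightarrow> S (adj_on K S x) = adj_on K S (S x)"
    and nP: "\<And>x. x \<in> K \<Longrightarrow> P (adj_on K P x) = adj_on K P (P x)"
    and spec: "joint_spectrum_on K S P \<subseteq> bGamma"
    using G by (auto simp: gamma_unitary_on_def normal_on_def)
  show onto: "P ` K = K"
  proof
    show "P ` K \<subseteq> K" using bounded_op_on_in[OF bP] by blast
    show "K \<subseteq> P ` K"
    proof
      fix y assume "y \<in> K"
      then show "y \<in> P ` K"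
        by (intro image_eqI[of _ _ "adj_on K P y"] adj_on_in[OF K cl bP])
          (use adj_on_isometry[OF K cl bP, of y] iso in \<open>simp add: nP\<close>)
    qed
  qed
  interpret commuting_normal_pair K S "adj_on K S" P "adj_on K P"
    by (rule commuting_normal_pair_unitary[OF K cl bS bP SP iso onto nS])
  have spectral: "(l, m) \<in> bGamma" if "approximate_joint_eigenvalue l m" for l m
  proof (rule ccontr)
    assume "(l, m) \<notin> bGamma"
    then have "koszul_exact_on K (\<lambda>x. S x - l *\<^sub>C x) (\<lambda>x. P x - m *\<^sub>C x)"
      using spec by (auto simp: joint_spectrum_on_def)
    then have "\<exists>e>0. \<forall>x\<in>K. e * norm x \<le> norm (S x - l *\<^sub>C x) + norm (P x - m *\<^sub>C x)"
      by (rule koszul_exact_imp_bounded_below[OF K cl adjoint_pair_shift[OF K S] _ adjoint_pair_shift[OF K P], rotated 2])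
        (rule normal_shift[OF K S] normal_shift[OF K P], rule SS' PP', assumption, assumption)+
    then obtain e where e: "e > 0" "\<And>x. x \<in> K \<Longrightarrow> e * norm x \<le> norm (S x - l *\<^sub>C x) + norm (P x - m *\<^sub>C x)"
      by blast
    obtain x where "x \<in> K" "norm x = 1" "norm (S x - l *\<^sub>C x) \<le> e / 4" "norm (P x - m *\<^sub>C x) \<le> e / 4"
      using \<open>approximate_joint_eigenvalue l m\<close>[unfolded approximate_joint_eigenvalue_def, rule_format, of "e / 4"] e(1)
      by auto
    then show False using e(2)[of x] e(1) by simp
  qed
  show "cinner (S x) y = cinner (P x) (S y)" if "x \<in> K" "y \<in> K" for x y
  proof -
    have "S x = adj_on K S (P x)"
      by (rule eq_adjoint_mult_if_joint_spectrum[OF _ that(1)]) (rule bGammaD[OF spectral])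
    then show ?thesis using adjoint_pairD(2)[OF S mem(3)[OF that(1)] that(2)] by simp
  qed
  show "norm (S x) \<le> 2 * norm x" if "x \<in> K" for x
    by (rule norm_le_if_joint_spectrum_le[OF _ that]) (rule bGammaD[OF spectral])
qed

text \<open>Conversely, at a point of the joint spectrum there are approximate eigenvectors, to which the
  relations between \<open>S\<close> and \<open>P\<close> transfer: \<open>P\<close> isometric gives \<open>\<bar>m\<bar> = 1\<close>, the norm bound \<open>\<bar>l\<bar> \<le> 2\<close>, and
  \<open>S = S\<^sup>*P\<close> gives \<open>l = cnj l * m\<close>.\<close>

lemma gamma_unitary_onI:
  fixes K :: "'a::chilbert_space set"
  assumes K: "csubspace K" and cl: "closed K" and bS: "bounded_op_on K S" and bP: "bounded_op_on K P"
    and SP: "\<And>x. x \<in> K \<Longrightarrow> S (P x) = P (S x)"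
    and iso: "\<And>x y. x \<in> K \<Longrightarrow> y \<in> K \<Longrightarrow> cinner (P x) (P y) = cinner x y"
    and onto: "P ` K = K"
    and SSP: "\<And>x y. x \<in> K \<Longrightarrow> y \<in> K \<Longrightarrow> cinner (S x) y = cinner (P x) (S y)"
    and S2: "\<And>x. x \<in> K \<Longrightarrow> norm (S x) \<le> 2 * norm x"
  shows "gamma_unitary_on K S P"
proof -
  interpret commuting_normal_pair K S "adj_on K S" P "adj_on K P"
    by (rule commuting_normal_pair_of_unitary[OF K cl bS bP SP iso onto SSP])
  have "(l, m) \<in> bGamma" if ne: "\<not> koszul_exact_on K (\<lambda>x. S x - l *\<^sub>C x) (\<lambda>x. P x - m *\<^sub>C x)" for l m
  proof -
    have nonexact: "\<exists>x\<in>K. norm (S x - l *\<^sub>C x) + norm (P x - m *\<^sub>C x) < e * norm x" if e: "e > 0" for e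
    proof (rule ccontr)
      assume "\<not> ?thesis"
      then have low: "\<And>x. x \<in> K \<Longrightarrow> e * norm x \<le> norm (S x - l *\<^sub>C x) + norm (P x - m *\<^sub>C x)"
        by force
      have "koszul_exact_on K (\<lambda>x. S x - l *\<^sub>C x) (\<lambda>x. P x - m *\<^sub>C x)"
        by (rule bounded_below_imp_koszul_exact[OF K cl adjoint_pair_shift[OF K S] _ adjoint_pair_shift[OF K P] _ _ _ e low],
            (rule normal_shift[OF K S] normal_shift[OF K P], rule SS' PP', assumption, assumption)+)
          (simp_all add: diff mem csubspace_scaleC[OF K] scale SP SP' scaleC_diff_right scaleC_scaleC mult.commute)
      then show False using ne by contradiction
    qed
    have approx: "\<exists>x\<in>K. norm x = 1 \<and> norm (S x - l *\<^sub>C x) \<le> e \<and> norm (P x - m *\<^sub>C x) \<le> e" if e: "e > 0" for e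
    proof -
      obtain x where x: "x \<in> K" "norm (S x - l *\<^sub>C x) + norm (P x - m *\<^sub>C x) < e * norm x"
        using nonexact[OF e] by blast
      have nx: "norm x > 0"
        using x(2) norm_ge_zero[of "S x - l *\<^sub>C x"] norm_ge_zero[of "P x - m *\<^sub>C x"]
        by (metis add_nonneg_nonneg linorder_not_le mult_zero_right norm_le_zero_iff norm_zero)
      define y where "y = complex_of_real (1 / norm x) *\<^sub>C x"
      have yK: "y \<in> K" unfolding y_def by (rule csubspace_scaleC[OF K x(1)])
      have ny: "norm y = 1" unfolding y_def norm_scaleC norm_of_real using nx by simp
      have "S y - l *\<^sub>C y = complex_of_real (1 / norm x) *\<^sub>C (S x - l *\<^sub>C x)"
        "P y - m *\<^sub>C y = complex_of_real (1 / norm x) *\<^sub>C (P x - m *\<^sub>C x)"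
        by (simp_all only: y_def scale(1)[OF x(1)] scale(3)[OF x(1)] scaleC_diff_right scaleC_scaleC mult.commute)
      then have "norm (S y - l *\<^sub>C y) = norm (S x - l *\<^sub>C x) / norm x"
        "norm (P y - m *\<^sub>C y) = norm (P x - m *\<^sub>C x) / norm x"
        by (simp_all only: norm_scaleC norm_of_real) simp_all
      moreover have "norm (S x - l *\<^sub>C x) \<le> e * norm x" "norm (P x - m *\<^sub>C x) \<le> e * norm x"
        using x(2) norm_ge_zero[of "S x - l *\<^sub>C x"] norm_ge_zero[of "P x - m *\<^sub>C x"] by linarith+
      ultimately have "norm (S y - l *\<^sub>C y) \<le> e" "norm (P y - m *\<^sub>C y) \<le> e"
        using nx by (simp_all add: divide_le_eq)
      then show ?thesis using yK ny by blast
    qed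
    have "\<bar>cmod m - 1\<bar> \<le> 0"
    proof (rule field_le_epsilon)
      fix e :: real assume "e > 0"
      then obtain x where x: "x \<in> K" "norm x = 1" "norm (P x - m *\<^sub>C x) \<le> e" using approx by blast
      have "(norm (P x))\<^sup>2 = (norm x)\<^sup>2"
        using iso[OF x(1,1)] unfolding cinner_self using of_real_eq_iff by blast
      then have "norm (P x) = 1" using x(2) by (simp add: power2_eq_1_iff) (metis norm_ge_zero not_one_le_zero neg_0_le_iff_le)
      then show "\<bar>cmod m - 1\<bar> \<le> 0 + e"
        using norm_triangle_ineq3[of "P x" "m *\<^sub>C x"] x by (simp add: norm_scaleC)
    qed
    moreover have "cmod l \<le> 2"
    proof (rule field_le_epsilon)
      fix e :: real assume "e > 0"
      then obtain x where x: "x \<in> K" "norm x = 1" "norm (S x - l *\<^sub>C x) \<le> e" using approx by blast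
      then show "cmod l \<le> 2 + e"
        using norm_triangle_ineq3[of "S x" "l *\<^sub>C x"] S2[OF x(1)] by (simp add: norm_scaleC)
    qed
    moreover have "cmod (l - cnj l * m) \<le> 0"
    proof (rule field_le_epsilon)
      fix e :: real assume e: "e > 0"
      have "e / 6 > 0" using e by simp
      then obtain x where x: "x \<in> K" "norm x = 1" "norm (S x - l *\<^sub>C x) \<le> e / 6" "norm (P x - m *\<^sub>C x) \<le> e / 6"
        using approx by blast
      have xx: "cinner x x = 1" by (simp add: cinner_self x(2))
      \<comment> \<open>\<open>\<langle>Sx,x\<rangle>\<close> is close to \<open>l\<close>, and \<open>\<langle>Px,Sx\<rangle>\<close> is close to \<open>m\<close> times the conjugate of \<open>l\<close>.\<close>
      have "l - cnj l * m = cinner (P x - m *\<^sub>C x) (S x) + m * cnj (cinner (S x - l *\<^sub>C x) x)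
          - cinner (S x - l *\<^sub>C x) x"
      proof -
        have "cinner (P x - m *\<^sub>C x) (S x) = cinner (S x) x - m * cinner x (S x)"
          using SSP[OF x(1,1)] by (simp add: cinner_diff_left cinner_scaleC_left)
        moreover have "cnj (cinner (S x - l *\<^sub>C x) x) = cinner x (S x) - cnj l"
          by (simp add: cinner_commute[symmetric] cinner_diff_right cinner_scaleC_right xx)
        moreover have "cinner (S x - l *\<^sub>C x) x = cinner (S x) x - l"
          by (simp add: cinner_diff_left cinner_scaleC_left xx)
        ultimately show ?thesis by (simp only:) (simp add: algebra_simps)
      qed
      then have "cmod (l - cnj l * m) \<le> cmod (cinner (P x - m *\<^sub>C x) (S x))
          + cmod (m * cnj (cinner (S x - l *\<^sub>C x) x)) + cmod (cinner (S x - l *\<^sub>C x) x)"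
        by (simp only:) (intro order_trans[OF norm_triangle_ineq4] add_right_mono norm_triangle_ineq)
      moreover have "cmod (cinner (S x - l *\<^sub>C x) x) \<le> e / 6"
        using cmod_cinner_le[of "S x - l *\<^sub>C x" x] x by simp
      moreover have "cmod (cinner (P x - m *\<^sub>C x) (S x)) \<le> (e / 6) * 2"
      proof -
        have "cmod (cinner (P x - m *\<^sub>C x) (S x)) \<le> norm (P x - m *\<^sub>C x) * norm (S x)"
          by (rule cmod_cinner_le)
        also have "\<dots> \<le> (e / 6) * 2" using x S2[OF x(1)] e by (intro mult_mono) auto
        finally show ?thesis .
      qed
      moreover have "cmod (m * cnj (cinner (S x - l *\<^sub>C x) x)) = cmod (cinner (S x - l *\<^sub>C x) x)"
        using \<open>\<bar>cmod m - 1\<bar> \<le> 0\<close> by (simp add: norm_mult)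
      ultimately show "cmod (l - cnj l * m) \<le> 0 + e" using e by linarith
    qed
    ultimately show ?thesis by (intro bGammaI) auto
  qed
  then show ?thesis
    unfolding gamma_unitary_on_def normal_on_def joint_spectrum_on_def
    using K cl bS bP SP SS' PP' by auto
qed


section \<open>Separable spaces inside \<open>\<ell>\<^sup>2\<close>\<close>

text \<open>As \<open>sgn 0 = 0\<close>, an entry that depends linearly on the earlier ones yields the zero vector.\<close>

fun gram_schmidt :: "(nat \<Rightarrow> 'a::complex_inner) \<Rightarrow> nat \<Rightarrow> 'a" where
  "gram_schmidt d n =
     sgn (d n - (\<Sum>k<n. cinner (d n) (gram_schmidt d k) *\<^sub>C gram_schmidt d k))"

declare gram_schmidt.simps [simp del]

definition fourier_sum :: "(nat \<Rightarrow> 'a::complex_inner) \<Rightarrow> nat \<Rightarrow> 'a \<Rightarrow> 'a" where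
  "fourier_sum e N x = (\<Sum>k<N. cinner x (e k) *\<^sub>C e k)"

lemma cinner_sum_left: "cinner (sum f I) y = (\<Sum>i\<in>I. cinner (f i) (y::'a::complex_inner))"
  by (rule bounded_bilinear.sum_left[OF bounded_bilinear_cinner])

lemma cinner_sum_right: "cinner x (sum f I) = (\<Sum>i\<in>I. cinner x (f i :: 'a::complex_inner))"
  by (rule bounded_bilinear.sum_right[OF bounded_bilinear_cinner])

lemma cinner_sgn_left: "cinner (sgn x) y = complex_of_real (inverse (norm x)) * cinner x (y::'a::complex_inner)"
  unfolding sgn_div_norm scaleR_scaleC by (simp add: cinner_scaleC_left)

lemma cinner_gram_schmidt_self:
  "gram_schmidt d n = 0 \<or> cinner (gram_schmidt d n) (gram_schmidt d n) = 1"
proof -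
  have "norm (gram_schmidt d n) = 0 \<or> norm (gram_schmidt d n) = 1"
    unfolding gram_schmidt.simps[of d n] norm_sgn by auto
  then show ?thesis by (auto simp: cinner_self)
qed

lemma cinner_gram_schmidt_less:
  "m < n \<Longrightarrow> cinner (gram_schmidt d n) (gram_schmidt d m) = 0"
proof (induction n arbitrary: m rule: less_induct)
  case (less n)
  let ?e = "gram_schmidt d"
  have orth: "cinner (?e k) (?e m) = 0" if "k < n" "k \<noteq> m" for k
  proof (cases "k < m")
    case True
    then have "cinner (?e m) (?e k) = 0" using less by simp
    then show ?thesis by (metis cinner_commute complex_cnj_zero)
  next
    case False
    then show ?thesis using less that by simp
  qed
  have "(\<Sum>k<n. cinner (d n) (?e k) * cinner (?e k) (?e m)) = (\<Sum>k\<in>{m}. cinner (d n) (?e k) * cinner (?e k) (?e m))"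
    by (rule sum.mono_neutral_right) (use less.prems orth in auto)
  then have "cinner (d n - fourier_sum ?e n (d n)) (?e m) = cinner (d n) (?e m) * (1 - cinner (?e m) (?e m))"
    by (simp add: fourier_sum_def cinner_diff_left cinner_sum_left cinner_scaleC_left algebra_simps)
  also have "\<dots> = 0" using cinner_gram_schmidt_self[of d m] by auto
  finally show ?case
    unfolding gram_schmidt.simps[of d n] cinner_sgn_left fourier_sum_def[symmetric] by simp
qed

lemma cinner_gram_schmidt_neq:
  "m \<noteq> n \<Longrightarrow> cinner (gram_schmidt d n) (gram_schmidt d m) = 0"
  by (metis cinner_commute cinner_gram_schmidt_less complex_cnj_zero nat_neq_iff)

lemma fourier_sum_diff: "fourier_sum e N (x - y) = fourier_sum e N x - fourier_sum e N y"
  by (simp add: fourier_sum_def cinner_diff_left scaleC_diff_left sum_subtractf)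

lemma cinner_fourier_sum_gram_schmidt:
  assumes "k < N"
  shows "cinner (fourier_sum (gram_schmidt d) N x) (gram_schmidt d k) = cinner x (gram_schmidt d k)"
proof -
  let ?e = "gram_schmidt d"
  have "(\<Sum>j<N. cinner x (?e j) * cinner (?e j) (?e k)) = (\<Sum>j\<in>{k}. cinner x (?e j) * cinner (?e j) (?e k))"
    by (rule sum.mono_neutral_right) (use assms in \<open>auto simp: cinner_gram_schmidt_neq\<close>)
  also have "\<dots> = cinner x (?e k)" using cinner_gram_schmidt_self[of d k] by auto
  finally show ?thesis by (simp add: fourier_sum_def cinner_sum_left cinner_scaleC_left)
qed

lemma norm_diff_fourier_sum:
  "(norm (x - fourier_sum (gram_schmidt d) N x))\<^sup>2
    = (norm x)\<^sup>2 - (\<Sum>k<N. (cmod (cinner x (gram_schmidt d k)))\<^sup>2)"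
proof -
  let ?e = "gram_schmidt d" and ?y = "fourier_sum (gram_schmidt d) N x"
  have sq: "cinner x (?e k) * cinner (?e k) x = complex_of_real ((cmod (cinner x (?e k)))\<^sup>2)" for k
    unfolding complex_norm_square cinner_commute[of "?e k" x] ..
  have "cinner (x - ?y) ?y = 0"
    by (subst (2) fourier_sum_def)
      (simp add: cinner_sum_right cinner_scaleC_right cinner_diff_left cinner_fourier_sum_gram_schmidt)
  then have "cinner (x - ?y) (x - ?y) = cinner (x - ?y) x" by (simp add: cinner_diff_right)
  also have "\<dots> = cinner x x - (\<Sum>k<N. cinner x (?e k) * cinner (?e k) x)"
    by (simp add: cinner_diff_left fourier_sum_def cinner_sum_left cinner_scaleC_left)
  also have "(\<Sum>k<N. cinner x (?e k) * cinner (?e k) x) = (\<Sum>k<N. complex_of_real ((cmod (cinner x (?e k)))\<^sup>2))"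
    by (simp only: sq)
  finally have "complex_of_real ((norm (x - ?y))\<^sup>2)
      = complex_of_real ((norm x)\<^sup>2 - (\<Sum>k<N. (cmod (cinner x (?e k)))\<^sup>2))"
    by (simp add: cinner_self)
  then show ?thesis using of_real_eq_iff by blast
qed

lemma bessel: "(\<Sum>k<N. (cmod (cinner x (gram_schmidt d k)))\<^sup>2) \<le> (norm x)\<^sup>2"
  using norm_diff_fourier_sum[of x d N] zero_le_power2[of "norm (x - fourier_sum (gram_schmidt d) N x)"]
  by linarith

lemma fourier_sum_gram_schmidt_self:
  assumes "n < N"
  shows "fourier_sum (gram_schmidt d) N (d n) = d n"
proof -
  let ?e = "gram_schmidt d" and ?r = "d n - fourier_sum (gram_schmidt d) n (d n)"
  have en: "?e n = sgn ?r" by (simp add: gram_schmidt.simps[of d n] fourier_sum_def)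
  have "x = norm x *\<^sub>R sgn x" for x :: 'a by (cases "x = 0") (simp_all add: sgn_div_norm)
  then have r: "?r = norm ?r *\<^sub>R ?e n" by (simp only: en)
  have d: "d n = fourier_sum ?e n (d n) + norm ?r *\<^sub>R ?e n" using r by (metis add_diff_cancel_left' add.commute diff_add_cancel)
  have ck: "cinner (d n) (?e k) = (if k = n then complex_of_real (norm ?r) else 0)" if "k \<ge> n" for k
  proof -
    have "cinner (fourier_sum ?e n (d n)) (?e k) = 0"
      unfolding fourier_sum_def cinner_sum_left cinner_scaleC_left
      by (rule sum.neutral) (use that in \<open>auto simp: cinner_gram_schmidt_neq\<close>)
    then have "cinner (d n) (?e k) = complex_of_real (norm ?r) * cinner (?e n) (?e k)"
      by (subst d) (simp add: cinner_add_left scaleR_scaleC cinner_scaleC_left)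
    moreover have "?e n = 0 \<Longrightarrow> norm ?r = 0" using en by (simp add: sgn_zero_iff)
    ultimately show ?thesis
      using cinner_gram_schmidt_self[of d n] cinner_gram_schmidt_neq[of k n d] by auto
  qed
  have "fourier_sum ?e N (d n) = (\<Sum>k<Suc n. cinner (d n) (?e k) *\<^sub>C ?e k)"
    unfolding fourier_sum_def by (rule sum.mono_neutral_right) (use assms ck in auto)
  also have "\<dots> = fourier_sum ?e n (d n) + norm ?r *\<^sub>R ?e n"
    using ck[of n] by (simp add: fourier_sum_def scaleR_scaleC)
  finally show ?thesis using d by simp
qed

text \<open>Fourier coefficients with respect to the orthonormalized sequence. Bessel's inequality makes
  the coefficient map contractive everywhere; Parseval's identity holds on the closed span.\<close>

lemma isometry_into_l2:
  fixes d :: "nat \<Rightarrow> 'a::complex_inner"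
  obtains V :: "'a \<Rightarrow> complex hardy" where "bounded_linear V" "\<And>c x. V (c *\<^sub>C x) = c *\<^sub>C V x"
    "\<And>x. x \<in> closure (cspan (range d)) \<Longrightarrow> norm (V x) = norm x"
proof -
  let ?e = "gram_schmidt d"
  have summ: "summable (\<lambda>n. (norm (cinner x (?e n)))\<^sup>2)" for x
    by (rule summableI_nonneg_bounded[where x = "(norm x)\<^sup>2"]) (simp_all add: bessel)
  define V where "V x = Abs_hardy (\<lambda>n. cinner x (?e n))" for x
  have V: "coef (V x) n = cinner x (?e n)" for x n
    using summ[of x] by (simp add: V_def Abs_hardy_inverse)
  have add: "V (x + y) = V x + V y" for x y by (rule hardy_eqI) (simp add: V cinner_add_left)
  have scale: "V (c *\<^sub>C x) = c *\<^sub>C V x" for c x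
    by (rule hardy_eqI) (simp add: V cinner_scaleC_left scaleC_complex_def)
  have le: "norm (V x) \<le> norm x" for x
    by (rule norm_hardy_le_if_partial_sums_le) (simp_all add: V bessel)
  have bl: "bounded_linear V"
    by (rule bounded_linear_intro[where K = 1]) (simp_all add: add scale scaleR_scaleC le)
  define Y where "Y = {y. \<exists>N. \<forall>M\<ge>N. fourier_sum ?e M y = y}"
  have "cspan (range d) \<subseteq> Y"
  proof (rule hull_minimal)
    show "range d \<subseteq> Y"
      unfolding Y_def using fourier_sum_gram_schmidt_self[of _ _ d] by (auto simp: Suc_le_eq intro!: exI[of _ "Suc _"])
    show "csubspace Y"
      unfolding csubspace_def
    proof (intro conjI ballI allI)
      show "0 \<in> Y" by (simp add: Y_def fourier_sum_def)
      fix x y assume "x \<in> Y" "y \<in> Y"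
      then obtain M N where "\<forall>k\<ge>M. fourier_sum ?e k x = x" "\<forall>k\<ge>N. fourier_sum ?e k y = y"
        by (auto simp: Y_def)
      then show "x + y \<in> Y"
        unfolding Y_def
        by (intro CollectI exI[of _ "max M N"])
          (auto simp: fourier_sum_def cinner_add_left scaleC_add_left sum.distrib)
    next
      fix c x assume "x \<in> Y"
      then obtain M where "\<forall>k\<ge>M. fourier_sum ?e k x = x" by (auto simp: Y_def)
      moreover have "fourier_sum ?e k (c *\<^sub>C x) = c *\<^sub>C fourier_sum ?e k x" for k
        unfolding fourier_sum_def cinner_scaleC_left scaleC_scaleC[symmetric]
        by (rule bounded_bilinear.sum_right[OF bounded_bilinear_scaleC, symmetric])
      ultimately show "c *\<^sub>C x \<in> Y" unfolding Y_def by (intro CollectI exI[of _ M]) simp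
    qed
  qed
  have iso: "norm (V x) = norm x" if x: "x \<in> closure (cspan (range d))" for x
  proof (rule antisym[OF le])
    have "(norm x)\<^sup>2 \<le> (norm (V x))\<^sup>2"
    proof (rule field_le_epsilon)
      fix r :: real assume r: "r > 0"
      then obtain y where y: "y \<in> cspan (range d)" "dist y x < sqrt r"
        using x by (metis closure_approachable real_sqrt_gt_zero)
      then obtain M where M: "fourier_sum ?e M y = y" using \<open>cspan (range d) \<subseteq> Y\<close> by (auto simp: Y_def)
      have "x - fourier_sum ?e M x = (x - y) - fourier_sum ?e M (x - y)"
        by (simp add: fourier_sum_diff M)
      then have "(norm (x - fourier_sum ?e M x))\<^sup>2 = (norm ((x - y) - fourier_sum ?e M (x - y)))\<^sup>2" by (simp only:)
      also have "\<dots> \<le> (norm (x - y))\<^sup>2"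
        unfolding norm_diff_fourier_sum by (simp add: sum_nonneg)
      also have "\<dots> \<le> (sqrt r)\<^sup>2"
        using y(2) by (intro power_mono) (auto simp: dist_norm norm_minus_commute)
      finally have "(norm x)\<^sup>2 \<le> (\<Sum>k<M. (cmod (cinner x (?e k)))\<^sup>2) + r"
        using r by (simp add: norm_diff_fourier_sum)
      also have "(\<Sum>k<M. (cmod (cinner x (?e k)))\<^sup>2) \<le> (norm (V x))\<^sup>2"
        unfolding norm_hardy_sq V by (rule sum_le_suminf[OF summ]) auto
      finally show "(norm x)\<^sup>2 \<le> (norm (V x))\<^sup>2 + r" by simp
    qed
    then show "norm x \<le> norm (V x)" by (rule power2_le_imp_le) simp
  qed
  show ?thesis by (rule that[OF bl scale iso])
qed

lemma cinner_isometry: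
  assumes K: "csubspace K" and lin: "clinear_on K L V" and iso: "\<And>x. x \<in> K \<Longrightarrow> norm (V x) = norm x"
    and x: "x \<in> K" and y: "y \<in> K"
  shows "cinner (V x) (V y) = cinner x y"
proof -
  have re: "inner (V x) (V y) = inner x y" if "x \<in> K" "y \<in> K" for x y
  proof -
    have "norm (V x + V y) = norm (x + y)"
      using lin that iso[OF csubspace_add[OF K that]] by (simp add: clinear_on_def)
    moreover have "inner a b = ((norm (a + b))\<^sup>2 - (norm a)\<^sup>2 - (norm b)\<^sup>2) / 2" for a b :: "'c::real_inner"
      unfolding power2_norm_eq_inner by (simp add: inner_add_left inner_add_right inner_commute)
    ultimately show ?thesis using iso that by metis
  qed
  have "V (\<i> *\<^sub>C x) = \<i> *\<^sub>C V x" using lin x by (simp add: clinear_on_def)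
  then have "Re (cinner (\<i> *\<^sub>C V x) (V y)) = Re (cinner (\<i> *\<^sub>C x) y)"
    using re[OF csubspace_scaleC[OF K x] y, of \<i>] by (simp add: Re_cinner)
  moreover have "Re (cinner (V x) (V y)) = Re (cinner x y)" using re[OF x y] by (simp add: Re_cinner)
  ultimately show ?thesis by (simp add: cinner_scaleC_left complex_eq_iff)
qed

lemma csubspace_imp_subspace: "csubspace K \<Longrightarrow> subspace K"
  by (simp add: subspace_def csubspace_0 csubspace_add csubspace_scaleR)

lemma closed_isometric_image:
  fixes V :: "'a::chilbert_space \<Rightarrow> 'b::complex_inner"
  assumes "csubspace K" "closed K" "bounded_linear V" "\<And>x. x \<in> K \<Longrightarrow> norm (V x) = norm x"
  shows "closed (V ` K)"
proof (rule complete_imp_closed, rule complete_isometric_image[where e = 1])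
  show "complete K" using assms(2) by (simp add: complete_eq_closed)
qed (use assms csubspace_imp_subspace in auto)

text \<open>It suffices to extend to operators satisfying the algebraic relations on any Hilbert space with
  a countable total set, because such a space embeds into \<open>\<ell>\<^sup>2\<close>.\<close>

lemma gamma_isometry_on_if_extension:
  fixes K :: "'a::complex_inner set" and L :: "'b::chilbert_space set" and d :: "nat \<Rightarrow> 'b"
  assumes ops: "bounded_op_on K S" "bounded_op_on K P" "\<And>x. x \<in> K \<Longrightarrow> S (P x) = P (S x)"
    and L: "csubspace L" "closed L" "L \<subseteq> closure (cspan (range d))"
    and bS: "bounded_op_on L S'" and bP: "bounded_op_on L P'"
    and SP: "\<And>x. x \<in> L \<Longrightarrow> S' (P' x) = P' (S' x)"
    and iso: "\<And>x y. x \<in> L \<Longrightarrow> y \<in> L \<Longrightarrow> cinner (P' x) (P' y) = cinner x y"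
    and onto: "P' ` L = L"
    and SSP: "\<And>x y. x \<in> L \<Longrightarrow> y \<in> L \<Longrightarrow> cinner (S' x) y = cinner (P' x) (S' y)"
    and S2: "\<And>x. x \<in> L \<Longrightarrow> norm (S' x) \<le> 2 * norm x"
    and J: "isometry_on K L J" "\<And>x. x \<in> K \<Longrightarrow> J (S x) = S' (J x)" "\<And>x. x \<in> K \<Longrightarrow> J (P x) = P' (J x)"
  shows "gamma_isometry_on K S P"
proof -
  obtain V :: "'b \<Rightarrow> complex hardy" where V: "bounded_linear V" "\<And>c x. V (c *\<^sub>C x) = c *\<^sub>C V x"
    "\<And>x. x \<in> L \<Longrightarrow> norm (V x) = norm x"
    using isometry_into_l2[of d] L(3) by (metis subsetD)
  have Vadd: "V (x + y) = V x + V y" for x y by (rule linear_add[OF bounded_linear.linear[OF V(1)]])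
  have clin: "clinear_on L (V ` L) V" by (simp add: clinear_on_def Vadd V(2))
  have Vin: "cinner (V x) (V y) = cinner x y" if "x \<in> L" "y \<in> L" for x y
    by (rule cinner_isometry[OF L(1) clin V(3) that])
  have inj: "inj_on V L"
  proof (rule inj_onI)
    fix x y assume xy: "x \<in> L" "y \<in> L" "V x = V y"
    then have "cinner k x = cinner k y" if "k \<in> L" for k using Vin that by metis
    then show "x = y" by (intro cinner_eqI[OF L(1) xy(1,2)])
  qed
  define W where "W = inv_into L V"
  have W: "W (V x) = x" if "x \<in> L" for x unfolding W_def by (rule inv_into_f_f[OF inj that])
  define S'' where "S'' y = V (S' (W y))" for y
  define P'' where "P'' y = V (P' (W y))" for y
  note SL = bounded_op_on_in[OF bS] and PL = bounded_op_on_in[OF bP]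
  have T: "bounded_op_on (V ` L) (\<lambda>y. V (T (W y)))" if bT: "bounded_op_on L T" for T
  proof -
    obtain B where B: "B > 0" "\<And>x. x \<in> L \<Longrightarrow> norm (T x) \<le> B * norm x"
      using bounded_op_on_bound[OF bT] by blast
    note TL = bounded_op_on_in[OF bT]
    show ?thesis
    proof (rule bounded_op_onI[where B = B])
      fix y assume "y \<in> V ` L"
      then obtain x where x: "x \<in> L" "y = V x" by blast
      show "V (T (W y)) \<in> V ` L" using TL x W by simp
      show "norm (V (T (W y))) \<le> B * norm y" using B(2)[OF x(1)] V(3)[OF TL[OF x(1)]] V(3)[OF x(1)] x W by simp
      show "V (T (W (c *\<^sub>C y))) = c *\<^sub>C V (T (W y))" for c
        using W[OF csubspace_scaleC[OF L(1) x(1)], of c] x W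
        by (simp add: V(2)[symmetric] bounded_op_on_scaleC[OF bT])
      fix z assume "z \<in> V ` L"
      then obtain u where u: "u \<in> L" "z = V u" by blast
      show "V (T (W (y + z))) = V (T (W y)) + V (T (W z))"
        using W[OF csubspace_add[OF L(1) x(1) u(1)]] x u W
        by (simp add: Vadd[symmetric] bounded_op_on_add[OF bT])
    qed
  qed
  have "gamma_unitary_on (V ` L) S'' P''"
  proof (rule gamma_unitary_onI)
    show "csubspace (V ` L)"
      unfolding csubspace_def
    proof (intro conjI ballI allI)
      have "V 0 = 0" using V(2)[of 0 0] by simp
      then show "0 \<in> V ` L" using csubspace_0[OF L(1)] by (metis imageI)
    qed (auto simp: Vadd[symmetric] V(2)[symmetric] intro!: imageI csubspace_add[OF L(1)] csubspace_scaleC[OF L(1)])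
    show "closed (V ` L)" by (rule closed_isometric_image[OF L(1,2) V(1,3)])
    show "bounded_op_on (V ` L) S''" "bounded_op_on (V ` L) P''"
      unfolding S''_def[abs_def] P''_def[abs_def] by (intro T bS bP)+
    show "P'' ` V ` L = V ` L"
    proof -
      have "P'' ` V ` L = V ` P' ` L" by (auto simp: image_iff P''_def W)
      then show ?thesis by (simp add: onto)
    qed
  qed (auto simp: S''_def P''_def W SL PL SP Vin iso SSP S2 V(3))
  moreover have "isometry_on K (V ` L) (\<lambda>x. V (J x))"
    using J(1) by (auto simp: isometry_on_def clinear_on_def Vadd V(2,3))
  moreover have "V (J (S x)) = S'' (V (J x)) \<and> V (J (P x)) = P'' (V (J x))" if "x \<in> K" for x
    using J that by (auto simp: S''_def P''_def isometry_on_def clinear_on_def W)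
  ultimately show ?thesis unfolding gamma_isometry_on_def using ops by blast
qed


section \<open>The pencil \<open>A + A\<^sup>*V\<close>\<close>

text \<open>With \<open>A' = A\<^sup>*\<close> and \<open>V = M\<^sub>z\<close> this is the analytic Toeplitz operator \<open>A + A\<^sup>*M\<^sub>z\<close>; the same formula with
  the bilateral shift is its normal extension.\<close>

definition pencil :: "('a::complex_inner \<Rightarrow> 'a) \<Rightarrow> ('a \<Rightarrow> 'a) \<Rightarrow> ('a \<Rightarrow> 'a) \<Rightarrow> 'a \<Rightarrow> 'a" where
  "pencil A A' V x = A x + A' (V x)"

locale pencil_operators =
  fixes K :: "'a::complex_inner set" and A A' V :: "'a \<Rightarrow> 'a"
  assumes K: "csubspace K" and A: "adjoint_pair K A A'" and V: "bounded_op_on K V"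
    and isometric: "x \<in> K \<Longrightarrow> y \<in> K \<Longrightarrow> cinner (V x) (V y) = cinner x y"
    and AV: "x \<in> K \<Longrightarrow> A (V x) = V (A x)" and A'V: "x \<in> K \<Longrightarrow> A' (V x) = V (A' x)"
begin

lemma A_bounded: "bounded_op_on K A" "bounded_op_on K A'"
  using A by (auto simp: adjoint_pair_def)

lemmas A_mem = A_bounded[THEN bounded_op_on_in] and V_mem = bounded_op_on_in[OF V]

lemma bounded_pencil: "bounded_op_on K (pencil A A' V)"
  using bounded_op_on_lincomb[OF K A_bounded(1) bounded_op_on_compose[OF A_bounded(2) V], of 1 1]
  by (simp add: pencil_def[abs_def])

lemma pencil_commute: "x \<in> K \<Longrightarrow> pencil A A' V (V x) = V (pencil A A' V x)"
  by (simp add: pencil_def bounded_op_on_add[OF V] A_mem V_mem AV A'V)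

lemma cinner_pencil:
  assumes x: "x \<in> K" and y: "y \<in> K"
  shows "cinner (pencil A A' V x) y = cinner (V x) (pencil A A' V y)"
proof -
  have "cinner (V x) (A' (V y)) = cinner (A (V x)) (V y)"
    by (rule adjoint_pairD(1)[OF A V_mem[OF x] V_mem[OF y], symmetric])
  also have "\<dots> = cinner (A x) y" using x y by (simp add: AV isometric A_mem)
  finally show ?thesis
    using adjoint_pairD(2)[OF A V_mem[OF x] y]
    by (simp add: pencil_def cinner_add_left cinner_add_right)
qed

end

text \<open>If \<open>V\<close> is unitary, \<open>T = A + A\<^sup>*V\<close> is normal. At an approximate joint eigenvector of \<open>(T, V)\<close> with
  eigenvalues \<open>(l, m)\<close>, \<open>l\<close> is close to \<open>\<langle>Ax,x\<rangle> + m\<langle>x,Ax\<rangle>\<close>, so that the numerical radius of \<open>A\<close> controls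
  the spectral radius of \<open>T\<close>, which is its norm.\<close>

lemma norm_pencil_le:
  fixes K :: "'a::chilbert_space set"
  assumes ops: "pencil_operators K A A' V" and cl: "closed K" and onto: "V ` K = K"
    and w: "\<And>x. x \<in> K \<Longrightarrow> cmod (cinner (A x) x) \<le> (norm x)\<^sup>2"
    and x: "x \<in> K"
  shows "norm (pencil A A' V x) \<le> 2 * norm x"
proof -
  interpret pencil_operators K A A' V by (rule ops)
  interpret commuting_normal_pair K "pencil A A' V" "adj_on K (pencil A A' V)" V "adj_on K V"
    by (rule commuting_normal_pair_of_unitary[OF K cl bounded_pencil V pencil_commute isometric onto cinner_pencil])
  obtain B where B: "B > 0" "\<And>x. x \<in> K \<Longrightarrow> norm (A x) \<le> B * norm x"
    using bounded_op_on_bound[OF A_bounded(1)] by blast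
  show ?thesis
  proof (rule norm_le_if_joint_spectrum_le[OF _ x])
    fix l m assume lm: "approximate_joint_eigenvalue l m"
    show "cmod l \<le> 2"
    proof (rule field_le_epsilon)
      fix e :: real assume e: "e > 0"
      define d where "d = e / (2 + B)"
      have d: "d > 0" "(2 + B) * d = e" using e B by (simp_all add: d_def)
      obtain y where y: "y \<in> K" "norm y = 1" "norm (pencil A A' V y - l *\<^sub>C y) \<le> d"
        "norm (V y - m *\<^sub>C y) \<le> d"
        using lm d(1) unfolding approximate_joint_eigenvalue_def by blast
      have yy: "cinner y y = 1" by (simp add: cinner_self y(2))
      have m1: "cmod m \<le> 1 + d"
      proof -
        have "(norm (V y))\<^sup>2 = (norm y)\<^sup>2"
          using isometric[OF y(1,1)] unfolding cinner_self using of_real_eq_iff by blast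
        then have "norm (V y) = 1" using y(2) by (smt (verit) norm_ge_zero power2_eq_imp_eq)
        then show ?thesis using norm_triangle_ineq3[of "V y" "m *\<^sub>C y"] y by (simp add: norm_scaleC)
      qed
      let ?q = "cinner (A y) y"
      have "cinner (A' (V y)) y = cinner (V y) (A y)"
        by (rule adjoint_pairD(2)[OF A V_mem[OF y(1)] y(1)])
      moreover have "cinner y (A y) = cnj ?q" by (rule cinner_commute)
      ultimately have l: "l = ?q + m * cnj ?q + (cinner (V y - m *\<^sub>C y) (A y)
          - cinner (pencil A A' V y - l *\<^sub>C y) y)"
        by (simp add: pencil_def cinner_diff_left cinner_add_left cinner_scaleC_left yy)
      have q: "cmod ?q \<le> 1" using w[OF y(1)] y(2) by simp
      have "cmod l \<le> cmod (?q + m * cnj ?q) + cmod (cinner (V y - m *\<^sub>C y) (A y)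
          - cinner (pencil A A' V y - l *\<^sub>C y) y)"
        by (subst l) (rule norm_triangle_ineq)
      also have "cmod (?q + m * cnj ?q) \<le> 1 + (1 + d)"
      proof -
        have "cmod (?q + m * cnj ?q) \<le> cmod ?q + cmod m * cmod ?q"
          using norm_triangle_ineq[of ?q "m * cnj ?q"] by (simp add: norm_mult)
        also have "\<dots> \<le> 1 + (1 + d) * 1" using q m1 d by (intro add_mono mult_mono) auto
        finally show ?thesis by simp
      qed
      also have "cmod (cinner (V y - m *\<^sub>C y) (A y) - cinner (pencil A A' V y - l *\<^sub>C y) y) \<le> d * B + d"
      proof -
        have "cmod (cinner (V y - m *\<^sub>C y) (A y)) \<le> norm (V y - m *\<^sub>C y) * norm (A y)"
          by (rule cmod_cinner_le)
        also have "\<dots> \<le> d * B" using y d B(2)[OF y(1)] by (intro mult_mono) auto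
        finally have "cmod (cinner (V y - m *\<^sub>C y) (A y)) \<le> d * B" .
        moreover have "cmod (cinner (pencil A A' V y - l *\<^sub>C y) y) \<le> d"
          using cmod_cinner_le[of "pencil A A' V y - l *\<^sub>C y" y] y by simp
        ultimately show ?thesis
          using norm_triangle_ineq4[of "cinner (V y - m *\<^sub>C y) (A y)" "cinner (pencil A A' V y - l *\<^sub>C y) y"]
          by linarith
      qed
      finally show "cmod l \<le> 2 + e" using d(2) by (simp add: algebra_simps)
    qed
  qed
qed


section \<open>Operators on the Hardy space and the bilateral shift\<close>

lemma hardy_in_iff: "f \<in> hardy_in E \<longleftrightarrow> (\<forall>n. coef f n \<in> E)"
  by (simp add: hardy_in_def)

lemma csubspace_hardy_in:
  assumes E: "csubspace E"
  shows "csubspace (hardy_in E)"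
  unfolding csubspace_def
  by (auto simp: hardy_in_iff intro: csubspace_0[OF E] csubspace_add[OF E] csubspace_scaleC[OF E])

lemma bounded_linear_coef: "bounded_linear (\<lambda>f. coef f n)"
  by (rule bounded_linear_intro[where K = 1]) (auto simp: scaleR_scaleC norm_coef_le)

lemma closed_hardy_in:
  assumes "closed E"
  shows "closed (hardy_in E)"
proof -
  have "hardy_in E = (\<Inter>n. (\<lambda>f. coef f n) -` E)" by (auto simp: hardy_in_iff)
  moreover have "closed ((\<lambda>f. coef f n) -` E)" for n
    using continuous_closed_vimage[OF assms] linear_continuous_at[OF bounded_linear_coef] by blast
  ultimately show ?thesis by (metis closed_INT)
qed

lemma coef_hardy_tensor:
  assumes A: "bounded_op_on E A" and f: "f \<in> hardy_in E"
  shows "coef (hardy_tensor A f) n = A (coef f n)"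
proof -
  obtain B where B: "B > 0" "\<And>x. x \<in> E \<Longrightarrow> norm (A x) \<le> B * norm x"
    using bounded_op_on_bound[OF A] by blast
  have "summable (\<lambda>n. (norm (A (coef f n)))\<^sup>2)"
  proof (rule summable_comparison_test')
    show "summable (\<lambda>n. B\<^sup>2 * (norm (coef f n))\<^sup>2)" by (intro summable_mult summable_coef)
    fix n
    have "norm (A (coef f n)) \<le> B * norm (coef f n)" using f by (intro B) (simp add: hardy_in_iff)
    then have "(norm (A (coef f n)))\<^sup>2 \<le> (B * norm (coef f n))\<^sup>2" by (intro power_mono) auto
    then show "norm ((norm (A (coef f n)))\<^sup>2) \<le> B\<^sup>2 * (norm (coef f n))\<^sup>2" by (simp add: power_mult_distrib)
  qed
  then show ?thesis by (simp add: hardy_tensor_def Abs_hardy_inverse)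
qed

lemma bounded_op_on_hardy_tensor:
  assumes E: "csubspace E" and A: "bounded_op_on E A"
  shows "bounded_op_on (hardy_in E) (hardy_tensor A)"
proof -
  obtain B where B: "B > 0" "\<And>x. x \<in> E \<Longrightarrow> norm (A x) \<le> B * norm x"
    using bounded_op_on_bound[OF A] by blast
  note c = coef_hardy_tensor[OF A] and H = csubspace_hardy_in[OF E]
  show ?thesis
  proof (rule bounded_op_onI[where B = B])
    fix f assume f: "f \<in> hardy_in E"
    show "hardy_tensor A f \<in> hardy_in E"
      unfolding hardy_in_iff c[OF f] using f bounded_op_on_in[OF A] by (simp add: hardy_in_iff)
    show "norm (hardy_tensor A f) \<le> B * norm f"
    proof (rule norm_hardy_le_if_partial_sums_le)
      fix N
      have "(\<Sum>n<N. (norm (coef (hardy_tensor A f) n))\<^sup>2) \<le> (\<Sum>n<N. B\<^sup>2 * (norm (coef f n))\<^sup>2)"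
      proof (rule sum_mono)
        fix n
        have "norm (A (coef f n)) \<le> B * norm (coef f n)" using f by (intro B) (simp add: hardy_in_iff)
        then have "(norm (A (coef f n)))\<^sup>2 \<le> (B * norm (coef f n))\<^sup>2" by (intro power_mono) auto
        then show "(norm (coef (hardy_tensor A f) n))\<^sup>2 \<le> B\<^sup>2 * (norm (coef f n))\<^sup>2"
          by (simp add: power_mult_distrib c[OF f])
      qed
      also have "\<dots> = B\<^sup>2 * (\<Sum>n<N. (norm (coef f n))\<^sup>2)" by (rule sum_distrib_left[symmetric])
      also have "\<dots> \<le> B\<^sup>2 * (norm f)\<^sup>2"
        unfolding norm_hardy_sq by (intro mult_left_mono sum_le_suminf summable_coef) auto
      finally show "(\<Sum>n<N. (norm (coef (hardy_tensor A f) n))\<^sup>2) \<le> (B * norm f)\<^sup>2"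
        by (simp add: power_mult_distrib)
    qed (use B in simp)
    show "hardy_tensor A (z *\<^sub>C f) = z *\<^sub>C hardy_tensor A f" for z
      using f by (intro hardy_eqI)
        (simp add: c csubspace_scaleC[OF H] bounded_op_on_scaleC[OF A] hardy_in_iff[of f])
    fix g assume g: "g \<in> hardy_in E"
    show "hardy_tensor A (f + g) = hardy_tensor A f + hardy_tensor A g"
      using f g by (intro hardy_eqI)
        (simp add: c csubspace_add[OF H] bounded_op_on_add[OF A] hardy_in_iff[of f] hardy_in_iff[of g])
  qed
qed

lemma adjoint_pair_hardy_tensor:
  assumes E: "csubspace E" and A: "adjoint_pair E A A'"
  shows "adjoint_pair (hardy_in E) (hardy_tensor A) (hardy_tensor A')"
proof -
  have b: "bounded_op_on E A" "bounded_op_on E A'" using A by (auto simp: adjoint_pair_def)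
  have "cinner (hardy_tensor A f) g = cinner f (hardy_tensor A' g)"
    if f: "f \<in> hardy_in E" and g: "g \<in> hardy_in E" for f g
    unfolding cinner_hardy.rep_eq coef_hardy_tensor[OF b(1) f] coef_hardy_tensor[OF b(2) g]
    using f g by (simp add: hardy_in_iff adjoint_pairD(1)[OF A])
  then show ?thesis using b by (simp add: adjoint_pair_def bounded_op_on_hardy_tensor[OF E])
qed

lemma coef_hardy_Mz [simp]: "coef (hardy_Mz f) 0 = 0" "coef (hardy_Mz f) (Suc n) = coef f n"
  by (simp_all add: hardy_Mz.rep_eq)

lift_definition hardy_single :: "nat \<Rightarrow> 'a::complex_inner \<Rightarrow> 'a hardy" is "\<lambda>k a n. if n = k then a else 0"
  by (rule summable_finite[of "{_}"]) auto

lift_definition backward_shift :: "'a::complex_inner hardy \<Rightarrow> 'a hardy" is "\<lambda>a n. a (Suc n)"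
  by (subst summable_Suc_iff)

declare hardy_single.rep_eq [simp] backward_shift.rep_eq [simp]

text \<open>The element \<open>(f, g)\<close> represents the two-sided sequence with entries \<open>coef f n\<close> at \<open>n \<ge> 0\<close> and
  \<open>coef g n\<close> at \<open>-n - 1\<close>.\<close>

definition bilateral_shift :: "'a::complex_inner hardy \<times> 'a hardy \<Rightarrow> 'a hardy \<times> 'a hardy" where
  "bilateral_shift x = (hardy_Mz (fst x) + hardy_single 0 (coef (snd x) 0), backward_shift (snd x))"

lemma cinner_hardy_head:
  "cinner f g = cinner (coef f 0) (coef g 0) + cinner (backward_shift f) (backward_shift g)"
  unfolding cinner_hardy.rep_eq backward_shift.rep_eq
  by (subst suminf_split_head[OF summable_cinner[OF summable_coef summable_coef]]) simp

lemma cinner_hardy_Mz: "cinner (hardy_Mz f) (hardy_Mz g) = cinner f g"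
proof -
  have "backward_shift (hardy_Mz f) = f" for f :: "'a hardy" by (rule hardy_eqI) simp
  then show ?thesis by (subst cinner_hardy_head) simp
qed

lemma cinner_bilateral_shift: "cinner (bilateral_shift x) (bilateral_shift y) = cinner x y"
proof -
  have "backward_shift (hardy_Mz f + hardy_single 0 a) = f" for f :: "'a hardy" and a
    by (rule hardy_eqI) simp
  then show ?thesis
    unfolding cinner_prod_def bilateral_shift_def fst_conv snd_conv
    by (subst (1) cinner_hardy_head, subst (4) cinner_hardy_head) simp
qed

lemma norm_eq_if_cinner_eq: "cinner x x = cinner y y \<Longrightarrow> norm x = norm y"
  unfolding cinner_self of_real_eq_iff by (simp add: power2_eq_imp_eq)

lemma hardy_Mz_add: "hardy_Mz (f + g) = hardy_Mz f + hardy_Mz g"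
  by (rule hardy_eqI) (simp add: hardy_Mz.rep_eq split: nat.split)

lemma hardy_Mz_scaleC: "hardy_Mz (c *\<^sub>C f) = c *\<^sub>C hardy_Mz f"
  by (rule hardy_eqI) (simp add: hardy_Mz.rep_eq split: nat.split)

lemma hardy_Mz_in: "csubspace E \<Longrightarrow> f \<in> hardy_in E \<Longrightarrow> hardy_Mz f \<in> hardy_in E"
  by (auto simp: hardy_in_iff hardy_Mz.rep_eq csubspace_0 split: nat.split)

lemma hardy_single_in: "csubspace E \<Longrightarrow> a \<in> E \<Longrightarrow> hardy_single k a \<in> hardy_in E"
  by (auto simp: hardy_in_iff csubspace_0)

lemma bounded_op_on_hardy_Mz: "csubspace E \<Longrightarrow> bounded_op_on (hardy_in E) hardy_Mz"
  by (rule bounded_op_onI[where B = 1])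
    (auto simp: hardy_Mz_in hardy_Mz_add hardy_Mz_scaleC cinner_hardy_Mz intro!: eq_refl norm_eq_if_cinner_eq)

lemma hardy_tensor_Mz:
  assumes E: "csubspace E" and A: "bounded_op_on E A" and f: "f \<in> hardy_in E"
  shows "hardy_tensor A (hardy_Mz f) = hardy_Mz (hardy_tensor A f)"
proof -
  show ?thesis
    by (rule hardy_eqI) (simp add: bounded_op_on_zero[OF E A] coef_hardy_tensor[OF A] f hardy_Mz_in[OF E f] hardy_Mz.rep_eq split: nat.split)
qed

lemma backward_shift_in: "f \<in> hardy_in E \<Longrightarrow> backward_shift f \<in> hardy_in E"
  by (simp add: hardy_in_iff)

lemma Mz_plus_single_in:
  assumes E: "csubspace E" and f: "f \<in> hardy_in E" and g: "g \<in> hardy_in E"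
  shows "hardy_Mz f + hardy_single 0 (coef g 0) \<in> hardy_in E"
proof -
  have "coef g 0 \<in> E" using g by (simp add: hardy_in_iff)
  then show ?thesis
    by (intro csubspace_add[OF csubspace_hardy_in[OF E]] hardy_Mz_in[OF E f] hardy_single_in[OF E])
qed

lemma bilateral_shift_in:
  assumes E: "csubspace E" and x: "x \<in> hardy_in E \<times> hardy_in E"
  shows "bilateral_shift x \<in> hardy_in E \<times> hardy_in E"
  using x by (auto simp: bilateral_shift_def intro: backward_shift_in Mz_plus_single_in[OF E])

lemma bilateral_shift_onto:
  assumes E: "csubspace E"
  shows "bilateral_shift ` (hardy_in E \<times> hardy_in E) = hardy_in E \<times> hardy_in E"
proof
  show "bilateral_shift ` (hardy_in E \<times> hardy_in E) \<subseteq> hardy_in E \<times> hardy_in E"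
    using bilateral_shift_in[OF E] by blast
  show "hardy_in E \<times> hardy_in E \<subseteq> bilateral_shift ` (hardy_in E \<times> hardy_in E)"
  proof
    fix y assume y: "y \<in> hardy_in E \<times> hardy_in E"
    define x where "x = (backward_shift (fst y), hardy_Mz (snd y) + hardy_single 0 (coef (fst y) 0))"
    have "y = bilateral_shift x"
      unfolding bilateral_shift_def x_def
      by (rule prod_eqI; rule hardy_eqI) (auto simp: hardy_Mz.rep_eq split: nat.split)
    moreover have "x \<in> hardy_in E \<times> hardy_in E"
      using y by (auto simp: x_def intro: backward_shift_in Mz_plus_single_in[OF E])
    ultimately show "y \<in> bilateral_shift ` (hardy_in E \<times> hardy_in E)" by blast
  qed
qed

lemma hardy_single_add: "hardy_single k (a + b) = hardy_single k a + hardy_single k b"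
  by (rule hardy_eqI) simp

lemma hardy_single_scaleC: "hardy_single k (c *\<^sub>C a) = c *\<^sub>C hardy_single k a"
  by (rule hardy_eqI) simp

lemma bounded_op_on_bilateral_shift:
  assumes E: "csubspace E"
  shows "bounded_op_on (hardy_in E \<times> hardy_in E) bilateral_shift"
proof (rule bounded_op_onI[where B = 1])
  fix x y :: "'a hardy \<times> 'a hardy" and c
  show "bilateral_shift (x + y) = bilateral_shift x + bilateral_shift y"
    unfolding bilateral_shift_def
    by (rule prod_eqI) (auto simp: hardy_Mz_add hardy_single_add intro: hardy_eqI)
  show "bilateral_shift (c *\<^sub>C x) = c *\<^sub>C bilateral_shift x"
    unfolding bilateral_shift_def
    by (rule prod_eqI) (auto simp: scaleC_prod_def hardy_Mz_scaleC hardy_single_scaleC scaleC_add_right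
        intro: hardy_eqI)
  show "norm (bilateral_shift x) \<le> 1 * norm x"
    using norm_eq_if_cinner_eq[OF cinner_bilateral_shift[of x x]] by simp
qed (rule bilateral_shift_in[OF E])

lemma csubspace_Times: "csubspace K \<Longrightarrow> csubspace L \<Longrightarrow> csubspace (K \<times> L)"
  by (auto simp: csubspace_def scaleC_prod_def zero_prod_def)

lemma norm_prod_sq:
  fixes x :: "'a::complex_inner \<times> 'b::complex_inner"
  shows "(norm x)\<^sup>2 = (norm (fst x))\<^sup>2 + (norm (snd x))\<^sup>2"
  by (simp add: norm_prod_def)

lemma norm_map_prod_le:
  fixes x :: "'a::complex_inner \<times> 'b::complex_inner"
    and S :: "'a \<Rightarrow> 'c::complex_inner" and T :: "'b \<Rightarrow> 'd::complex_inner"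
  assumes "norm (S (fst x)) \<le> c * norm (fst x)" "norm (T (snd x)) \<le> c * norm (snd x)" "c \<ge> 0"
  shows "norm (map_prod S T x) \<le> c * norm x"
proof -
  have "(norm (map_prod S T x))\<^sup>2 \<le> (c * norm (fst x))\<^sup>2 + (c * norm (snd x))\<^sup>2"
    unfolding norm_prod_sq[of "map_prod S T x"] using assms by (intro add_mono power_mono) (auto simp: map_prod_def split: prod.split)
  also have "\<dots> = (c * norm x)\<^sup>2" by (simp add: power_mult_distrib norm_prod_sq[of x] algebra_simps)
  finally show ?thesis by (rule power2_le_imp_le) (use assms in simp)
qed

lemma bounded_op_on_map_prod:
  assumes S: "bounded_op_on K S" and T: "bounded_op_on L T"
  shows "bounded_op_on (K \<times> L) (map_prod S T)"
proof -
  obtain B where B: "B > 0" "\<And>x. x \<in> K \<Longrightarrow> norm (S x) \<le> B * norm x"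
    using bounded_op_on_bound[OF S] by blast
  obtain C where C: "C > 0" "\<And>x. x \<in> L \<Longrightarrow> norm (T x) \<le> C * norm x"
    using bounded_op_on_bound[OF T] by blast
  show ?thesis
  proof (rule bounded_op_onI[where B = "max B C"])
    fix x assume x: "x \<in> K \<times> L"
    show "norm (map_prod S T x) \<le> max B C * norm x"
    proof (rule norm_map_prod_le)
      have "B * norm (fst x) \<le> max B C * norm (fst x)" "C * norm (snd x) \<le> max B C * norm (snd x)"
        by (intro mult_right_mono; simp)+
      then show "norm (S (fst x)) \<le> max B C * norm (fst x)" "norm (T (snd x)) \<le> max B C * norm (snd x)"
        using B(2)[of "fst x"] C(2)[of "snd x"] x by force+
    qed (use B in simp)
  qed (auto simp: bounded_op_on_in[OF S] bounded_op_on_in[OF T] bounded_op_on_add[OF S] bounded_op_on_add[OF T]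
      bounded_op_on_scaleC[OF S] bounded_op_on_scaleC[OF T] scaleC_prod_def)
qed

lemma adjoint_pair_map_prod:
  assumes "adjoint_pair K S S'" "adjoint_pair L T T'"
  shows "adjoint_pair (K \<times> L) (map_prod S T) (map_prod S' T')"
  using assms by (auto simp: adjoint_pair_def bounded_op_on_map_prod cinner_prod_def)

lemma hardy_sums_single: "(\<lambda>N. \<Sum>k<N. hardy_single k (coef f k)) \<longlonglongrightarrow> f"
proof -
  have coef_sum: "coef (\<Sum>k<N. hardy_single k (coef f k)) n = (if n < N then coef f n else 0)" for N n
    unfolding linear_sum[OF bounded_linear.linear[OF bounded_linear_coef]] by simp
  let ?S = "\<lambda>N. \<Sum>k<N. hardy_single k (coef f k)"
  have "(norm (?S N - f))\<^sup>2 = (norm f)\<^sup>2 - (\<Sum>k<N. (norm (coef f k))\<^sup>2)" for N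
  proof -
    have "(\<Sum>n. (norm (coef (?S N - f) n))\<^sup>2) = (\<Sum>n. (norm (coef (?S N - f) (n + N)))\<^sup>2) + (\<Sum>n<N. (norm (coef (?S N - f) n))\<^sup>2)"
      by (rule suminf_split_initial_segment[OF summable_coef])
    also have "\<dots> = (\<Sum>n. (norm (coef f (n + N)))\<^sup>2)" by (simp add: coef_sum)
    also have "\<dots> = (\<Sum>n. (norm (coef f n))\<^sup>2) - (\<Sum>n<N. (norm (coef f n))\<^sup>2)"
      by (rule suminf_minus_initial_segment[OF summable_coef])
    finally show ?thesis by (simp only: norm_hardy_sq)
  qed
  moreover have "(\<lambda>N. (norm f)\<^sup>2 - (\<Sum>k<N. (norm (coef f k))\<^sup>2)) \<longlonglongrightarrow> (norm f)\<^sup>2 - (norm f)\<^sup>2"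
    unfolding norm_hardy_sq by (intro tendsto_diff tendsto_const summable_LIMSEQ summable_coef)
  ultimately have "(\<lambda>N. sqrt ((norm (?S N - f))\<^sup>2)) \<longlonglongrightarrow> sqrt 0"
    by (intro tendsto_real_sqrt) simp
  then show ?thesis by (simp add: tendsto_norm_zero_iff LIM_zero_iff)
qed


section \<open>Operators determined by their compressions\<close>

lemma orthogonal_to_total:
  fixes z :: "'a::complex_inner"
  assumes z: "z \<in> closure (cspan X)" and orth: "\<And>x. x \<in> X \<Longrightarrow> cinner x z = 0"
  shows "z = 0"
proof -
  let ?N = "{x. cinner x z = 0}"
  have "cspan X \<subseteq> ?N"
    by (rule hull_minimal) (auto simp: orth csubspace_def cinner_add_left cinner_scaleC_left)
  moreover have "closed ?N"
  proof -
    have "continuous_on UNIV (\<lambda>x. cinner x z)"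
      by (intro bounded_linear.continuous_on[OF bounded_bilinear.bounded_linear_left[OF bounded_bilinear_cinner]]
          continuous_on_id)
    then show ?thesis by (intro closed_Collect_eq continuous_on_const)
  qed
  ultimately have "closure (cspan X) \<subseteq> ?N" by (rule closure_minimal)
  then have "cinner z z = 0" using z by blast
  then show ?thesis by (simp add: cinner_self)
qed

text \<open>An isometric dilation \<open>V\<close> of \<open>P\<close>, minimal in the sense that the vectors \<open>V\<^sup>mJh\<close> span a dense
  subspace: any identity between bounded operators on \<open>K\<close> can be tested on them.\<close>

locale isometric_dilation =
  fixes P :: "'h::chilbert_space \<Rightarrow> 'h" and K :: "'b::chilbert_space set"
    and V :: "'b \<Rightarrow> 'b" and J :: "'h \<Rightarrow> 'b"
  assumes K: "csubspace K" and closed: "closed K"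
    and P: "bounded_op_on UNIV P" and V: "bounded_op_on K V" and J: "isometry_on UNIV K J"
    and V_isometric: "x \<in> K \<Longrightarrow> y \<in> K \<Longrightarrow> cinner (V x) (V y) = cinner x y"
    and J_adj: "J (adj P h) = adj_on K V (J h)"
    and minimal: "K = closure (cspan {(V ^^ m) (J h) | m h. True})"
begin

lemma J_mem: "J h \<in> K"
  using J by (simp add: isometry_on_def clinear_on_def)

lemma V_power_mem: "x \<in> K \<Longrightarrow> (V ^^ m) x \<in> K"
  by (induction m) (auto simp: bounded_op_on_in[OF V])

lemma cinner_J: "cinner (J h) (J k) = cinner h k"
  by (rule cinner_isometry[OF csubspace_UNIV]) (use J in \<open>auto simp: isometry_on_def\<close>)

lemma cinner_V_power: "x \<in> K \<Longrightarrow> y \<in> K \<Longrightarrow> cinner ((V ^^ m) x) ((V ^^ m) y) = cinner x y"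
  by (induction m) (auto simp: V_isometric V_power_mem)

lemma cinner_V_power_J:
  assumes x: "x \<in> K"
  shows "cinner ((V ^^ m) x) (J k) = cinner x (J ((adj P ^^ m) k))"
proof (induction m arbitrary: k)
  case (Suc m)
  have "cinner ((V ^^ Suc m) x) (J k) = cinner ((V ^^ m) x) (J (adj P k))"
    unfolding J_adj using cinner_adj_on[OF K closed V V_power_mem[OF x]] by simp
  also have "\<dots> = cinner x (J ((adj P ^^ m) (adj P k)))" by (rule Suc.IH)
  finally show ?case by (simp add: funpow_swap1)
qed simp

lemma orthogonal_to_dilation:
  assumes z: "z \<in> K" and orth: "\<And>m h. cinner ((V ^^ m) (J h)) z = 0"
  shows "z = 0"
proof (rule orthogonal_to_total)
  show "z \<in> closure (cspan {(V ^^ m) (J h) | m h. True})" by (subst minimal[symmetric]) (rule z)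
qed (use orth in blast)

definition toeplitz_lift :: "('h \<Rightarrow> 'h) \<Rightarrow> ('b \<Rightarrow> 'b) \<Rightarrow> bool" where
  "toeplitz_lift S T \<longleftrightarrow> bounded_op_on K T \<and> (\<forall>x\<in>K. T (V x) = V (T x)) \<and>
     (\<forall>x\<in>K. \<forall>y\<in>K. cinner (T x) y = cinner (V x) (T y)) \<and>
     (\<forall>h k. cinner (T (J h)) (J k) = cinner (S h) k)"

lemma
  assumes "toeplitz_lift S T"
  shows lift_bounded: "bounded_op_on K T" and lift_commute: "x \<in> K \<Longrightarrow> T (V x) = V (T x)"
    and lift_relation: "x \<in> K \<Longrightarrow> y \<in> K \<Longrightarrow> cinner (T x) y = cinner (V x) (T y)"
    and lift_compression: "cinner (T (J h)) (J k) = cinner (S h) k"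
  using assms by (auto simp: toeplitz_lift_def)

lemma lift_V_power:
  assumes "toeplitz_lift S T" "x \<in> K"
  shows "T ((V ^^ m) x) = (V ^^ m) (T x)"
  by (induction m) (simp_all add: lift_commute[OF assms(1)] V_power_mem[OF assms(2)])

text \<open>A commuting lift of a compression is automatically co-extending: on the dense set of the
  vectors \<open>V\<^sup>mJh\<close> both sides have the inner product \<open>\<langle>P\<^sup>mh, S\<^sup>*k\<rangle>\<close>, because \<open>S\<close> commutes with \<open>P\<close>.\<close>

lemma adj_compression:
  assumes S: "bounded_op_on UNIV S" and SP: "\<And>h. S (P h) = P (S h)"
    and lift: "toeplitz_lift S T"
  shows "J (adj S k) = adj_on K T (J k)"
proof -
  note T = lift_bounded[OF lift]
  have adjP: "cinner ((P ^^ m) h) k = cinner h ((adj P ^^ m) k)" for m h k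
  proof (induction m arbitrary: k)
    case (Suc m)
    have "cinner ((P ^^ Suc m) h) k = cinner ((P ^^ m) h) (adj P k)"
      using cinner_adj_on[OF csubspace_UNIV closed_UNIV P] by simp
    then show ?case by (simp add: Suc.IH funpow_swap1)
  qed simp
  have SPm: "S ((P ^^ m) h) = (P ^^ m) (S h)" for m h by (induction m) (simp_all add: SP)
  note adjS = cinner_adj_on[OF csubspace_UNIV closed_UNIV S UNIV_I]
  have "adj_on K T (J k) - J (adj S k) = 0"
  proof (rule orthogonal_to_dilation)
    show "adj_on K T (J k) - J (adj S k) \<in> K"
      by (intro csubspace_diff[OF K] adj_on_in[OF K closed T] J_mem)
    fix m h
    have TJ: "T (J h) \<in> K" by (rule bounded_op_on_in[OF T J_mem])
    have "cinner ((V ^^ m) (J h)) (adj_on K T (J k)) = cinner (T ((V ^^ m) (J h))) (J k)"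
      by (rule cinner_adj_on[OF K closed T V_power_mem[OF J_mem], symmetric])
    also have "\<dots> = cinner ((V ^^ m) (T (J h))) (J k)" by (simp add: lift_V_power[OF lift J_mem])
    also have "\<dots> = cinner (S h) ((adj P ^^ m) k)" by (simp add: cinner_V_power_J[OF TJ] lift_compression[OF lift])
    also have "\<dots> = cinner ((P ^^ m) (S h)) k" by (simp add: adjP)
    also have "\<dots> = cinner ((P ^^ m) h) (adj S k)" by (simp add: SPm[symmetric] adjS)
    also have "\<dots> = cinner ((V ^^ m) (J h)) (J (adj S k))"
      by (simp add: adjP cinner_V_power_J[OF J_mem] cinner_J)
    finally show "cinner ((V ^^ m) (J h)) (adj_on K T (J k) - J (adj S k)) = 0"
      by (simp add: cinner_diff_right)
  qed
  then show ?thesis by simp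
qed

text \<open>\<open>T\<close> is a Toeplitz operator with respect to \<open>V\<close>, so \<open>\<langle>TV\<^sup>mJh, V\<^sup>nJk\<rangle>\<close> depends only on \<open>m - n\<close>. For
  \<open>m \<ge> n\<close> it is determined by the compression, and \<open>T = T\<^sup>*V\<close> reduces the case \<open>m < n\<close> to the case
  \<open>m \<ge> n\<close>.\<close>

lemma toeplitz_lift_unique:
  assumes S: "bounded_op_on UNIV S" and SP: "\<And>h. S (P h) = P (S h)"
    and lift: "toeplitz_lift S T" and lift': "toeplitz_lift S T'" and x: "x \<in> K"
  shows "T x = T' x"
proof -
  note T = lift_bounded[OF lift] and T' = lift_bounded[OF lift']
  have lower: "cinner (R ((V ^^ j) (J h))) (J k) = cinner ((V ^^ j) (J h)) (J (adj S k))"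
    if R: "toeplitz_lift S R" for R j h k
    using cinner_adj_on[OF K closed lift_bounded[OF R] V_power_mem[OF J_mem]]
      adj_compression[OF S SP R] by simp
  have entry: "cinner (R ((V ^^ m) (J h))) ((V ^^ n) (J k)) =
      (if n \<le> m then cinner ((V ^^ (m - n)) (J h)) (J (adj S k))
       else cnj (cinner ((V ^^ (n - m - 1)) (J k)) (J (adj S h))))"
    if R: "toeplitz_lift S R" for R m n h k
  proof (cases "n \<le> m")
    case True
    then have "(V ^^ m) (J h) = (V ^^ n) ((V ^^ (m - n)) (J h))"
      by (metis comp_apply funpow_add le_add_diff_inverse)
    then have "R ((V ^^ m) (J h)) = (V ^^ n) (R ((V ^^ (m - n)) (J h)))"
      by (simp add: lift_V_power[OF R V_power_mem[OF J_mem]])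
    then show ?thesis
      using True lower[OF R]
        cinner_V_power[OF bounded_op_on_in[OF lift_bounded[OF R] V_power_mem[OF J_mem]] J_mem]
      by simp
  next
    case False
    define j where "j = n - m - 1"
    have n: "n = m + Suc j" using False by (simp add: j_def)
    have Rj: "R ((V ^^ j) (J k)) \<in> K"
      by (rule bounded_op_on_in[OF lift_bounded[OF R] V_power_mem[OF J_mem]])
    have "cinner (R ((V ^^ m) (J h))) ((V ^^ n) (J k))
        = cinner ((V ^^ m) (R (J h))) ((V ^^ m) ((V ^^ Suc j) (J k)))"
      by (simp only: lift_V_power[OF R J_mem] n funpow_add comp_apply)
    also have "\<dots> = cinner (R (J h)) ((V ^^ Suc j) (J k))"
      by (rule cinner_V_power[OF bounded_op_on_in[OF lift_bounded[OF R] J_mem] V_power_mem[OF J_mem]])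
    also have "\<dots> = cinner (V (J h)) (R (V ((V ^^ j) (J k))))"
      by (simp add: lift_relation[OF R J_mem V_power_mem[OF J_mem, of "Suc j", simplified]])
    also have "\<dots> = cinner (J h) (R ((V ^^ j) (J k)))"
      by (simp add: lift_commute[OF R V_power_mem[OF J_mem]] V_isometric[OF J_mem Rj])
    also have "\<dots> = cnj (cinner (R ((V ^^ j) (J k))) (J h))" by (rule cinner_commute)
    also have "\<dots> = cnj (cinner ((V ^^ j) (J k)) (J (adj S h)))" by (simp add: lower[OF R])
    finally show ?thesis using False by (simp add: j_def)
  qed
  note e = entry[OF lift] entry[OF lift']
  \<comment> \<open>Passing to the adjoints and back carries the equality of matrix entries from the spanning
    vectors to all of \<open>K\<close>, first in the right and then in the left argument.\<close>
  have adj_eq: "adj_on K T ((V ^^ n) (J k)) = adj_on K T' ((V ^^ n) (J k))" for n k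
  proof -
    let ?y = "(V ^^ n) (J k)"
    have "adj_on K T ?y - adj_on K T' ?y = 0"
    proof (rule orthogonal_to_dilation)
      show "adj_on K T ?y - adj_on K T' ?y \<in> K"
        by (intro csubspace_diff[OF K] adj_on_in[OF K closed] T T')
      fix m h
      show "cinner ((V ^^ m) (J h)) (adj_on K T ?y - adj_on K T' ?y) = 0"
        using cinner_adj_on[OF K closed T V_power_mem[OF J_mem], of m h ?y]
          cinner_adj_on[OF K closed T' V_power_mem[OF J_mem], of m h ?y]
        by (simp add: cinner_diff_right e)
    qed
    then show ?thesis by simp
  qed
  have "T x - T' x = 0"
  proof (rule orthogonal_to_dilation)
    show "T x - T' x \<in> K"
      using x by (intro csubspace_diff[OF K] bounded_op_on_in[OF T] bounded_op_on_in[OF T'])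
    fix m h
    have "cinner (T x) ((V ^^ m) (J h)) = cinner (T' x) ((V ^^ m) (J h))"
      by (simp add: cinner_adj_on[OF K closed T x] cinner_adj_on[OF K closed T' x] adj_eq)
    then have "cinner (T x - T' x) ((V ^^ m) (J h)) = 0" by (simp add: cinner_diff_left)
    then show "cinner ((V ^^ m) (J h)) (T x - T' x) = 0" by (metis cinner_commute complex_cnj_zero)
  qed
  then show ?thesis by simp
qed

end


section \<open>The Sz.-Nagy--Foias model space\<close>

text \<open>The supremum is taken in \<open>\<real>\<close>, so its bound says something only because boundedness of \<open>A\<close>
  bounds the set above.\<close>

lemma cmod_cinner_le_numerical_radius:
  assumes E: "csubspace E" and A: "bounded_op_on E A" and w: "numerical_radius_on E A \<le> 1" and h: "h \<in> E"
  shows "cmod (cinner (A h) h) \<le> (norm h)\<^sup>2"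
proof (cases "h = 0")
  case False
  obtain B where B: "B > 0" "\<And>x. x \<in> E \<Longrightarrow> norm (A x) \<le> B * norm x"
    using bounded_op_on_bound[OF A] by blast
  let ?X = "{cmod (cinner (A h) h) | h. h \<in> E \<and> norm h \<le> 1}"
  have "bdd_above ?X"
  proof (rule bdd_aboveI[where M = B])
    fix r assume "r \<in> ?X"
    then obtain x where x: "x \<in> E" "norm x \<le> 1" "r = cmod (cinner (A x) x)" by blast
    have "r \<le> norm (A x) * norm x" unfolding x(3) by (rule cmod_cinner_le)
    also have "\<dots> \<le> (B * 1) * 1"
    proof (intro mult_mono x(2))
      have "B * norm x \<le> B * 1" using x(2) B(1) by (intro mult_left_mono) auto
      then show "norm (A x) \<le> B * 1" using B(2)[OF x(1)] by linarith
    qed (use B in auto)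
    finally show "r \<le> B" by simp
  qed
  define g where "g = complex_of_real (1 / norm h) *\<^sub>C h"
  have g: "g \<in> E" "norm g \<le> 1"
    using False csubspace_scaleC[OF E h] by (auto simp: g_def norm_scaleC norm_divide)
  have "cmod (cinner (A g) g) \<le> 1"
    using cSup_upper[OF _ \<open>bdd_above ?X\<close>, of "cmod (cinner (A g) g)"] w g
    unfolding numerical_radius_on_def by fastforce
  moreover have "cmod (cinner (A g) g) = cmod (cinner (A h) h) / (norm h)\<^sup>2"
    unfolding g_def bounded_op_on_scaleC[OF A h] cinner_scaleC_left cinner_scaleC_right
    by (simp add: norm_mult norm_divide power2_eq_square)
  ultimately show ?thesis using False by (simp add: divide_le_eq)
qed simp

lemma cmod_cinner_hardy_tensor_le:
  assumes A: "bounded_op_on E A" and w: "\<And>h. h \<in> E \<Longrightarrow> cmod (cinner (A h) h) \<le> (norm h)\<^sup>2"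
    and f: "f \<in> hardy_in E"
  shows "cmod (cinner (hardy_tensor A f) f) \<le> (norm f)\<^sup>2"
proof -
  have le: "norm (cinner (A (coef f n)) (coef f n)) \<le> (norm (coef f n))\<^sup>2" for n
    using f w by (simp add: hardy_in_iff)
  have summ: "summable (\<lambda>n. norm (cinner (A (coef f n)) (coef f n)))"
    by (rule summable_comparison_test'[OF summable_coef[of f], of 0]) (simp add: le)
  have "cmod (cinner (hardy_tensor A f) f) = cmod (\<Sum>n. cinner (A (coef f n)) (coef f n))"
    by (simp add: cinner_hardy.rep_eq coef_hardy_tensor[OF A f])
  also have "\<dots> \<le> (\<Sum>n. norm (cinner (A (coef f n)) (coef f n)))" by (rule summable_norm[OF summ])
  also have "\<dots> \<le> (norm f)\<^sup>2"
    unfolding norm_hardy_sq by (intro suminf_le le summ summable_coef)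
  finally show ?thesis .
qed

lemma cinner_L2_Meit: "cinner (L2_Meit f) (L2_Meit g) = cinner f g"
proof transfer
  fix f g :: "real \<Rightarrow> 'a"
  have "cinner (cis t *\<^sub>C f t) (cis t *\<^sub>C g t) = cinner (f t) (g t)" for t
  proof -
    have "cinner (cis t *\<^sub>C f t) (cis t *\<^sub>C g t) = (cis t * cnj (cis t)) * cinner (f t) (g t)"
      by (simp add: cinner_scaleC_left cinner_scaleC_right del: cis_cnj)
    also have "cis t * cnj (cis t) = 1" by (simp add: cis_cnj cis_mult)
    finally show ?thesis by simp
  qed
  then show "(\<integral>t. cinner (cis t *\<^sub>C f t) (cis t *\<^sub>C g t) \<partial>circle) = (\<integral>t. cinner (f t) (g t) \<partial>circle)"
    by simp
qed

lemma sq_integrable_cis: "sq_integrable f \<Longrightarrow> sq_integrable (\<lambda>t. (c * cis t) *\<^sub>C f t)"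
proof (rule sq_integrable_scaleC[where B = "cmod c"])
  have "(\<lambda>t. c * cis t) \<in> borel_measurable borel"
    by (intro borel_measurable_continuous_onI continuous_on_mult continuous_on_const continuous_on_cis
        continuous_on_id)
  then show "(\<lambda>t. c * cis t) \<in> borel_measurable circle"
    by (simp add: measurable_cong_sets[OF sets_circle refl])
qed (simp_all add: norm_mult)

lemma L2_Meit_add: "L2_Meit (f + g) = L2_Meit f + L2_Meit g"
proof transfer
  fix f g :: "real \<Rightarrow> 'a"
  assume fg: "L2rel f f" "L2rel g g"
  then have "sq_integrable f" "sq_integrable g" by (auto simp: L2rel_def)
  then have "sq_integrable (\<lambda>t. cis t *\<^sub>C f t + cis t *\<^sub>C g t)"
    using sq_integrable_cis[of f 1] sq_integrable_cis[of g 1] by (simp add: sq_integrable_add)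
  then show "L2rel (\<lambda>t. cis t *\<^sub>C (f t + g t)) (\<lambda>t. cis t *\<^sub>C f t + cis t *\<^sub>C g t)"
    by (simp add: L2rel_def scaleC_add_right)
qed

lemma L2_Meit_scaleC: "L2_Meit (c *\<^sub>C f) = c *\<^sub>C L2_Meit f"
  by transfer (auto simp: L2rel_def scaleC_scaleC mult.commute intro: sq_integrable_cis)

lemma cinner_model_P: "cinner (model_P x) (model_P y) = cinner x y"
  by (simp add: model_P_def cinner_prod_def cinner_hardy_Mz cinner_L2_Meit map_prod_def split: prod.split)

lemma bounded_linear_model_P: "bounded_linear model_P"
proof (rule bounded_linear_intro[where K = 1])
  show "norm (model_P x) \<le> norm x * 1" for x :: "'a hardy \<times> 'a L2"
    using norm_eq_if_cinner_eq[OF cinner_model_P[of x x]] by simp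
qed (auto simp: model_P_def hardy_Mz_add L2_Meit_add hardy_Mz_scaleC L2_Meit_scaleC scaleR_scaleC scaleC_prod_def)


lemma closed_csubspace_vimage:
  assumes \<phi>: "bounded_linear \<phi>" "\<And>c x. \<phi> (c *\<^sub>C x) = c *\<^sub>C \<phi> x" and C: "csubspace C" "closed C"
  shows "csubspace (\<phi> -` C)" "closed (\<phi> -` C)"
proof -
  have "\<phi> 0 = 0" "\<phi> (x + y) = \<phi> x + \<phi> y" for x y
    using linear_0[OF bounded_linear.linear[OF \<phi>(1)]] linear_add[OF bounded_linear.linear[OF \<phi>(1)]] by auto
  then show "csubspace (\<phi> -` C)"
    unfolding csubspace_def by (auto simp: \<phi>(2) intro: csubspace_0 csubspace_add csubspace_scaleC C)
  show "closed (\<phi> -` C)"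
    using continuous_closed_vimage[OF C(2)] linear_continuous_at[OF \<phi>(1)] by blast
qed

lemma bounded_linear_dense_vimage:
  assumes \<phi>: "bounded_linear \<phi>" and C: "closed C" and D: "closure D = UNIV"
    and sub: "\<And>c. c \<in> D \<Longrightarrow> \<phi> c \<in> C"
  shows "\<phi> a \<in> C"
proof -
  have "\<phi> ` closure D \<subseteq> C"
    by (rule image_closure_subset[OF linear_continuous_on[OF \<phi>] C]) (use sub in blast)
  then show ?thesis using D by blast
qed

lemma hardy_single_total:
  assumes C: "csubspace C" "closed C" and s: "\<And>k a. hardy_single k a \<in> C"
  shows "f \<in> C"
proof (rule closed_sequentially[OF C(2) _ hardy_sums_single])
  show "(\<Sum>k<n. hardy_single k (coef f k)) \<in> C" for n by (intro csubspace_sum[OF C(1)] s)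
qed

lemma bounded_linear_hardy_single: "bounded_linear (hardy_single k)"
proof (rule bounded_linear_intro[where K = 1])
  fix a :: 'a
  show "norm (hardy_single k a) \<le> norm a * 1"
  proof (rule norm_hardy_le_if_partial_sums_le)
    fix N
    have "(\<Sum>n<N. (norm (coef (hardy_single k a) n))\<^sup>2) = (\<Sum>n<N. if n = k then (norm a)\<^sup>2 else 0)"
      by (rule sum.cong) auto
    then show "(\<Sum>n<N. (norm (coef (hardy_single k a) n))\<^sup>2) \<le> (norm a * 1)\<^sup>2" by simp
  qed simp
qed (simp_all add: hardy_single_add hardy_single_scaleC scaleR_scaleC)

lemma bounded_linear_funpow:
  fixes f :: "'a::real_normed_vector \<Rightarrow> 'a"
  shows "bounded_linear f \<Longrightarrow> bounded_linear (f ^^ n)"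
proof (induction n)
  case (Suc n)
  then show ?case using bounded_linear_compose[of f "f ^^ n"] by (simp add: comp_def)
qed (simp add: id_def bounded_linear_ident)

lemma isometry_UNIV_bounded_linear:
  assumes "isometry_on UNIV K J"
  shows "bounded_linear J"
  using assms
  by (intro bounded_linear_intro[where K = 1]) (auto simp: isometry_on_def clinear_on_def scaleR_scaleC)

text \<open>The unitary extension acts on \<open>\<ell>\<^sup>2(\<int>) \<otimes> E\<close> plus the residual space, by the bilateral shift \<open>W\<close>,
  the pencil \<open>A + A\<^sup>*W\<close>, and the given \<open>\<Gamma>\<close>-unitary.\<close>

lemma gamma_isometry_on_model:
  fixes E :: "'h::{chilbert_space, second_countable_topology} set" and D :: "'h L2 set"
    and J :: "'h \<Rightarrow> 'h hardy \<times> 'h L2"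
  assumes E: "csubspace E" "closed E" and A: "adjoint_pair E A A'"
    and w: "\<And>h. h \<in> E \<Longrightarrow> cmod (cinner (A h) h) \<le> (norm h)\<^sup>2"
    and U: "gamma_unitary_on D U L2_Meit"
    and J: "isometry_on UNIV (hardy_in E \<times> D) J"
    and minimal: "hardy_in E \<times> D = closure (cspan {(model_P ^^ m) (J h) | m h. True})"
  shows "gamma_isometry_on (hardy_in E \<times> D)
    (map_prod (pencil (hardy_tensor A) (hardy_tensor A') hardy_Mz) U) model_P"
proof -
  have bA: "bounded_op_on E A" "bounded_op_on E A'" using A by (auto simp: adjoint_pair_def)
  have D: "csubspace D" "closed D" and bU: "bounded_op_on D U" and bM: "bounded_op_on D L2_Meit"
    and UM: "\<And>x. x \<in> D \<Longrightarrow> U (L2_Meit x) = L2_Meit (U x)"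
    using U by (auto simp: gamma_unitary_on_def)
  note UD = gamma_unitary_onD[OF U cinner_L2_Meit]
  note H = csubspace_hardy_in[OF E(1)]
  note tensor = adjoint_pair_hardy_tensor[OF E(1) A]
  interpret analytic: pencil_operators "hardy_in E" "hardy_tensor A" "hardy_tensor A'" hardy_Mz
    by unfold_locales (auto simp: H tensor bounded_op_on_hardy_Mz[OF E(1)] cinner_hardy_Mz
        hardy_tensor_Mz[OF E(1) bA(1)] hardy_tensor_Mz[OF E(1) bA(2)])
  let ?T = "\<lambda>B. map_prod (hardy_tensor B) (hardy_tensor B)"
  have T0: "hardy_tensor B 0 = 0" if B: "bounded_op_on E B" for B
    by (rule bounded_op_on_zero[OF H bounded_op_on_hardy_tensor[OF E(1) B]])
  have tensor_shift: "?T B (bilateral_shift x) = bilateral_shift (?T B x)"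
    if B: "bounded_op_on E B" and x: "x \<in> hardy_in E \<times> hardy_in E" for B x
  proof -
    have f: "fst x \<in> hardy_in E" and g: "snd x \<in> hardy_in E" using x by auto
    have "hardy_tensor B (hardy_Mz (fst x) + hardy_single 0 (coef (snd x) 0))
        = hardy_Mz (hardy_tensor B (fst x)) + hardy_single 0 (coef (hardy_tensor B (snd x)) 0)"
      by (rule hardy_eqI)
        (simp add: coef_hardy_tensor[OF B Mz_plus_single_in[OF E(1) f g]] coef_hardy_tensor[OF B f]
          coef_hardy_tensor[OF B g] hardy_Mz.rep_eq split: nat.split)
    moreover have "hardy_tensor B (backward_shift (snd x)) = backward_shift (hardy_tensor B (snd x))"
      by (rule hardy_eqI)
        (simp add: coef_hardy_tensor[OF B backward_shift_in[OF g]] coef_hardy_tensor[OF B g])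
    ultimately show ?thesis by (simp add: bilateral_shift_def map_prod_def split_beta)
  qed
  have bil: "pencil_operators (hardy_in E \<times> hardy_in E) (?T A) (?T A') bilateral_shift"
    by unfold_locales
      (simp_all only: csubspace_Times[OF H H] adjoint_pair_map_prod[OF tensor tensor]
        bounded_op_on_bilateral_shift[OF E(1)] cinner_bilateral_shift tensor_shift[OF bA(1)] tensor_shift[OF bA(2)])
  interpret bilateral: pencil_operators "hardy_in E \<times> hardy_in E" "?T A" "?T A'" bilateral_shift
    by (rule bil)
  let ?B = "pencil (?T A) (?T A') bilateral_shift"
  have clH: "closed (hardy_in E)" by (rule closed_hardy_in[OF E(2)])
  have B2: "norm (?B x) \<le> 2 * norm x" if x: "x \<in> hardy_in E \<times> hardy_in E" for x
  proof (rule norm_pencil_le[OF bil closed_Times[OF clH clH] bilateral_shift_onto[OF E(1)] _ x])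
    fix y assume y: "y \<in> hardy_in E \<times> hardy_in E"
    have "cmod (cinner (?T A y) y)
        \<le> cmod (cinner (hardy_tensor A (fst y)) (fst y)) + cmod (cinner (hardy_tensor A (snd y)) (snd y))"
      unfolding cinner_prod_def fst_map_prod snd_map_prod by (rule norm_triangle_ineq)
    also have "\<dots> \<le> (norm (fst y))\<^sup>2 + (norm (snd y))\<^sup>2"
      using y by (intro add_mono cmod_cinner_hardy_tensor_le[OF bA(1) w]) auto
    finally show "cmod (cinner (?T A y) y) \<le> (norm y)\<^sup>2" by (simp add: norm_prod_sq[of y])
  qed
  obtain X :: "'h set" where X: "countable X" "\<And>G. open G \<Longrightarrow> G \<noteq> {} \<Longrightarrow> \<exists>x\<in>X. x \<in> G"
    using countable_dense_exists[where 'a = 'h] by auto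
  have clX: "closure X = UNIV"
  proof -
    have "UNIV - closure X = {}"
      using X(2)[of "UNIV - closure X"] closure_subset[of X] by (auto simp: open_Diff)
    then show ?thesis by blast
  qed
  \<comment> \<open>A countable total set: monomials with coefficients from the dense set \<open>X\<close> in the two sequence
    components; in the residual component, the parts of \<open>V\<^sup>mJc\<close>, which are total because the dilation is
    minimal.\<close>
  define Z :: "(('h hardy \<times> 'h hardy) \<times> 'h L2) set" where
    "Z = (\<Union>n. (\<lambda>c. ((hardy_single n c, 0), 0)) ` X) \<union> (\<Union>n. (\<lambda>c. ((0, hardy_single n c), 0)) ` X)
      \<union> (\<Union>m. (\<lambda>c. ((0, 0), snd ((model_P ^^ m) (J c)))) ` X)"
  have "X \<noteq> {}" using clX by auto
  then have "Z \<noteq> {}" "countable Z" using X(1) by (auto simp: Z_def)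
  then have Z: "range (from_nat_into Z) = Z" by (rule range_from_nat_into)
  let ?C = "closure (cspan Z)"
  have C: "csubspace ?C" "closed ?C" by (auto intro: csubspace_closure csubspace_cspan)
  have ZC: "z \<in> Z \<Longrightarrow> z \<in> ?C" for z using hull_subset[of Z csubspace] closure_subset by blast
  have total: "hardy_in E \<times> hardy_in E \<times> D \<subseteq> {(f, g, u). ((f, g), u) \<in> ?C}"
  proof -
    have hardy: "\<phi> f \<in> ?C"
      if \<phi>: "bounded_linear \<phi>" "\<And>c x. \<phi> (c *\<^sub>C x) = c *\<^sub>C \<phi> x"
        and single: "\<And>k c. c \<in> X \<Longrightarrow> \<phi> (hardy_single k c) \<in> Z"
      for \<phi> :: "'h hardy \<Rightarrow> ('h hardy \<times> 'h hardy) \<times> 'h L2" and f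
    proof -
      have "\<phi> (hardy_single k a) \<in> ?C" for k a
        by (rule bounded_linear_dense_vimage[OF bounded_linear_compose[OF \<phi>(1) bounded_linear_hardy_single] C(2) clX])
          (intro ZC single)
      then show ?thesis using hardy_single_total[OF closed_csubspace_vimage[OF \<phi> C], of f] by simp
    qed
    have "((f, 0), 0) \<in> ?C" "((0, f), 0) \<in> ?C" for f
      by (rule hardy[of "\<lambda>f. ((f, 0), 0)"] hardy[of "\<lambda>f. ((0, f), 0)"];
          auto simp: Z_def scaleC_prod_def
            intro!: bounded_linear_Pair bounded_linear_ident bounded_linear_zero)+
    moreover have "((0, 0), u) \<in> ?C" if u: "u \<in> D" for u
    proof -
      let ?\<phi> = "\<lambda>x::'h hardy \<times> 'h L2. ((0, 0), snd x) :: ('h hardy \<times> 'h hardy) \<times> 'h L2"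
      have \<phi>: "bounded_linear ?\<phi>" "\<And>c x. ?\<phi> (c *\<^sub>C x) = c *\<^sub>C ?\<phi> x"
        by (intro bounded_linear_Pair bounded_linear_snd bounded_linear_zero) (simp add: scaleC_prod_def)
      have bl: "bounded_linear (\<lambda>h. ?\<phi> ((model_P ^^ m) (J h)))" for m
        by (intro bounded_linear_compose[OF \<phi>(1)]
            bounded_linear_compose[OF bounded_linear_funpow[OF bounded_linear_model_P]] isometry_UNIV_bounded_linear[OF J])
      have "?\<phi> ((model_P ^^ m) (J h)) \<in> ?C" for m h
        by (rule bounded_linear_dense_vimage[OF bl C(2) clX]) (rule ZC, auto simp: Z_def)
      then have "cspan {(model_P ^^ m) (J h) | m h. True} \<subseteq> ?\<phi> -` ?C"
        by (intro hull_minimal closed_csubspace_vimage[OF \<phi> C]) auto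
      then have "closure (cspan {(model_P ^^ m) (J h) | m h. True}) \<subseteq> ?\<phi> -` ?C"
        by (rule closure_minimal) (rule closed_csubspace_vimage[OF \<phi> C])
      then have "hardy_in E \<times> D \<subseteq> ?\<phi> -` ?C" by (simp only: minimal[symmetric])
      moreover have "(0, u) \<in> hardy_in E \<times> D" using u csubspace_0[OF H] by simp
      ultimately show ?thesis by force
    qed
    ultimately have "((f, 0), 0) + ((0, g), 0) + ((0, 0), u) \<in> ?C" if "u \<in> D" for f g u
      using that by (intro csubspace_add[OF C(1)])
    then show ?thesis by auto
  qed
  have bP: "bounded_op_on (hardy_in E \<times> D) model_P"
    unfolding model_P_def by (rule bounded_op_on_map_prod[OF bounded_op_on_hardy_Mz[OF E(1)] bM])
  show ?thesis
  proof (rule gamma_isometry_on_if_extension[where L = "(hardy_in E \<times> hardy_in E) \<times> D"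
        and d = "from_nat_into Z" and S' = "map_prod ?B U" and P' = "map_prod bilateral_shift L2_Meit"
        and J = "\<lambda>x. ((fst x, 0), snd x)"])
    show "bounded_op_on (hardy_in E \<times> D) (map_prod (pencil (hardy_tensor A) (hardy_tensor A') hardy_Mz) U)"
      by (rule bounded_op_on_map_prod[OF analytic.bounded_pencil bU])
    show "bounded_op_on (hardy_in E \<times> D) model_P" by (rule bP)
    show "csubspace ((hardy_in E \<times> hardy_in E) \<times> D)" by (intro csubspace_Times H D)
    show "closed ((hardy_in E \<times> hardy_in E) \<times> D)" by (intro closed_Times clH D)
    show "(hardy_in E \<times> hardy_in E) \<times> D \<subseteq> closure (cspan (range (from_nat_into Z)))"
      unfolding Z using total by auto
    show "bounded_op_on ((hardy_in E \<times> hardy_in E) \<times> D) (map_prod ?B U)"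
      by (rule bounded_op_on_map_prod[OF bilateral.bounded_pencil bU])
    show "bounded_op_on ((hardy_in E \<times> hardy_in E) \<times> D) (map_prod bilateral_shift L2_Meit)"
      by (rule bounded_op_on_map_prod[OF bounded_op_on_bilateral_shift[OF E(1)] bM])
    show "map_prod bilateral_shift L2_Meit ` ((hardy_in E \<times> hardy_in E) \<times> D) = (hardy_in E \<times> hardy_in E) \<times> D"
      by (rule map_prod_surj_on[OF bilateral_shift_onto[OF E(1)] UD(1)])
    show "isometry_on (hardy_in E \<times> D) ((hardy_in E \<times> hardy_in E) \<times> D) (\<lambda>x. ((fst x, 0), snd x))"
      using csubspace_0[OF H] by (auto simp: isometry_on_def clinear_on_def scaleC_prod_def norm_prod_def)
  next
    fix x assume "x \<in> hardy_in E \<times> D"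
    then obtain f u where x: "x = (f, u)" "f \<in> hardy_in E" "u \<in> D" by auto
    show "map_prod (pencil (hardy_tensor A) (hardy_tensor A') hardy_Mz) U (model_P x)
        = model_P (map_prod (pencil (hardy_tensor A) (hardy_tensor A') hardy_Mz) U x)"
      using x by (simp add: model_P_def analytic.pencil_commute UM)
    have shift: "bilateral_shift (f, 0) = (hardy_Mz f, 0)"
      unfolding bilateral_shift_def by (rule prod_eqI) (auto intro: hardy_eqI)
    show "((fst (model_P x), 0), snd (model_P x)) = map_prod bilateral_shift L2_Meit ((fst x, 0), snd x)"
      by (simp add: x model_P_def shift)
    show "((fst (map_prod (pencil (hardy_tensor A) (hardy_tensor A') hardy_Mz) U x), 0),
          snd (map_prod (pencil (hardy_tensor A) (hardy_tensor A') hardy_Mz) U x))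
        = map_prod ?B U ((fst x, 0), snd x)"
      by (simp add: x pencil_def shift T0[OF bA(1)] T0[OF bA(2)])
  next
    fix x assume "x \<in> (hardy_in E \<times> hardy_in E) \<times> D"
    then obtain f u where x: "x = (f, u)" "f \<in> hardy_in E \<times> hardy_in E" "u \<in> D" by auto
    show "map_prod ?B U (map_prod bilateral_shift L2_Meit x) = map_prod bilateral_shift L2_Meit (map_prod ?B U x)"
      unfolding x(1) map_prod_simp bilateral.pencil_commute[OF x(2)] UM[OF x(3)] ..
    show "norm (map_prod ?B U x) \<le> 2 * norm x"
      by (rule norm_map_prod_le) (simp_all add: x(1) B2[OF x(2)] UD(3)[OF x(3)])
    fix y assume "y \<in> (hardy_in E \<times> hardy_in E) \<times> D"
    then obtain g v where y: "y = (g, v)" "g \<in> hardy_in E \<times> hardy_in E" "v \<in> D" by auto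
    show "cinner (map_prod bilateral_shift L2_Meit x) (map_prod bilateral_shift L2_Meit y) = cinner x y"
      unfolding x(1) y(1) map_prod_simp
      by (subst (1 2) cinner_prod_def) (simp add: cinner_bilateral_shift cinner_L2_Meit)
    show "cinner (map_prod ?B U x) y = cinner (map_prod bilateral_shift L2_Meit x) (map_prod ?B U y)"
      unfolding x(1) y(1) map_prod_simp
      by (subst (1 2) cinner_prod_def)
        (simp add: bilateral.cinner_pencil[OF x(2) y(2)] UD(2)[OF x(3) y(3)])
  qed
qed


text \<open>The defect space is defined through a choice of square roots; that it is a linear subspace is
  read off from the model space, which is a closed linear span, by looking at constant functions.\<close>

lemma csubspace_coefficients:
  assumes HD: "csubspace (hardy_in E \<times> D)"
  shows "csubspace E"
proof -
  have 0: "0 \<in> E" "0 \<in> D"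
    using csubspace_0[OF HD] by (auto simp: zero_prod_def hardy_in_iff)
  have single: "(hardy_single 0 a, 0) \<in> hardy_in E \<times> D" if "a \<in> E" for a
    using that 0 by (auto simp: hardy_in_iff)
  show ?thesis
    unfolding csubspace_def
  proof (intro conjI ballI allI 0)
    fix a b assume "a \<in> E" "b \<in> E"
    then have "(hardy_single 0 a, 0) + (hardy_single 0 b, 0) \<in> hardy_in E \<times> D"
      by (intro csubspace_add[OF HD] single)
    then have "hardy_single 0 a + hardy_single 0 b \<in> hardy_in E" by simp
    then have "coef (hardy_single 0 a + hardy_single 0 b) 0 \<in> E" unfolding hardy_in_iff by blast
    then show "a + b \<in> E" by simp
  next
    fix c a assume "a \<in> E"
    then have "c *\<^sub>C (hardy_single 0 a, 0) \<in> hardy_in E \<times> D"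
      by (intro csubspace_scaleC[OF HD] single)
    then have "c *\<^sub>C hardy_single 0 a \<in> hardy_in E" by (simp add: scaleC_prod_def)
    then have "coef (c *\<^sub>C hardy_single 0 a) 0 \<in> E" unfolding hardy_in_iff by blast
    then show "c *\<^sub>C a \<in> E" by simp
  qed
qed

lemma bounded_op_on_cong:
  assumes "csubspace K" "bounded_op_on K T" "\<And>x. x \<in> K \<Longrightarrow> T' x = T x"
  shows "bounded_op_on K T'"
  using assms(2,3) csubspace_add[OF assms(1)] csubspace_scaleC[OF assms(1)]
  by (auto simp: bounded_op_on_def clinear_on_def)

lemma unitarily_equiv_on_if_eq:
  assumes "\<And>x. x \<in> K \<Longrightarrow> A x = B x"
  shows "unitarily_equiv_on K A B"
  unfolding unitarily_equiv_on_def
  by (rule exI[of _ id]) (simp add: assms isometry_on_def clinear_on_def)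

theorem theorem5p6:
  fixes S P :: "'h::{chilbert_space, second_countable_topology} \<Rightarrow> 'h"
    and Pi_NF :: "'h \<Rightarrow> 'h hardy \<times> 'h L2"
    and A :: "'h \<Rightarrow> 'h" and U :: "'h L2 \<Rightarrow> 'h L2"
  assumes "gamma_contraction S P" and "cnu P"
    and "NF_dilation P Pi_NF"
    and "representing S P Pi_NF A U"
  shows "(\<forall>A' U'. representing S P Pi_NF A' U' \<longrightarrow>
            unitarily_equiv_on (defect_star_space P) A A' \<and>
            unitarily_equiv_on (Delta_space P) U U') \<and>
         min_gamma_isometric_dilation S P (HP P) (model_S P A U) model_P Pi_NF"
proof -
  define E where "E = defect_star_space P"
  define D where "D = Delta_space P"
  define J where "J = Pi_NF"
  have HP: "HP P = hardy_in E \<times> D" by (simp add: HP_def E_def D_def)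
  have bS: "bounded_op_on UNIV S" and bP: "bounded_op_on UNIV P" and SP: "S (P h) = P (S h)" for h
    using assms(1) by (auto simp: gamma_contraction_def)
  have J: "isometry_on UNIV (hardy_in E \<times> D) J" and ran: "range J = QP P"
    and JP: "J (adj P h) = adj_on (hardy_in E \<times> D) model_P (J h)"
    and min: "hardy_in E \<times> D = closure (cspan {(model_P ^^ m) (J h) | m h. True})" for h
    using assms(3) unfolding NF_dilation_def J_def[symmetric] HP by blast+
  have HD: "csubspace (hardy_in E \<times> D)"
    by (subst min) (intro csubspace_closure csubspace_cspan)
  have E: "csubspace E" by (rule csubspace_coefficients[OF HD])
  have clE: "closed E" by (simp add: E_def defect_star_space_def)
  have clK: "closed (hardy_in E \<times> D)" by (subst min) simp
  note H = csubspace_hardy_in[OF E]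
  have QP: "csubspace (QP P)" "closed (QP P)"
  proof -
    have sub: "csubspace {x. \<forall>y\<in>SP P. cinner x y = 0}"
      unfolding csubspace_def by (auto simp: cinner_add_left cinner_scaleC_left)
    have "QP P = hardy_in E \<times> D \<inter> {x. \<forall>y\<in>SP P. cinner x y = 0}" by (auto simp: QP_def HP)
    then show "csubspace (QP P)" using HD sub by (auto simp: csubspace_def)
    show "closed (QP P)"
      unfolding ran[symmetric]
      by (rule closed_isometric_image[OF csubspace_UNIV closed_UNIV isometry_UNIV_bounded_linear[OF J]])
        (use J in \<open>simp add: isometry_on_def\<close>)
  qed
  have bV: "bounded_op_on (hardy_in E \<times> D) model_P"
    using assms(4) bounded_op_on_map_prod[OF bounded_op_on_hardy_Mz[OF E]]
    by (auto simp: representing_def gamma_unitary_on_def D_def model_P_def)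
  note VK = bounded_op_on_in[OF bV]
  interpret isometric_dilation P "hardy_in E \<times> D" model_P J
    by (rule isometric_dilation.intro) (use HD clK bP bV J JP min cinner_model_P in \<open>blast+\<close>)
  have operators: "toeplitz_lift S (model_S P B W) \<and> gamma_isometry_on (hardy_in E \<times> D) (model_S P B W) model_P"
    if "representing S P J B W" for B W
  proof -
    have bB: "bounded_op_on E B" and w: "numerical_radius_on E B \<le> 1"
      and W: "gamma_unitary_on D W L2_Meit"
      and compression: "\<And>h. J (S h) = proj (QP P) (model_S P B W (J h))"
      using that by (auto simp: representing_def E_def D_def)
    define B' where "B' = adj_on E B"
    have B: "adjoint_pair E B B'" unfolding B'_def by (rule adjoint_pair_adj_on[OF E clE bB])
    then have bB': "bounded_op_on E B'" by (simp add: adjoint_pair_def)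
    have bW: "bounded_op_on D W" and WM: "\<And>x. x \<in> D \<Longrightarrow> W (L2_Meit x) = L2_Meit (W x)"
      using W by (auto simp: gamma_unitary_on_def)
    interpret pencil: pencil_operators "hardy_in E" "hardy_tensor B" "hardy_tensor B'" hardy_Mz
      by unfold_locales (auto simp: H adjoint_pair_hardy_tensor[OF E B] bounded_op_on_hardy_Mz[OF E] cinner_hardy_Mz
          hardy_tensor_Mz[OF E bB] hardy_tensor_Mz[OF E bB'])
    let ?T = "map_prod (pencil (hardy_tensor B) (hardy_tensor B') hardy_Mz) W"
    have T: "model_S P B W x = ?T x" if "x \<in> hardy_in E \<times> D" for x
      using that by (auto simp: model_S_def pencil_def pencil.A'V E_def[symmetric] B'_def[symmetric])
    have bT: "bounded_op_on (hardy_in E \<times> D) ?T" by (rule bounded_op_on_map_prod[OF pencil.bounded_pencil bW])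
    have cong: "bounded_op_on (hardy_in E \<times> D) (model_S P B W)"
      by (rule bounded_op_on_cong[OF HD bT T])
    have com: "model_S P B W (model_P x) = model_P (model_S P B W x)" if x: "x \<in> hardy_in E \<times> D" for x
      unfolding T[OF x] T[OF VK[OF x]] using x by (auto simp: model_P_def pencil.pencil_commute WM)
    have rel: "cinner (model_S P B W x) y = cinner (model_P x) (model_S P B W y)"
      if x: "x \<in> hardy_in E \<times> D" and y: "y \<in> hardy_in E \<times> D" for x y
      unfolding T[OF x] T[OF y] using x y gamma_unitary_onD(2)[OF W cinner_L2_Meit]
      by (auto simp: model_P_def cinner_prod_def pencil.cinner_pencil)
    have comp: "cinner (model_S P B W (J h)) (J k) = cinner (S h) k" for h k
    proof -
      have "cinner (J (S h)) (J k) = cinner (model_S P B W (J h)) (J k)"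
        unfolding compression by (rule cinner_proj[OF QP]) (simp add: ran[symmetric])
      then show ?thesis by (simp add: cinner_J)
    qed
    have "gamma_isometry_on (hardy_in E \<times> D) ?T model_P"
      by (rule gamma_isometry_on_model[OF E clE B cmod_cinner_le_numerical_radius[OF E bB w] W J min])
    then have "gamma_isometry_on (hardy_in E \<times> D) (model_S P B W) model_P"
      using cong com unfolding gamma_isometry_on_def by (simp add: T)
    then show ?thesis using cong com rel comp unfolding toeplitz_lift_def by blast
  qed
  have rep: "representing S P J A U" using assms(4) by (simp add: J_def)
  note opA = operators[OF rep]
  have adjS: "J (adj S h) = adj_on (hardy_in E \<times> D) (model_S P A U) (J h)" for h
    using adj_compression[OF bS SP] opA by blast
  have unique: "(\<forall>x\<in>E. A x = A' x) \<and> (\<forall>u\<in>D. U u = U' u)" if "representing S P J A' U'" for A' U'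
  proof -
    have eq: "model_S P A U x = model_S P A' U' x" if "x \<in> hardy_in E \<times> D" for x
      using toeplitz_lift_unique[OF bS SP _ _ that] opA operators[OF \<open>representing S P J A' U'\<close>] by blast
    have bA: "bounded_op_on E A" "bounded_op_on E A'" using rep that by (auto simp: representing_def E_def)
    \<comment> \<open>On the constant function \<open>a\<close> the constant coefficient of \<open>Aa + zA\<^sup>*a\<close> is \<open>Aa\<close>.\<close>
    have "A a = A' a" if a: "a \<in> E" for a
    proof -
      have s: "hardy_single 0 a \<in> hardy_in E" by (rule hardy_single_in[OF E a])
      then have "(hardy_single 0 a, 0) \<in> hardy_in E \<times> D"
        using csubspace_0[OF HD] by (auto simp: zero_prod_def)
      then have "fst (model_S P A U (hardy_single 0 a, 0)) = fst (model_S P A' U' (hardy_single 0 a, 0))"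
        using eq by simp
      then have "coef (fst (model_S P A U (hardy_single 0 a, 0))) 0 = coef (fst (model_S P A' U' (hardy_single 0 a, 0))) 0"
        by (rule arg_cong)
      then show ?thesis
        by (simp add: model_S_def coef_hardy_tensor[OF bA(1) s] coef_hardy_tensor[OF bA(2) s])
    qed
    moreover have "U u = U' u" if u: "u \<in> D" for u
    proof -
      have "(0, u) \<in> hardy_in E \<times> D" using u csubspace_0[OF H] by simp
      then have "snd (model_S P A U (0, u)) = snd (model_S P A' U' (0, u))" using eq by simp
      then show ?thesis by (simp add: model_S_def)
    qed
    ultimately show ?thesis by blast
  qed
  have "min_gamma_isometric_dilation S P (HP P) (model_S P A U) model_P Pi_NF"
    unfolding min_gamma_isometric_dilation_def HP J_def[symmetric]
    using opA J adjS JP min by blast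
  moreover have "unitarily_equiv_on (defect_star_space P) A A' \<and> unitarily_equiv_on (Delta_space P) U U'"
    if "representing S P Pi_NF A' U'" for A' U'
    using unique[of A' U'] that unfolding J_def E_def D_def by (blast intro: unitarily_equiv_on_if_eq)
  ultimately show ?thesis by blast
qed

end
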